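(* Let $f:X\to Y$ be a morphism between real algebraic varieties $X\subset\mathbb{R}^n$ and $Y\subset\mathbb{R}^m$ of the same dimension $d$, such that $f_{\mathbb{C}}:X(\mathbb{C})\to Y(\mathbb{C})$ is dominant and $\dim_{\mathbb{C}}X(\mathbb{C})=\dim_{\mathbb{C}}Y(\mathbb{C})=d$. Let $(W_\bullet,V_\bullet)$ be the Jelonek flag of $f$. Assume that $X_\bullet$ is a Whitney stratification of $X$ subordinate to $W_\bullet$ and that $Y_\bullet$ is a Whitney stratification of $Y$ subordinate to $V_\bullet$, such that $f$ is stratified with respect to $X_\bullet$ and $Y_\bullet$. Whenever $\dim V_i=\dim W_i$ holds, for every $Y_\bullet$-stratum $R\subset Y$ with $R\subset V_i-V_{i-1}$, the map $f|_{f^{-1}(R)}:f^{-1}(R)\to R$ is a locally trivial fiber bundle.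
   Context: Complexification: for a real variety $X$ given as the zero set of real polynomials, $X(\mathbb{C})$ is the complex variety defined by the same polynomials. A morphism $f:X\to Y$ of real varieties is given by a tuple of real polynomials, and $f_{\mathbb{C}}:X(\mathbb{C})\to Y(\mathbb{C})$ is given by the same tuple. A morphism is dominant if its image is dense in the target. The dimension of a real variety is the dimension of its manifold of smooth points. Jelonek set: $\mathbf{Jel}(f)\subset Y(\mathbb{C})$ is the set of points $y$ for which there is a sequence $\{x_k\}\subset X(\mathbb{C})$ with $\lim|x_k|=\infty$ and $\lim f_{\mathbb{C}}(x_k)=y$. It is either empty or an algebraic hypersurface of $Y(\mathbb{C})$ defined by a polynomial with real coefficients. Jelonek flag: the pair $(W_\bullet,V_\bullet)$ of flags of length $d$, $$\varnothing=W_{-1}\subset W_0\subset\cdots\subset W_d=X,\qquad \varnothing=V_{-1}\subset V_0\subset\cdots\subset V_d=Y,$$ defined by reverse induction on $i\in\{d-1,d-2,\dots,1,0\}$ as follows. Start with $V_{d-1}$ equal to the set of real points of $\mathbf{Jel}(f)$. Then $W_i:=\overline{f^{-1}(V_i)}$, and $V_{i-1}$ is the set of real points in $\mathbf{Jel}(f|_{W_i}:W_i\to V_i)$. Whitney stratifications: a pair $(M,N)$ of smooth submanifolds of $\mathbb{R}^n$ satisfies Whitney's Condition (B) if for every $q\in N$ and all sequences $\{p_k\}\subset M$, $\{q_k\}\subset N$ with $\lim p_k=q=\lim q_k$, whenever $T=\lim T_{p_k}M$ and the limiting secant line $\ell=\lim[p_k,q_k]$ both exist, one has $\ell\subset T$.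 A Whitney stratification of a real variety $X$ is a flag of subvarieties $\varnothing\subset X_0\subset\cdots\subset X_k=X$ such that the connected components of the differences $X_i-X_{i-1}$ are smooth $i$-manifolds (the strata) and every pair of strata satisfies Condition (B). Subordinate: a Whitney stratification $X_\bullet$ of $X$ is subordinate to a flag $\varnothing=F_{-1}\subset F_0\subset\cdots\subset F_\ell=X$ of subvarieties if every stratum $S$ of $X_\bullet$ satisfies $S\subset F_j-F_{j-1}$ for some $j\in\{0,\dots,\ell\}$. Stratified map: $f$ is stratified with respect to $X_\bullet,Y_\bullet$ if for each stratum $M\subset X$ there is a stratum $N\subset Y$ with $f(M)\subset N$ and $f|_M:M\to N$ a smooth submersion. *)

theory Defs
  imports "HOL-Analysis.Analysis" "HOL-Library.Poly_Mapping"
begin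

section \<open>Polynomials and algebraic sets\<close>

text \<open>A polynomial in the variables \<open>x $ i\<close>, \<open>i :: 'n\<close>, is a finitely supported map from
  exponent vectors to coefficients.\<close>

type_synonym ('n, 'a) mpoly = "('n \<Rightarrow>\<^sub>0 nat) \<Rightarrow>\<^sub>0 'a"

definition mpoly_eval :: "('n::finite, 'a::comm_semiring_1) mpoly \<Rightarrow> 'a ^ 'n \<Rightarrow> 'a" where
  "mpoly_eval p x =
     (\<Sum>m\<in>Poly_Mapping.keys p. Poly_Mapping.lookup p m * (\<Prod>i\<in>UNIV. x $ i ^ Poly_Mapping.lookup m i))"

definition zero_set :: "('n::finite, 'a::comm_semiring_1) mpoly set \<Rightarrow> ('a ^ 'n) set" where
  "zero_set P = {x. \<forall>p\<in>P. mpoly_eval p x = 0}"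

definition algebraic_set :: "('a::comm_semiring_1 ^ 'n::finite) set \<Rightarrow> bool" where
  "algebraic_set S \<longleftrightarrow> (\<exists>P. S = zero_set P)"

definition poly_map :: "('n::finite, 'a::comm_semiring_1) mpoly ^ 'm::finite \<Rightarrow> 'a ^ 'n \<Rightarrow> 'a ^ 'm" where
  "poly_map F x = (\<chi> j. mpoly_eval (F $ j) x)"

definition vanishing_ideal :: "('a::comm_semiring_1 ^ 'n::finite) set \<Rightarrow> ('n, 'a) mpoly set" where
  "vanishing_ideal S = {p. \<forall>x\<in>S. mpoly_eval p x = 0}"


section \<open>Complexification\<close>

definition complex_mpoly :: "('n, real) mpoly \<Rightarrow> ('n, complex) mpoly" where
  "complex_mpoly p = Poly_Mapping.map complex_of_real p"

text \<open>The set of complex points depends on the defining polynomials and not only on their real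
  zero set.\<close>

definition complex_points :: "('n::finite, real) mpoly set \<Rightarrow> (complex ^ 'n) set" where
  "complex_points P = zero_set (complex_mpoly ` P)"

definition complex_map ::
    "('n::finite, real) mpoly ^ 'm::finite \<Rightarrow> complex ^ 'n \<Rightarrow> complex ^ 'm" where
  "complex_map F = poly_map (\<chi> j. complex_mpoly (F $ j))"

definition real_points :: "(complex ^ 'n::finite) set \<Rightarrow> (real ^ 'n) set" where
  "real_points S = {x. (\<chi> i. complex_of_real (x $ i)) \<in> S}"

definition variety_morphism ::
    "('n::finite, real) mpoly set \<Rightarrow> ('m::finite, real) mpoly set \<Rightarrow> ('n, real) mpoly ^ 'm \<Rightarrow> bool" where
  "variety_morphism P Q F \<longleftrightarrow>
     poly_map F ` zero_set P \<subseteq> zero_set Q \<and>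
     complex_map F ` complex_points P \<subseteq> complex_points Q"

text \<open>Density is with respect to the Zariski topology.\<close>

definition zariski_dense_in :: "('a::comm_semiring_1 ^ 'n::finite) set \<Rightarrow> ('a ^ 'n) set \<Rightarrow> bool" where
  "zariski_dense_in A S \<longleftrightarrow> A \<subseteq> S \<and> (\<forall>Z. algebraic_set Z \<and> A \<subseteq> Z \<longrightarrow> S \<subseteq> Z)"

definition irreducible_algebraic :: "('a::comm_semiring_1 ^ 'n::finite) set \<Rightarrow> bool" where
  "irreducible_algebraic Z \<longleftrightarrow>
     algebraic_set Z \<and> Z \<noteq> {} \<and>
     (\<forall>A B. algebraic_set A \<and> algebraic_set B \<and> Z \<subseteq> A \<union> B \<longrightarrow> Z \<subseteq> A \<or> Z \<subseteq> B)"

text \<open>The dimension of a complex variety is the maximal length of a chain of irreducible closed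
  subsets. As a supremum in \<^typ>\<open>ereal\<close> it is \<open>-\<infinity>\<close> for the empty set.\<close>

definition complex_dim :: "(complex ^ 'n::finite) set \<Rightarrow> ereal" where
  "complex_dim S =
     (SUP k\<in>{k. \<exists>Z. (\<forall>i\<le>k. irreducible_algebraic (Z i) \<and> Z i \<subseteq> S) \<and> (\<forall>i<k. Z i \<subset> Z (Suc i))}.
        ereal (real k))"


section \<open>Smooth submanifolds of Euclidean space\<close>

fun differentiable_upto ::
    "nat \<Rightarrow> 'a::real_normed_vector set \<Rightarrow> ('a \<Rightarrow> 'b::real_normed_vector) \<Rightarrow> bool" where
  "differentiable_upto 0 S f \<longleftrightarrow> continuous_on S f"
| "differentiable_upto (Suc r) S f \<longleftrightarrow>
     (\<forall>x\<in>S. f differentiable (at x)) \<and>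
     (\<forall>v. differentiable_upto r S (\<lambda>x. frechet_derivative f (at x) v))"

definition smooth_on :: "'a::real_normed_vector set \<Rightarrow> ('a \<Rightarrow> 'b::real_normed_vector) \<Rightarrow> bool" where
  "smooth_on S f \<longleftrightarrow> open S \<and> (\<forall>r. differentiable_upto r S f)"

text \<open>Near \<open>p\<close>, a diffeomorphism between open sets of the ambient space takes \<open>S\<close> to a linear
  subspace of dimension \<open>k\<close>.\<close>

definition smooth_point :: "nat \<Rightarrow> 'a::euclidean_space set \<Rightarrow> 'a \<Rightarrow> bool" where
  "smooth_point k S p \<longleftrightarrow>
     p \<in> S \<and>
     (\<exists>U V g h L. p \<in> U \<and> smooth_on U g \<and> smooth_on V h \<and> homeomorphism U V g h \<and>
        subspace (L :: 'a set) \<and> dim L = k \<and> g ` (S \<inter> U) = V \<inter> L)"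

definition smooth_submanifold :: "nat \<Rightarrow> 'a::euclidean_space set \<Rightarrow> bool" where
  "smooth_submanifold k M \<longleftrightarrow> (\<forall>p\<in>M. smooth_point k M p)"

text \<open>The dimension of a real variety is that of its manifold of smooth points, i.e. the largest
  dimension occurring; it is \<open>-\<infinity>\<close> for the empty set.\<close>

definition real_dim :: "'a::euclidean_space set \<Rightarrow> ereal" where
  "real_dim S = (SUP k\<in>{k. \<exists>p. smooth_point k S p}. ereal (real k))"

definition tangent_space :: "'a::euclidean_space set \<Rightarrow> 'a \<Rightarrow> 'a set" where
  "tangent_space M p =
     {v. \<exists>c e. 0 < e \<and> smooth_on {-e<..<e::real} c \<and> c ` {-e<..<e} \<subseteq> M \<and> c 0 = p \<and>
         (c has_vector_derivative v) (at 0)}"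

definition smooth_submersion ::
    "('a::euclidean_space \<Rightarrow> 'b::euclidean_space) \<Rightarrow> 'a set \<Rightarrow> 'b set \<Rightarrow> bool" where
  "smooth_submersion f M N \<longleftrightarrow>
     f ` M \<subseteq> N \<and>
     (\<exists>U. M \<subseteq> U \<and> smooth_on U f) \<and>
     (\<forall>p\<in>M. frechet_derivative f (at p) ` tangent_space M p = tangent_space N (f p))"


section \<open>Whitney stratifications\<close>

text \<open>Convergence in the Grassmannian: the orthogonal projections onto the subspaces converge.
  On a subspace, \<^const>\<open>closest_point\<close> is the orthogonal projection.\<close>

definition subspace_lim :: "(nat \<Rightarrow> 'a::euclidean_space set) \<Rightarrow> 'a set \<Rightarrow> bool" where
  "subspace_lim L T \<longleftrightarrow>
     (\<forall>k. subspace (L k)) \<and> subspace T \<and>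
     (\<forall>x. (\<lambda>k. closest_point (L k) x) \<longlonglongrightarrow> closest_point T x)"

definition whitney_B :: "'a::euclidean_space set \<Rightarrow> 'a set \<Rightarrow> bool" where
  "whitney_B M N \<longleftrightarrow>
     (\<forall>x\<in>N. \<forall>p q T l.
        (\<forall>k. p k \<in> M) \<and> (\<forall>k. q k \<in> N) \<and> (\<forall>k. p k \<noteq> q k) \<and>
        p \<longlonglongrightarrow> x \<and> q \<longlonglongrightarrow> x \<and>
        subspace_lim (\<lambda>k. tangent_space M (p k)) T \<and>
        subspace_lim (\<lambda>k. span {p k - q k}) l
        \<longrightarrow> l \<subseteq> T)"

text \<open>A flag \<open>F 0 \<subseteq> \<dots> \<subseteq> F k\<close> is indexed by \<^typ>\<open>nat\<close>; the member with index \<open>-1\<close> is empty.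
  Values beyond the length of the flag are irrelevant.\<close>

definition flag_diff :: "(nat \<Rightarrow> 'a set) \<Rightarrow> nat \<Rightarrow> 'a set" where
  "flag_diff F i = F i - (if i = 0 then {} else F (i - 1))"

definition strata :: "(nat \<Rightarrow> 'a::topological_space set) \<Rightarrow> nat \<Rightarrow> 'a set set" where
  "strata F k = (\<Union>i\<le>k. components (flag_diff F i))"

definition whitney_stratification ::
    "(real ^ 'n::finite) set \<Rightarrow> (nat \<Rightarrow> (real ^ 'n) set) \<Rightarrow> nat \<Rightarrow> bool" where
  "whitney_stratification X F k \<longleftrightarrow>
     (\<forall>i\<le>k. algebraic_set (F i)) \<and> (\<forall>i<k. F i \<subseteq> F (Suc i)) \<and> F k = X \<and>
     (\<forall>i\<le>k. \<forall>S\<in>components (flag_diff F i). smooth_submanifold i S) \<and>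
     (\<forall>M\<in>strata F k. \<forall>N\<in>strata F k. whitney_B M N)"

definition subordinate ::
    "(nat \<Rightarrow> 'a::topological_space set) \<Rightarrow> nat \<Rightarrow> (nat \<Rightarrow> 'a set) \<Rightarrow> nat \<Rightarrow> bool" where
  "subordinate X k F l \<longleftrightarrow> (\<forall>S\<in>strata X k. \<exists>j\<le>l. S \<subseteq> flag_diff F j)"

definition stratified_map ::
    "('a::euclidean_space \<Rightarrow> 'b::euclidean_space) \<Rightarrow>
     (nat \<Rightarrow> 'a set) \<Rightarrow> nat \<Rightarrow> (nat \<Rightarrow> 'b set) \<Rightarrow> nat \<Rightarrow> bool" where
  "stratified_map f X k Y l \<longleftrightarrow> (\<forall>M\<in>strata X k. \<exists>N\<in>strata Y l. smooth_submersion f M N)"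


section \<open>The Jelonek flag\<close>

definition jelonek_set ::
    "(complex ^ 'n::finite) set \<Rightarrow> (complex ^ 'm::finite) set \<Rightarrow> (complex ^ 'n \<Rightarrow> complex ^ 'm) \<Rightarrow>
     (complex ^ 'm) set" where
  "jelonek_set X Y f =
     {y\<in>Y. \<exists>x. (\<forall>k. x k \<in> X) \<and> filterlim (\<lambda>k. norm (x k)) at_top sequentially \<and>
        (\<lambda>k. f (x k)) \<longlonglongrightarrow> y}"

text \<open>The varieties \<open>X = W d\<close> and \<open>Y = V d\<close> come with their defining polynomials \<open>P\<close> and \<open>Q\<close>.
  The lower members of the flag arise only as sets of real points. They are complexified using all
  real polynomials vanishing on them. An arbitrary choice of defining polynomials would not do:
  \<open>{u\<^sup>2 + v\<^sup>2 = 0}\<close>, for instance, has complex points forming a set of larger dimension than the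
  real ones.\<close>

definition flag_polys ::
    "nat \<Rightarrow> ('n::finite, real) mpoly set \<Rightarrow> (nat \<Rightarrow> (real ^ 'n) set) \<Rightarrow> nat \<Rightarrow> ('n, real) mpoly set" where
  "flag_polys d P F i = (if i = d then P else vanishing_ideal (F i))"

definition jelonek_flag ::
    "('n::finite, real) mpoly set \<Rightarrow> ('m::finite, real) mpoly set \<Rightarrow> ('n, real) mpoly ^ 'm \<Rightarrow> nat \<Rightarrow>
     (nat \<Rightarrow> (real ^ 'n) set) \<Rightarrow> (nat \<Rightarrow> (real ^ 'm) set) \<Rightarrow> bool" where
  "jelonek_flag P Q F d W V \<longleftrightarrow>
     W d = zero_set P \<and> V d = zero_set Q \<and>
     (\<forall>i<d.
        V i = real_points (jelonek_set (complex_points (flag_polys d P W (Suc i)))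
                (complex_points (flag_polys d Q V (Suc i))) (complex_map F)) \<and>
        W i = closure {x \<in> zero_set P. poly_map F x \<in> V i})"


section \<open>Fiber bundles\<close>

text \<open>The fiber \<open>F\<close> may be taken in the type of the total space because it is homeomorphic to
  any fiber of \<open>f\<close>; it may be empty.\<close>

definition locally_trivial_bundle ::
    "('a::topological_space \<Rightarrow> 'b::topological_space) \<Rightarrow> 'a set \<Rightarrow> 'b set \<Rightarrow> bool" where
  "locally_trivial_bundle f E B \<longleftrightarrow>
     continuous_on E f \<and> f ` E \<subseteq> B \<and>
     (\<exists>F :: 'a set. \<forall>b\<in>B. \<exists>U g h. openin (top_of_set B) U \<and> b \<in> U \<and>
        homeomorphism {x\<in>E. f x \<in> U} (U \<times> F) g h \<and>
        (\<forall>x\<in>E. f x \<in> U \<longrightarrow> fst (g x) = f x))"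

end

theory Submission
  imports Defs "HOL-Computational_Algebra.Fundamental_Theorem_Algebra"
begin

text \<open>For \<open>i \<ge> 1\<close> the points of \<open>R\<close> avoid the Jelonek set of \<open>W\<^sub>i \<rightarrow> V\<^sub>i\<close>, so \<open>f\<close> is proper over \<open>R\<close> and its
  complex fibers are bounded algebraic sets, hence finite. A submersion of strata with finite fibers
  is a local diffeomorphism; by properness every stratum over the connected \<open>R\<close> maps onto \<open>R\<close>, so
  there are finitely many of them, each open and closed in \<open>f\<^sup>-\<^sup>1(R)\<close>, and \<open>f\<close> is a finite covering over
  \<open>R\<close>.

  For \<open>i = 0\<close> the set \<open>V\<^sub>-\<^sub>1\<close> is empty and properness is not available. Here \<open>dim V\<^sub>0 = dim W\<^sub>0\<close>
  forces \<open>dim V\<^sub>0 \<le> 0\<close>, so that \<open>R\<close> is a point. Otherwise let \<open>e = dim V\<^sub>0 > 0\<close>. Algebraically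
  independent functions on \<open>V\<^sub>n\<close> and a suitable coordinate of the source are independent on
  \<open>W\<^sub>n\<^sub>+\<^sub>1\<close>, because otherwise \<open>f\<close> would be proper near some point of \<open>V\<^sub>n\<close>; so \<open>dim W\<^sub>n\<^sub>+\<^sub>1 > dim V\<^sub>n\<close>. A stratum
  of maximal dimension in \<open>W\<^sub>n\<^sub>+\<^sub>1\<close> is not contained in \<open>W\<^sub>0\<close>, whose dimension is \<open>e\<close>, hence it has
  finite fibers over \<open>V\<^sub>n\<^sub>+\<^sub>1\<close> and \<open>dim V\<^sub>n\<^sub>+\<^sub>1 \<ge> dim W\<^sub>n\<^sub>+\<^sub>1\<close>. By induction \<open>dim V\<^sub>n \<ge> e + n\<close>, and the same step
  from \<open>V\<^sub>d\<^sub>-\<^sub>1\<close> to \<open>X(\<complex>)\<close> contradicts \<open>dim X(\<complex>) = d\<close>.\<close>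

section \<open>Polynomial functions\<close>

text \<open>Three notions of dimension meet here: \<open>real_dim\<close> looks at smooth points,
  \<open>complex_dim\<close> at chains of irreducible sets, and a Jelonek step yields algebraically
  independent functions. Flag members arise as real points and Euclidean closures, so the working
  notion is \<open>adim\<close>, the largest number of coordinates without a polynomial relation on
  a set. On nonempty unions of strata it equals \<open>real_dim\<close>: near a generic point the
  Zariski closure is a graph over independent coordinates, and invariance of dimension compares this
  graph with the stratum. On the complex side independent functions produce a chain of primes of the
  same length. The top step has to end in \<open>complex_dim\<close>, because the Jelonek set of
  \<open>X\<close> is formed with the given polynomials \<open>P\<close>, whose complex zeros may
  exceed the Zariski closure of the real points. Two elementary devices carry the algebra: counting
  monomials in boxes of exponents, for dependence and finite generation, and the countable dimension
  of a polynomial ring against the uncountable field, for primes and points over the complex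
  numbers.\<close>

inductive_set polyfun :: "'i set \<Rightarrow> (('i \<Rightarrow> 'k::comm_ring_1) \<Rightarrow> 'k) set" for J where
  const: "(\<lambda>_. c) \<in> polyfun J"
| var: "i \<in> J \<Longrightarrow> (\<lambda>z. z i) \<in> polyfun J"
| add: "p \<in> polyfun J \<Longrightarrow> q \<in> polyfun J \<Longrightarrow> (\<lambda>z. p z + q z) \<in> polyfun J"
| mult: "p \<in> polyfun J \<Longrightarrow> q \<in> polyfun J \<Longrightarrow> (\<lambda>z. p z * q z) \<in> polyfun J"

lemma polyfun_mono:
  assumes "p \<in> polyfun J" "J \<subseteq> K"
  shows "p \<in> polyfun K"
  using assms(1) by induction (use assms(2) in \<open>auto intro: polyfun.intros\<close>)

lemma polyfun_uminus: "p \<in> polyfun J \<Longrightarrow> (\<lambda>z. - p z) \<in> polyfun J"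
  using polyfun.mult[OF polyfun.const[of "-1"], of p J] by simp

lemma polyfun_diff: "p \<in> polyfun J \<Longrightarrow> q \<in> polyfun J \<Longrightarrow> (\<lambda>z. p z - q z) \<in> polyfun J"
  using polyfun.add[of p J "\<lambda>z. - q z"] polyfun_uminus[of q J] by simp

lemma polyfun_sum:
  assumes "\<And>a. a \<in> A \<Longrightarrow> p a \<in> polyfun J"
  shows "(\<lambda>z. \<Sum>a\<in>A. p a z) \<in> polyfun J"
  using assms by (induction A rule: infinite_finite_induct) (auto intro: polyfun.intros)

lemma polyfun_prod:
  assumes "\<And>a. a \<in> A \<Longrightarrow> p a \<in> polyfun J"
  shows "(\<lambda>z. \<Prod>a\<in>A. p a z) \<in> polyfun J"
  using assms by (induction A rule: infinite_finite_induct) (auto intro: polyfun.intros)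

lemma polyfun_power: "p \<in> polyfun J \<Longrightarrow> (\<lambda>z. p z ^ k) \<in> polyfun J"
  by (induction k) (auto intro: polyfun.intros)

lemmas polyfun_intros = polyfun.const polyfun.var polyfun.add polyfun.mult
  polyfun_uminus polyfun_diff polyfun_sum polyfun_prod polyfun_power

lemma polyfun_cong:
  assumes "p \<in> polyfun J" "\<And>i. i \<in> J \<Longrightarrow> z i = w i"
  shows "p z = p w"
  using assms(1) by induction (use assms(2) in auto)

lemma polyfun_compose:
  assumes "q \<in> polyfun J" "\<And>i. i \<in> J \<Longrightarrow> g i \<in> polyfun I"
  shows "(\<lambda>x. q (\<lambda>i. g i x)) \<in> polyfun I"
  using assms(1) by induction (use assms(2) in \<open>auto intro: polyfun.intros\<close>)

text \<open>Polynomials are handled as functions. Questions in several variables are settled on a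
  line, where univariate polynomials with finitely many roots take over.\<close>

lemma polyfun_line:
  fixes q :: "('i \<Rightarrow> 'k::comm_ring_1) \<Rightarrow> 'k"
  assumes "q \<in> polyfun J"
  shows "\<exists>P. \<forall>t. q (\<lambda>i. u i + t * v i) = poly P t"
  using assms
proof induction
  case (const c)
  then show ?case by (intro exI[of _ "[:c:]"]) simp
next
  case (var i)
  then show ?case by (intro exI[of _ "[:u i, v i:]"]) simp
next
  case (add p q)
  then obtain P Q where "\<forall>t. p (\<lambda>i. u i + t * v i) = poly P t" "\<forall>t. q (\<lambda>i. u i + t * v i) = poly Q t"
    by blast
  then show ?case by (intro exI[of _ "P + Q"]) simp
next
  case (mult p q)
  then obtain P Q where "\<forall>t. p (\<lambda>i. u i + t * v i) = poly P t" "\<forall>t. q (\<lambda>i. u i + t * v i) = poly Q t"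
    by blast
  then show ?case by (intro exI[of _ "P * Q"]) simp
qed

text \<open>Polynomial functions form an integral domain: on the line from \<open>z\<close> to
  \<open>w\<close> both restrictions are nonzero, and their product has finitely many roots in an
  infinite field.\<close>

lemma polyfun_nonzero_both:
  fixes p q :: "('i \<Rightarrow> 'k::field_char_0) \<Rightarrow> 'k"
  assumes "p \<in> polyfun J" "q \<in> polyfun J" "p z \<noteq> 0" "q w \<noteq> 0"
  shows "\<exists>x. p x \<noteq> 0 \<and> q x \<noteq> 0"
proof -
  define v where "v i = w i - z i" for i
  obtain P Q where P: "\<And>t. p (\<lambda>i. z i + t * v i) = poly P t"
    and Q: "\<And>t. q (\<lambda>i. z i + t * v i) = poly Q t"
    using polyfun_line[OF assms(1), of z v] polyfun_line[OF assms(2), of z v] by blast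
  have "P \<noteq> 0" using P[of 0] assms(3) by auto
  moreover have "Q \<noteq> 0" using Q[of 1] assms(4) by (auto simp: v_def)
  ultimately have "P * Q \<noteq> 0" by simp
  then have "finite {t. poly (P * Q) t = 0}" by (rule poly_roots_finite)
  then obtain t where "poly (P * Q) t \<noteq> 0"
    using ex_new_if_finite[OF infinite_UNIV_char_0[where 'a='k]] by blast
  then show ?thesis using P[of t] Q[of t] by (intro exI[of _ "\<lambda>i. z i + t * v i"]) auto
qed

lemma polyfun_nonzero_prod:
  fixes p :: "'a \<Rightarrow> ('i \<Rightarrow> 'k::field_char_0) \<Rightarrow> 'k"
  assumes "finite S" "\<And>s. s \<in> S \<Longrightarrow> p s \<in> polyfun J" "\<And>s. s \<in> S \<Longrightarrow> \<exists>z. p s z \<noteq> 0"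
  shows "\<exists>z. (\<Prod>s\<in>S. p s z) \<noteq> 0"
  using assms
proof (induction S rule: finite_induct)
  case (insert s S)
  obtain z w where "p s z \<noteq> 0" "(\<Prod>s\<in>S. p s w) \<noteq> 0"
    using insert by (metis insertI1 insertI2)
  moreover have "p s \<in> polyfun J" "(\<lambda>w. \<Prod>s\<in>S. p s w) \<in> polyfun J"
    using insert.prems(1) by (auto intro: polyfun_prod)
  ultimately obtain x where "p s x \<noteq> 0" "(\<Prod>s\<in>S. p s x) \<noteq> 0"
    using polyfun_nonzero_both[of "p s" J "\<lambda>w. \<Prod>s\<in>S. p s w" z w] by auto
  then show ?case using insert.hyps by (intro exI[of _ x]) simp
qed simp

lemma polyfun_expand:
  assumes "q \<in> polyfun (insert b J)"
  shows "\<exists>N c. (\<forall>k. c k \<in> polyfun J) \<and> (\<forall>z. q z = (\<Sum>k\<le>N. c k z * z b ^ k))"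
  using assms
proof induction
  case (const c)
  show ?case by (intro exI[of _ 0] exI[of _ "\<lambda>_ _. c"]) (auto intro: polyfun.intros)
next
  case (var i)
  show ?case
  proof (cases "i = b")
    case True
    show ?thesis
      by (intro exI[of _ 1] exI[of _ "\<lambda>k _. if k = 1 then 1 else 0"]) (auto simp: True intro: polyfun.intros)
  next
    case False
    then show ?thesis using var
      by (intro exI[of _ 0] exI[of _ "\<lambda>_ z. z i"]) (auto intro: polyfun.intros)
  qed
next
  case (add p q)
  then obtain N c M d where c: "\<And>k. c k \<in> polyfun J" "\<And>z. p z = (\<Sum>k\<le>N. c k z * z b ^ k)"
    and d: "\<And>k. d k \<in> polyfun J" "\<And>z. q z = (\<Sum>k\<le>M. d k z * z b ^ k)" by blast
  define c' d' where "c' k z = (if k \<le> N then c k z else 0)"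
    and "d' k z = (if k \<le> M then d k z else 0)" for k z
  have "p z = (\<Sum>k\<le>max N M. c' k z * z b ^ k)" for z
    unfolding c(2) c'_def by (rule sum.mono_neutral_cong_left) auto
  moreover have "q z = (\<Sum>k\<le>max N M. d' k z * z b ^ k)" for z
    unfolding d(2) d'_def by (rule sum.mono_neutral_cong_left) auto
  moreover have "(\<lambda>z. c' k z + d' k z) \<in> polyfun J" for k
    using c(1)[of k] d(1)[of k] unfolding c'_def d'_def
    by (cases "k \<le> N"; cases "k \<le> M") (auto intro: polyfun.intros)
  ultimately show ?case
    by (intro exI[of _ "max N M"] exI[of _ "\<lambda>k z. c' k z + d' k z"])
      (auto simp: sum.distrib algebra_simps)
next
  case (mult p q)
  then obtain N c M d where c: "\<And>k. c k \<in> polyfun J" "\<And>z. p z = (\<Sum>k\<le>N. c k z * z b ^ k)"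
    and d: "\<And>k. d k \<in> polyfun J" "\<And>z. q z = (\<Sum>k\<le>M. d k z * z b ^ k)" by blast
  define e where "e k z = (\<Sum>(i,j)\<in>{..N}\<times>{..M}. if i + j = k then c i z * d j z else 0)" for k z
  have "(\<lambda>z. case ij of (i, j) \<Rightarrow> if i + j = k then c i z * d j z else 0) \<in> polyfun J" for ij k
    using polyfun.mult[OF c(1) d(1), of "fst ij" "snd ij"] polyfun.const[of 0 J]
    by (cases "fst ij + snd ij = k") (auto simp: case_prod_beta)
  then have "e k \<in> polyfun J" for k
    unfolding e_def by (intro polyfun_sum)
  moreover have "p z * q z = (\<Sum>k\<le>N + M. e k z * z b ^ k)" for z
  proof -
    have "(\<Sum>k\<le>N + M. e k z * z b ^ k)
        = (\<Sum>ij\<in>{..N}\<times>{..M}. \<Sum>k\<le>N + M. (if fst ij + snd ij = k then c (fst ij) z * d (snd ij) z else 0) * z b ^ k)"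
      unfolding e_def sum_distrib_right by (subst sum.swap) (simp add: case_prod_beta)
    also have "\<dots> = (\<Sum>ij\<in>{..N}\<times>{..M}. c (fst ij) z * d (snd ij) z * z b ^ (fst ij + snd ij))"
    proof (rule sum.cong[OF refl])
      fix ij assume "ij \<in> {..N}\<times>{..M}"
      then have "fst ij + snd ij \<le> N + M" by auto
      then show "(\<Sum>k\<le>N + M. (if fst ij + snd ij = k then c (fst ij) z * d (snd ij) z else 0) * z b ^ k)
        = c (fst ij) z * d (snd ij) z * z b ^ (fst ij + snd ij)"
        by (subst sum.remove[of _ "fst ij + snd ij"]) (auto intro!: sum.neutral)
    qed
    also have "\<dots> = p z * q z"
      unfolding c(2) d(2) sum_product sum.cartesian_product
      by (rule sum.cong) (auto simp: power_add algebra_simps)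
    finally show ?thesis by simp
  qed
  ultimately show ?case by (intro exI[of _ "N + M"] exI[of _ e]) auto
qed

text \<open>An expansion of least length cannot have an identically vanishing top coefficient, or it
  could be shortened; for \<open>N = 0\<close> the point \<open>w\<close> excludes this.\<close>

lemma polyfun_expand_lead:
  assumes "q \<in> polyfun (insert b J)" "q w \<noteq> 0"
  obtains N c where "\<And>k. c k \<in> polyfun J" "\<And>z. q z = (\<Sum>k\<le>N. c k z * z b ^ k)" "\<exists>z. c N z \<noteq> 0"
proof -
  define P where "P N \<longleftrightarrow> (\<exists>c. (\<forall>k. c k \<in> polyfun J) \<and> (\<forall>z. q z = (\<Sum>k\<le>N. c k z * z b ^ k)))" for N
  have "\<exists>N. P N" using polyfun_expand[OF assms(1)] unfolding P_def by blast
  then have PL: "P (LEAST N. P N)" by (rule LeastI_ex)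
  define N where "N = (LEAST N. P N)"
  obtain c where c: "\<And>k. c k \<in> polyfun J" "\<And>z. q z = (\<Sum>k\<le>N. c k z * z b ^ k)"
    using PL unfolding P_def N_def by blast
  have "\<exists>z. c N z \<noteq> 0"
  proof (rule ccontr)
    assume *: "\<not> ?thesis"
    show False
    proof (cases N)
      case 0
      then show False using c(2)[of w] * assms(2) by simp
    next
      case (Suc M)
      have "q z = (\<Sum>k\<le>M. c k z * z b ^ k)" for z using c(2)[of z] * by (simp add: Suc)
      then have "P M" unfolding P_def using c(1) by blast
      then have "N \<le> M" unfolding N_def by (rule Least_le)
      then show False using Suc by simp
    qed
  qed
  then show ?thesis using that c by blast
qed

text \<open>For coordinate functions this says that the projection of \<open>A\<close> to the
  coordinates in \<open>J\<close> is Zariski dense. It forces \<open>A\<close> to be nonempty, even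
  for \<open>J = {}\<close>.\<close>

definition alg_indep :: "'x set \<Rightarrow> ('i \<Rightarrow> 'x \<Rightarrow> 'k::comm_ring_1) \<Rightarrow> 'i set \<Rightarrow> bool" where
  "alg_indep A g J \<longleftrightarrow> (\<forall>q\<in>polyfun J. (\<forall>x\<in>A. q (\<lambda>i. g i x) = 0) \<longrightarrow> (\<forall>z. q z = 0))"

lemma alg_indepD:
  "alg_indep A g J \<Longrightarrow> q \<in> polyfun J \<Longrightarrow> (\<And>x. x \<in> A \<Longrightarrow> q (\<lambda>i. g i x) = 0) \<Longrightarrow> q z = 0"
  unfolding alg_indep_def by blast

lemma alg_indep_point:
  assumes "alg_indep A g J" "q \<in> polyfun J" "q z \<noteq> 0"
  obtains x where "x \<in> A" "q (\<lambda>i. g i x) \<noteq> 0"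
  using assms unfolding alg_indep_def by blast

lemma alg_indep_mono: "alg_indep A g J \<Longrightarrow> A \<subseteq> B \<Longrightarrow> K \<subseteq> J \<Longrightarrow> alg_indep B g K"
  unfolding alg_indep_def by (meson polyfun_mono subsetD)

text \<open>The product of a relation on \<open>B\<close> and one on \<open>C\<close> is a nonzero
  relation on \<open>A\<close>. This replaces a decomposition into irreducible components:
  independence survives on one of two pieces.\<close>

lemma alg_indep_split:
  fixes g :: "'i \<Rightarrow> 'x \<Rightarrow> 'k::field_char_0"
  assumes "alg_indep A g J" "A \<subseteq> B \<union> C"
  shows "alg_indep B g J \<or> alg_indep C g J"
proof (rule ccontr)
  assume "\<not> ?thesis"
  then obtain p q z w where p: "p \<in> polyfun J" "\<And>x. x \<in> B \<Longrightarrow> p (\<lambda>i. g i x) = 0" "p z \<noteq> 0"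
    and q: "q \<in> polyfun J" "\<And>x. x \<in> C \<Longrightarrow> q (\<lambda>i. g i x) = 0" "q w \<noteq> 0"
    unfolding alg_indep_def by blast
  obtain x where "p x \<noteq> 0" "q x \<noteq> 0" using polyfun_nonzero_both[of p J q z w] p(1,3) q(1,3) by auto
  moreover have "(\<lambda>z. p z * q z) \<in> polyfun J" using p(1) q(1) by (rule polyfun.mult)
  ultimately obtain y where "y \<in> A" "p (\<lambda>i. g i y) * q (\<lambda>i. g i y) \<noteq> 0"
    using alg_indep_point[OF assms(1), of "\<lambda>z. p z * q z" x] by auto
  moreover have "y \<in> B \<or> y \<in> C" using \<open>y \<in> A\<close> assms(2) by blast
  ultimately show False using p(2)[of y] q(2)[of y] by auto
qed

text \<open>Gaussian elimination: an equation with a nonzero coefficient at \<open>a0\<close>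
  removes this unknown, and the smaller system is solved by induction.\<close>

lemma underdetermined_system:
  fixes M :: "'a \<Rightarrow> 'b \<Rightarrow> 'f::field"
  assumes "finite B" "finite A" "card B < card A"
  shows "\<exists>l. (\<exists>a\<in>A. l a \<noteq> 0) \<and> (\<forall>b\<in>B. (\<Sum>a\<in>A. l a * M a b) = 0)"
  using assms
proof (induction B arbitrary: A M rule: finite_induct)
  case empty
  then have "A \<noteq> {}" by auto
  then show ?case by (intro exI[of _ "\<lambda>_. 1"]) auto
next
  case (insert b B)
  show ?case
  proof (cases "\<exists>a\<in>A. M a b \<noteq> 0")
    case False
    have "card B < card A" using insert by simp
    then obtain l where "\<exists>a\<in>A. l a \<noteq> 0" "\<forall>c\<in>B. (\<Sum>a\<in>A. l a * M a c) = 0"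
      using insert.IH[of A M] insert.prems by blast
    then show ?thesis using False by (intro exI[of _ l]) auto
  next
    case True
    then obtain a0 where a0: "a0 \<in> A" "M a0 b \<noteq> 0" by blast
    define A' where "A' = A - {a0}"
    have A: "A = insert a0 A'" "a0 \<notin> A'" "finite A'" using a0 insert.prems by (auto simp: A'_def)
    have "card B < card A'" using insert A by simp
    then obtain l where l: "\<exists>a\<in>A'. l a \<noteq> 0"
      "\<And>c. c \<in> B \<Longrightarrow> (\<Sum>a\<in>A'. l a * (M a c - M a b / M a0 b * M a0 c)) = 0"
      using insert.IH[of A' "\<lambda>a c. M a c - M a b / M a0 b * M a0 c"] A(3) by blast
    define s where "s = (\<Sum>a\<in>A'. l a * (M a b / M a0 b))"
    define l' where "l' a = (if a = a0 then - s else l a)" for a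
    have eq: "(\<Sum>a\<in>A. l' a * M a c) = (\<Sum>a\<in>A'. l a * M a c) - s * M a0 c" for c
    proof -
      have "(\<Sum>a\<in>A'. l' a * M a c) = (\<Sum>a\<in>A'. l a * M a c)"
        using A(2) by (intro sum.cong) (auto simp: l'_def)
      then show ?thesis using A by (simp add: l'_def)
    qed
    have "(\<Sum>a\<in>A. l' a * M a b) = 0"
      unfolding eq s_def sum_distrib_right using a0 by simp
    moreover have "(\<Sum>a\<in>A. l' a * M a c) = 0" if "c \<in> B" for c
      unfolding eq s_def sum_distrib_right sum_subtractf[symmetric]
      using l(2)[OF that] by (simp add: algebra_simps)
    moreover have "\<exists>a\<in>A. l' a \<noteq> 0" using l(1) A by (auto simp: l'_def)
    ultimately show ?thesis by (intro exI[of _ l']) auto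
  qed
qed

section \<open>Counting monomials\<close>

text \<open>The exponent of \<open>b\<close> is split off. By induction some \<open>w\<close> makes
  one coefficient of a univariate polynomial in the value at \<open>b\<close> nonzero, and a value
  that is not a root completes the point.\<close>

lemma monomials_independent:
  fixes l :: "('b \<Rightarrow> nat) \<Rightarrow> 'k::field_char_0"
  assumes "finite B" "\<nu> \<in> PiE B (\<lambda>_. {..t})" "l \<nu> \<noteq> 0"
  shows "\<exists>w. (\<Sum>\<nu>\<in>PiE B (\<lambda>_. {..t}). l \<nu> * (\<Prod>b\<in>B. w b ^ \<nu> b)) \<noteq> 0"
  using assms
proof (induction B arbitrary: \<nu> l rule: finite_induct)
  case empty
  then show ?case by simp
next
  case (insert b B)
  let ?P = "PiE B (\<lambda>_. {..t})"
  define y0 where "y0 = \<nu> b"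
  define g0 where "g0 = restrict \<nu> B"
  have g0: "g0 \<in> ?P" using insert.prems(1) by (auto simp: g0_def)
  have g0b: "g0(b := y0) = \<nu>"
    using insert.prems(1) insert.hyps(2) by (auto simp: g0_def y0_def PiE_def extensional_def fun_eq_iff)
  have y0: "y0 \<le> t" using insert.prems(1) by (auto simp: y0_def)
  have "\<exists>w. (\<Sum>g\<in>?P. l (g(b := y0)) * (\<Prod>b\<in>B. w b ^ g b)) \<noteq> 0"
    using insert.IH[OF g0, of "\<lambda>g. l (g(b := y0))"] insert.prems(2) g0b by simp
  then obtain w where w: "(\<Sum>g\<in>?P. l (g(b := y0)) * (\<Prod>b\<in>B. w b ^ g b)) \<noteq> 0" ..
  define k where "k y = (\<Sum>g\<in>?P. l (g(b := y)) * (\<Prod>b\<in>B. w b ^ g b))" for y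
  define p where "p = (\<Sum>y\<le>t. monom (k y) y)"
  have "coeff p y0 = k y0" using y0 by (simp add: p_def coeff_sum)
  then have "p \<noteq> 0" using w by (auto simp: k_def)
  then have "finite {x. poly p x = 0}" by (rule poly_roots_finite)
  then obtain x where x: "poly p x \<noteq> 0"
    using ex_new_if_finite[OF infinite_UNIV_char_0[where 'a='k], of "{x. poly p x = 0}"] by auto
  have inj: "inj_on (\<lambda>(y, g). g(b := y)) ({..t} \<times> ?P)"
    using insert.hyps(2) by (auto simp: inj_on_def PiE_def extensional_def fun_eq_iff)
  have B: "(\<Prod>c\<in>B. (w(b := x)) c ^ (g(b := y)) c) = (\<Prod>c\<in>B. w c ^ g c)" for g y
    using insert.hyps(2) by (intro prod.cong) auto
  have "(\<Sum>\<nu>\<in>PiE (insert b B) (\<lambda>_. {..t}). l \<nu> * (\<Prod>c\<in>insert b B. (w(b := x)) c ^ \<nu> c))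
    = (\<Sum>(y, g)\<in>{..t} \<times> ?P. l (g(b := y)) * (\<Prod>c\<in>insert b B. (w(b := x)) c ^ (g(b := y)) c))"
    unfolding PiE_insert_eq by (subst sum.reindex[OF inj]) (simp add: case_prod_beta o_def)
  also have "\<dots> = (\<Sum>(y, g)\<in>{..t} \<times> ?P. l (g(b := y)) * (x ^ y * (\<Prod>c\<in>B. w c ^ g c)))"
    using insert.hyps B by (intro sum.cong) auto
  also have "\<dots> = (\<Sum>y\<le>t. k y * x ^ y)"
    unfolding k_def sum.cartesian_product[symmetric] sum_distrib_right
    by (intro sum.cong) (auto simp: algebra_simps)
  also have "\<dots> = poly p x" by (simp add: p_def poly_sum poly_monom)
  finally show ?case using x by metis
qed

text \<open>\<open>J\<close> is meant to be a transcendence basis among the coordinates on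
  \<open>Z\<close>. The leading coefficients may vanish at some points of \<open>Z\<close>, so the
  results below speak of points where \<open>lead\<close> is nonzero.\<close>

locale algebraic_over =
  fixes Z :: "'x set" and X :: "'n::finite \<Rightarrow> 'x \<Rightarrow> 'k::field_char_0" and J :: "'n set"
    and N :: "'n \<Rightarrow> nat" and c :: "'n \<Rightarrow> nat \<Rightarrow> ('n \<Rightarrow> 'k) \<Rightarrow> 'k"
  assumes c: "\<And>i k. i \<notin> J \<Longrightarrow> c i k \<in> polyfun J"
    and N: "\<And>i. i \<notin> J \<Longrightarrow> 1 \<le> N i"
    and rel: "\<And>i x. i \<notin> J \<Longrightarrow> x \<in> Z \<Longrightarrow> (\<Sum>k\<le>N i. c i k (\<lambda>j. X j x) * X i x ^ k) = 0"
begin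

text \<open>Up to factors \<open>lead\<close>, the relations reduce every polynomial to monomials
  whose exponents outside \<open>J\<close> stay below \<open>N i\<close>. The spaces
  \<open>V s\<close> filter the functions on \<open>Z\<close> by the exponents in \<open>J\<close>,
  and \<open>bd\<close> measures by how much a multiplication moves along this filtration.\<close>

definition "Box s = PiE UNIV (\<lambda>i. if i \<in> J then {..s} else {..<N i})"
definition "mon \<beta> x = (\<Prod>i\<in>UNIV. X i x ^ \<beta> i)"
definition "V s = {h. \<exists>l. \<forall>x\<in>Z. h x = (\<Sum>\<beta>\<in>Box s. l \<beta> * mon \<beta> x)}"
definition "bd p D \<longleftrightarrow> (\<forall>s. \<forall>v\<in>V s. (\<lambda>x. p x * v x) \<in> V (s + D))"
definition "lead z = (\<Prod>i\<in>- J. c i (N i) z)"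

lemma Box_iff: "\<beta> \<in> Box s \<longleftrightarrow> (\<forall>i. if i \<in> J then \<beta> i \<le> s else \<beta> i < N i)"
  unfolding Box_def by (auto simp: PiE_def Pi_def)

lemma finite_Box: "finite (Box s)"
  unfolding Box_def by (intro finite_PiE) auto

text \<open>The exponent \<open>card J\<close> is the order of growth of a Hilbert function; the
  dimension counts below rest on it.\<close>

lemma card_Box: "card (Box s) = Suc s ^ card J * (\<Prod>i\<in>- J. N i)"
proof -
  have "card (Box s) = (\<Prod>i\<in>UNIV. card (if i \<in> J then {..s} else {..<N i}))"
    unfolding Box_def by (rule card_PiE) simp
  also have "\<dots> = (\<Prod>i\<in>J. Suc s) * (\<Prod>i\<in>- J. N i)"
    by (simp add: if_distrib[of card] prod.If_cases cong: if_cong)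
  finally show ?thesis by simp
qed

lemma V_cong: "h \<in> V s \<Longrightarrow> (\<And>x. x \<in> Z \<Longrightarrow> h' x = h x) \<Longrightarrow> h' \<in> V s"
  unfolding V_def by auto

lemma V_add: "g \<in> V s \<Longrightarrow> h \<in> V s \<Longrightarrow> (\<lambda>x. g x + h x) \<in> V s"
proof -
  assume "g \<in> V s" "h \<in> V s"
  then obtain l m where "\<forall>x\<in>Z. g x = (\<Sum>\<beta>\<in>Box s. l \<beta> * mon \<beta> x)" "\<forall>x\<in>Z. h x = (\<Sum>\<beta>\<in>Box s. m \<beta> * mon \<beta> x)"
    unfolding V_def by auto
  then show ?thesis unfolding V_def
    by (intro CollectI exI[of _ "\<lambda>\<beta>. l \<beta> + m \<beta>"]) (simp add: sum.distrib algebra_simps)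
qed

lemma V_scale: "h \<in> V s \<Longrightarrow> (\<lambda>x. a * h x) \<in> V s"
proof -
  assume "h \<in> V s"
  then obtain m where "\<forall>x\<in>Z. h x = (\<Sum>\<beta>\<in>Box s. m \<beta> * mon \<beta> x)"
    unfolding V_def by auto
  then show ?thesis unfolding V_def
    by (intro CollectI exI[of _ "\<lambda>\<beta>. a * m \<beta>"]) (simp add: sum_distrib_left algebra_simps)
qed

lemma V_zero: "(\<lambda>x. 0) \<in> V s"
  unfolding V_def by (intro CollectI exI[of _ "\<lambda>_. 0"]) simp

lemma V_sum: "(\<And>a. a \<in> A \<Longrightarrow> h a \<in> V s) \<Longrightarrow> (\<lambda>x. \<Sum>a\<in>A. h a x) \<in> V s"
  by (induction A rule: infinite_finite_induct) (auto intro: V_zero V_add)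

lemma V_mono: "s \<le> t \<Longrightarrow> V s \<subseteq> V t"
proof
  fix h assume "s \<le> t" "h \<in> V s"
  then obtain m where m: "\<forall>x\<in>Z. h x = (\<Sum>\<beta>\<in>Box s. m \<beta> * mon \<beta> x)"
    unfolding V_def by auto
  have sub: "Box s \<subseteq> Box t" unfolding Box_def using \<open>s \<le> t\<close> by (intro PiE_mono) auto
  have "(\<Sum>\<beta>\<in>Box s. m \<beta> * mon \<beta> x) = (\<Sum>\<beta>\<in>Box t. (if \<beta> \<in> Box s then m \<beta> else 0) * mon \<beta> x)" for x
    using sub by (intro sum.mono_neutral_cong_left finite_Box) auto
  then show "h \<in> V t" unfolding V_def using m
    by (intro CollectI exI[of _ "\<lambda>\<beta>. if \<beta> \<in> Box s then m \<beta> else 0"]) simp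
qed

lemma mon_V: "\<beta> \<in> Box s \<Longrightarrow> mon \<beta> \<in> V s"
  unfolding V_def
  by (intro CollectI exI[of _ "\<lambda>\<gamma>. if \<gamma> = \<beta> then 1 else 0"]) (simp add: finite_Box if_distrib[of "\<lambda>a. a * _"] cong: if_cong)

lemma one_V: "(\<lambda>x. 1) \<in> V s"
proof -
  have "(\<lambda>_. 0) \<in> Box s" unfolding Box_iff using N by (auto simp: Suc_le_eq)
  from mon_V[OF this] show ?thesis by (simp add: mon_def[abs_def])
qed

lemma bdI:
  assumes "\<And>s \<beta>. \<beta> \<in> Box s \<Longrightarrow> (\<lambda>x. p x * mon \<beta> x) \<in> V (s + D)"
  shows "bd p D"
  unfolding bd_def
proof (intro allI ballI)
  fix s v assume "v \<in> V s"
  then obtain l where l: "\<forall>x\<in>Z. v x = (\<Sum>\<beta>\<in>Box s. l \<beta> * mon \<beta> x)"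
    unfolding V_def by auto
  have "(\<lambda>x. \<Sum>\<beta>\<in>Box s. l \<beta> * (p x * mon \<beta> x)) \<in> V (s + D)"
    by (intro V_sum V_scale assms)
  then show "(\<lambda>x. p x * v x) \<in> V (s + D)"
    by (rule V_cong) (simp add: l sum_distrib_left algebra_simps)
qed

lemma bd_mono: "bd p D \<Longrightarrow> D \<le> D' \<Longrightarrow> bd p D'"
  unfolding bd_def using V_mono by (meson add_left_mono subsetD)

lemma bd_const: "bd (\<lambda>x. a) 0"
  unfolding bd_def by (auto intro: V_scale)

lemma bd_add: "bd p D \<Longrightarrow> bd q D \<Longrightarrow> bd (\<lambda>x. p x + q x) D"
  unfolding bd_def using V_add by (simp add: distrib_right)

lemma bd_mult: "bd p D \<Longrightarrow> bd q E \<Longrightarrow> bd (\<lambda>x. p x * q x) (D + E)"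
  unfolding bd_def
proof (intro allI ballI)
  fix s v assume a: "\<forall>s. \<forall>v\<in>V s. (\<lambda>x. p x * v x) \<in> V (s + D)"
    "\<forall>s. \<forall>v\<in>V s. (\<lambda>x. q x * v x) \<in> V (s + E)" "v \<in> V s"
  then have "(\<lambda>x. q x * v x) \<in> V (s + E)" by simp
  then have "(\<lambda>x. p x * (q x * v x)) \<in> V (s + E + D)" using a(1) by simp
  then show "(\<lambda>x. p x * q x * v x) \<in> V (s + (D + E))" by (simp add: algebra_simps)
qed

lemma bd_power: "bd p D \<Longrightarrow> bd (\<lambda>x. p x ^ k) (k * D)"
  by (induction k) (auto intro: bd_mult bd_mono[OF bd_const])

lemma bd_prod:
  assumes "finite B" "\<And>b. b \<in> B \<Longrightarrow> bd (p b) D"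
  shows "bd (\<lambda>x. \<Prod>b\<in>B. p b x) (card B * D)"
  using assms by (induction B rule: finite_induct) (auto intro: bd_mult bd_const)

lemma bd_polyfun: "p \<in> polyfun J \<Longrightarrow> \<exists>D. bd (\<lambda>x. p (\<lambda>j. X j x)) D"
proof (induction rule: polyfun.induct)
  case (const a)
  show ?case using bd_const by blast
next
  case (var j)
  have "bd (X j) 1"
  proof (rule bdI)
    fix s \<beta> assume b: "\<beta> \<in> Box s"
    have "\<beta>(j := Suc (\<beta> j)) \<in> Box (s + 1)"
      using b var unfolding Box_iff by (auto simp: le_SucI)
    moreover have "mon (\<beta>(j := Suc (\<beta> j))) x = X j x * mon \<beta> x" for x
      unfolding mon_def by (subst (1 2) prod.remove[of _ j]) (auto intro!: prod.cong)
    ultimately show "(\<lambda>x. X j x * mon \<beta> x) \<in> V (s + 1)"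
      by (metis (no_types, lifting) V_cong mon_V)
  qed
  then show ?case by blast
next
  case (add p q)
  then obtain D E where "bd (\<lambda>x. p (\<lambda>j. X j x)) D" "bd (\<lambda>x. q (\<lambda>j. X j x)) E" by blast
  then have "bd (\<lambda>x. p (\<lambda>j. X j x)) (max D E)" "bd (\<lambda>x. q (\<lambda>j. X j x)) (max D E)"
    by (auto intro: bd_mono)
  then show ?case using bd_add by blast
next
  case (mult p q)
  then show ?case using bd_mult by blast
qed

text \<open>Multiplication by \<open>X i\<close> may push an exponent from \<open>N i - 1\<close> to
  \<open>N i\<close>. The extra factor \<open>c i (N i)\<close> then lets the relation replace the
  top power by lower ones.\<close>

lemma bd_lead_coordinate:
  assumes i: "i \<notin> J"
  shows "\<exists>D. bd (\<lambda>x. c i (N i) (\<lambda>j. X j x) * X i x) D"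
proof -
  have "\<exists>D. \<forall>k. k \<le> n \<longrightarrow> bd (\<lambda>x. c i k (\<lambda>j. X j x)) D" for n
  proof (induction n)
    case 0
    then show ?case using bd_polyfun[OF c[OF i]] by auto
  next
    case (Suc n)
    then obtain D where "\<forall>k. k \<le> n \<longrightarrow> bd (\<lambda>x. c i k (\<lambda>j. X j x)) D" by blast
    moreover obtain E where "bd (\<lambda>x. c i (Suc n) (\<lambda>j. X j x)) E" using bd_polyfun[OF c[OF i]] by blast
    ultimately have "\<forall>k. k \<le> Suc n \<longrightarrow> bd (\<lambda>x. c i k (\<lambda>j. X j x)) (max D E)"
      by (metis bd_mono le_SucE max.cobounded1 max.cobounded2)
    then show ?case by blast
  qed
  then obtain D where D: "\<And>k. k \<le> N i \<Longrightarrow> bd (\<lambda>x. c i k (\<lambda>j. X j x)) D" by blast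
  have "bd (\<lambda>x. c i (N i) (\<lambda>j. X j x) * X i x) D"
  proof (rule bdI)
    fix s \<beta> assume b: "\<beta> \<in> Box s"
    define r where "r x = (\<Prod>j\<in>- {i}. X j x ^ \<beta> j)" for x
    have m: "mon (\<beta>(i := k)) x = X i x ^ k * r x" for k x
      unfolding mon_def r_def by (subst prod.remove[of _ i]) (auto intro!: prod.cong simp: Compl_eq_Diff_UNIV)
    have m0: "mon \<beta> x = X i x ^ \<beta> i * r x" for x using m[of "\<beta> i"] by simp
    have bk: "\<beta>(i := k) \<in> Box s" if "k < N i" for k
      using b that i unfolding Box_iff by auto
    have "\<beta> i < N i" using b i unfolding Box_iff by metis
    then consider "Suc (\<beta> i) < N i" | "Suc (\<beta> i) = N i" by linarith
    then show "(\<lambda>x. c i (N i) (\<lambda>j. X j x) * X i x * mon \<beta> x) \<in> V (s + D)"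
    proof cases
      case 1
      have "(\<lambda>x. c i (N i) (\<lambda>j. X j x) * mon (\<beta>(i := Suc (\<beta> i))) x) \<in> V (s + D)"
        using D[of "N i"] mon_V[OF bk[OF 1]] unfolding bd_def by auto
      then show ?thesis by (rule V_cong) (simp add: m m0)
    next
      case 2
      have "(\<lambda>x. \<Sum>k<N i. (-1) * (c i k (\<lambda>j. X j x) * mon (\<beta>(i := k)) x)) \<in> V (s + D)"
        using D mon_V[OF bk] unfolding bd_def by (intro V_sum V_scale) auto
      then show ?thesis
      proof (rule V_cong)
        fix x assume "x \<in> Z"
        have "(\<Sum>k<N i. c i k (\<lambda>j. X j x) * X i x ^ k) + c i (N i) (\<lambda>j. X j x) * X i x ^ N i = 0"
          using rel[OF i \<open>x \<in> Z\<close>] by (simp add: lessThan_Suc_atMost[symmetric])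
        then have "c i (N i) (\<lambda>j. X j x) * X i x ^ N i = - (\<Sum>k<N i. c i k (\<lambda>j. X j x) * X i x ^ k)"
          by (simp add: eq_neg_iff_add_eq_0 add.commute)
        moreover have "c i (N i) (\<lambda>j. X j x) * X i x * mon \<beta> x = c i (N i) (\<lambda>j. X j x) * X i x ^ N i * r x"
          by (simp add: m0 2[symmetric] algebra_simps)
        ultimately show "c i (N i) (\<lambda>j. X j x) * X i x * mon \<beta> x
          = (\<Sum>k<N i. (-1) * (c i k (\<lambda>j. X j x) * mon (\<beta>(i := k)) x))"
          by (simp only: m sum_distrib_right mult_minus_left mult_1_left sum_negf mult.assoc)
      qed
    qed
  qed
  then show ?thesis by blast
qed

lemma lead_polyfun: "lead \<in> polyfun J"
  unfolding lead_def[abs_def] by (intro polyfun_prod) (auto intro: c)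

text \<open>Each coordinate outside \<open>J\<close> costs one factor \<open>lead\<close>. For a
  sum, each summand is multiplied by the power of \<open>lead\<close> that belongs to the
  other.\<close>

lemma bd_lead_polyfun: "P \<in> polyfun UNIV \<Longrightarrow> \<exists>\<kappa> D. bd (\<lambda>x. lead (\<lambda>j. X j x) ^ \<kappa> * P (\<lambda>j. X j x)) D"
proof (induction rule: polyfun.induct)
  case (const a)
  show ?case using bd_const[of a] by (intro exI[of _ 0]) auto
next
  case (var i)
  show ?case
  proof (cases "i \<in> J")
    case True
    then obtain D where "bd (X i) D" using bd_polyfun[OF polyfun.var[OF True]] by auto
    then show ?thesis by (intro exI[of _ 0] exI[of _ D]) simp
  next
    case False
    have "(\<lambda>z. \<Prod>j\<in>- J - {i}. c j (N j) z) \<in> polyfun J" by (intro polyfun_prod) (auto intro: c)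
    then obtain D where "bd (\<lambda>x. \<Prod>j\<in>- J - {i}. c j (N j) (\<lambda>j. X j x)) D" using bd_polyfun by blast
    moreover obtain E where "bd (\<lambda>x. c i (N i) (\<lambda>j. X j x) * X i x) E"
      using bd_lead_coordinate[OF False] by blast
    ultimately have "bd (\<lambda>x. (\<Prod>j\<in>- J - {i}. c j (N j) (\<lambda>j. X j x)) * (c i (N i) (\<lambda>j. X j x) * X i x)) (D + E)"
      by (rule bd_mult)
    moreover have "lead z = c i (N i) z * (\<Prod>j\<in>- J - {i}. c j (N j) z)" for z
      unfolding lead_def using False by (intro prod.remove) auto
    ultimately show ?thesis by (intro exI[of _ 1] exI[of _ "D + E"]) (simp add: algebra_simps)
  qed
next
  case (add p q)
  then obtain k D l E where b: "bd (\<lambda>x. lead (\<lambda>j. X j x) ^ k * p (\<lambda>j. X j x)) D"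
    "bd (\<lambda>x. lead (\<lambda>j. X j x) ^ l * q (\<lambda>j. X j x)) E" by blast
  obtain F where F: "bd (\<lambda>x. lead (\<lambda>j. X j x)) F" using bd_polyfun[OF lead_polyfun] by blast
  have "bd (\<lambda>x. lead (\<lambda>j. X j x) ^ l * (lead (\<lambda>j. X j x) ^ k * p (\<lambda>j. X j x))) (max (l * F + D) (k * F + E))"
    by (rule bd_mono[OF bd_mult[OF bd_power[OF F] b(1)]]) simp
  moreover have "bd (\<lambda>x. lead (\<lambda>j. X j x) ^ k * (lead (\<lambda>j. X j x) ^ l * q (\<lambda>j. X j x))) (max (l * F + D) (k * F + E))"
    by (rule bd_mono[OF bd_mult[OF bd_power[OF F] b(2)]]) simp
  ultimately have "bd (\<lambda>x. lead (\<lambda>j. X j x) ^ l * (lead (\<lambda>j. X j x) ^ k * p (\<lambda>j. X j x))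
      + lead (\<lambda>j. X j x) ^ k * (lead (\<lambda>j. X j x) ^ l * q (\<lambda>j. X j x))) (max (l * F + D) (k * F + E))"
    by (rule bd_add)
  then show ?case
    by (intro exI[of _ "k + l"] exI[of _ "max (l * F + D) (k * F + E)"]) (simp add: power_add algebra_simps)
next
  case (mult p q)
  then obtain k D l E where "bd (\<lambda>x. lead (\<lambda>j. X j x) ^ k * p (\<lambda>j. X j x)) D"
    "bd (\<lambda>x. lead (\<lambda>j. X j x) ^ l * q (\<lambda>j. X j x)) E" by blast
  from bd_mult[OF this] show ?case
    by (intro exI[of _ "k + l"] exI[of _ "D + E"]) (simp add: power_add algebra_simps)
qed

lemma bd_lead_family:
  assumes "finite B" "\<And>b. b \<in> B \<Longrightarrow> P b \<in> polyfun UNIV"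
  shows "\<exists>\<kappa> D. \<forall>b\<in>B. bd (\<lambda>x. lead (\<lambda>j. X j x) ^ \<kappa> * P b (\<lambda>j. X j x)) D"
  using assms
proof (induction B rule: finite_induct)
  case (insert b B)
  obtain k D where k: "\<And>b. b \<in> B \<Longrightarrow> bd (\<lambda>x. lead (\<lambda>j. X j x) ^ k * P b (\<lambda>j. X j x)) D"
    using insert.IH insert.prems by auto
  obtain l E where l: "bd (\<lambda>x. lead (\<lambda>j. X j x) ^ l * P b (\<lambda>j. X j x)) E"
    using bd_lead_polyfun[of "P b"] insert.prems by auto
  obtain F where F: "bd (\<lambda>x. lead (\<lambda>j. X j x)) F" using bd_polyfun[OF lead_polyfun] by blast
  define M where "M = max (l * F + D) (k * F + E)"
  have "bd (\<lambda>x. lead (\<lambda>j. X j x) ^ (k + l) * P a (\<lambda>j. X j x)) M" if "a \<in> insert b B" for a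
  proof (cases "a = b")
    case True
    have "bd (\<lambda>x. lead (\<lambda>j. X j x) ^ k * (lead (\<lambda>j. X j x) ^ l * P b (\<lambda>j. X j x))) M"
      by (rule bd_mono[OF bd_mult[OF bd_power[OF F] l]]) (simp add: M_def)
    then show ?thesis by (simp add: True power_add algebra_simps)
  next
    case False
    then have "a \<in> B" using that by simp
    have "bd (\<lambda>x. lead (\<lambda>j. X j x) ^ l * (lead (\<lambda>j. X j x) ^ k * P a (\<lambda>j. X j x))) M"
      by (rule bd_mono[OF bd_mult[OF bd_power[OF F] k[OF \<open>a \<in> B\<close>]]]) (simp add: M_def)
    then show ?thesis by (simp add: power_add algebra_simps)
  qed
  then show ?case by blast
qed simp

lemma dependent_family:
  assumes "finite A" "\<And>a. a \<in> A \<Longrightarrow> h a \<in> V s" "card (Box s) < card A"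
  shows "\<exists>l. (\<exists>a\<in>A. l a \<noteq> 0) \<and> (\<forall>x\<in>Z. (\<Sum>a\<in>A. l a * h a x) = 0)"
proof -
  have "\<forall>a\<in>A. \<exists>m. \<forall>x\<in>Z. h a x = (\<Sum>\<beta>\<in>Box s. m \<beta> * mon \<beta> x)"
    using assms(2) unfolding V_def by auto
  then obtain M where M: "\<And>a x. a \<in> A \<Longrightarrow> x \<in> Z \<Longrightarrow> h a x = (\<Sum>\<beta>\<in>Box s. M a \<beta> * mon \<beta> x)"
    by metis
  obtain l where l: "\<exists>a\<in>A. l a \<noteq> 0" "\<And>\<beta>. \<beta> \<in> Box s \<Longrightarrow> (\<Sum>a\<in>A. l a * M a \<beta>) = 0"
    using underdetermined_system[OF finite_Box assms(1,3), of M] by auto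
  have "(\<Sum>a\<in>A. l a * h a x) = 0" if "x \<in> Z" for x
  proof -
    have "(\<Sum>a\<in>A. l a * h a x) = (\<Sum>a\<in>A. \<Sum>\<beta>\<in>Box s. l a * M a \<beta> * mon \<beta> x)"
      using M that by (auto simp: sum_distrib_left mult.assoc intro!: sum.cong)
    also have "\<dots> = (\<Sum>\<beta>\<in>Box s. (\<Sum>a\<in>A. l a * M a \<beta>) * mon \<beta> x)"
      by (subst sum.swap) (simp add: sum_distrib_right)
    also have "\<dots> = 0" using l(2) by simp
    finally show ?thesis .
  qed
  then show ?thesis using l(1) by blast
qed

text \<open>Products of the \<open>H b\<close> with exponents at most \<open>t\<close>, times a
  power of \<open>lead\<close>, give \<open>Suc t ^ card B\<close> functions in
  \<open>V (t * E)\<close>, whose spanning set grows in \<open>t\<close> only with order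
  \<open>card J\<close>.\<close>

lemma algebraic_dependence:
  assumes B: "finite B" "card J < card B" and H: "\<And>b. b \<in> B \<Longrightarrow> H b \<in> polyfun UNIV"
  shows "\<exists>Q\<in>polyfun B. (\<exists>w. Q w \<noteq> 0) \<and>
    (\<forall>x\<in>Z. lead (\<lambda>j. X j x) \<noteq> 0 \<longrightarrow> Q (\<lambda>b. H b (\<lambda>j. X j x)) = 0)"
proof -
  obtain \<kappa> D0 where D0: "\<And>b. b \<in> B \<Longrightarrow> bd (\<lambda>x. lead (\<lambda>j. X j x) ^ \<kappa> * H b (\<lambda>j. X j x)) D0"
    using bd_lead_family[of B H] B(1) H by blast
  obtain F where F: "bd (\<lambda>x. lead (\<lambda>j. X j x) ^ \<kappa>) F"
    using bd_polyfun[OF polyfun_power[OF lead_polyfun]] by blast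
  define D where "D = max D0 F"
  have D: "b \<in> B \<Longrightarrow> bd (\<lambda>x. lead (\<lambda>j. X j x) ^ \<kappa> * H b (\<lambda>j. X j x)) D"
    "bd (\<lambda>x. lead (\<lambda>j. X j x) ^ \<kappa>) D" for b
    using bd_mono[OF D0] bd_mono[OF F] by (auto simp: D_def)
  define E where "E = card B * D"
  define n where "n = (\<Prod>i\<in>- J. N i)"
  \<comment> \<open>\<open>t\<close> absorbs the constants: it is the factor left over when
    \<open>Suc (t * E)\<close> is bounded by \<open>Suc t * Suc E\<close>, so the count ends at
    \<open>Suc t ^ card J * t\<close>, just below the next power.\<close>
  define t where "t = Suc E ^ card J * n"
  define A where "A = PiE B (\<lambda>_. {..t})"
  \<comment> \<open>Every factor \<open>H b ^ \<nu> b\<close> is padded to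
    \<open>\<kappa> * t\<close> powers of \<open>lead\<close>, so that one common factor serves all
    exponent vectors.\<close>
  define L where "L x = lead (\<lambda>j. X j x) ^ (\<kappa> * (t * card B))" for x
  have h: "(\<lambda>x. L x * (\<Prod>b\<in>B. H b (\<lambda>j. X j x) ^ \<nu> b)) \<in> V (t * E)" if "\<nu> \<in> A" for \<nu>
  proof -
    have "bd (\<lambda>x. \<Prod>b\<in>B. (lead (\<lambda>j. X j x) ^ \<kappa>) ^ (t - \<nu> b) * (lead (\<lambda>j. X j x) ^ \<kappa> * H b (\<lambda>j. X j x)) ^ \<nu> b)
      (card B * (t * D))"
    proof (rule bd_prod[OF B(1)])
      fix b assume b: "b \<in> B"
      then have "\<nu> b \<le> t" using that by (auto simp: A_def)
      then have "(t - \<nu> b) * D + \<nu> b * D = t * D" by (simp flip: add_mult_distrib)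
      then show "bd (\<lambda>x. (lead (\<lambda>j. X j x) ^ \<kappa>) ^ (t - \<nu> b) * (lead (\<lambda>j. X j x) ^ \<kappa> * H b (\<lambda>j. X j x)) ^ \<nu> b) (t * D)"
        using bd_mult[OF bd_power[OF D(2), of "t - \<nu> b"] bd_power[OF D(1)[OF b], of "\<nu> b"]] by simp
    qed
    then have "(\<lambda>x. (\<Prod>b\<in>B. (lead (\<lambda>j. X j x) ^ \<kappa>) ^ (t - \<nu> b) * (lead (\<lambda>j. X j x) ^ \<kappa> * H b (\<lambda>j. X j x)) ^ \<nu> b) * 1)
      \<in> V (0 + card B * (t * D))"
      using one_V unfolding bd_def by (elim allE[of _ 0] ballE) auto
    then have "(\<lambda>x. (\<Prod>b\<in>B. (lead (\<lambda>j. X j x) ^ \<kappa>) ^ (t - \<nu> b) * (lead (\<lambda>j. X j x) ^ \<kappa> * H b (\<lambda>j. X j x)) ^ \<nu> b)) \<in> V (t * E)"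
      by (simp add: E_def mult.left_commute)
    then show ?thesis
    proof (rule V_cong)
      fix x
      have "(\<Prod>b\<in>B. (lead (\<lambda>j. X j x) ^ \<kappa>) ^ (t - \<nu> b) * (lead (\<lambda>j. X j x) ^ \<kappa> * H b (\<lambda>j. X j x)) ^ \<nu> b)
        = (\<Prod>b\<in>B. (lead (\<lambda>j. X j x) ^ \<kappa>) ^ t * H b (\<lambda>j. X j x) ^ \<nu> b)"
      proof (rule prod.cong[OF refl])
        fix b assume "b \<in> B"
        then have "\<nu> b \<le> t" using that by (auto simp: A_def)
        then show "(lead (\<lambda>j. X j x) ^ \<kappa>) ^ (t - \<nu> b) * (lead (\<lambda>j. X j x) ^ \<kappa> * H b (\<lambda>j. X j x)) ^ \<nu> b
          = (lead (\<lambda>j. X j x) ^ \<kappa>) ^ t * H b (\<lambda>j. X j x) ^ \<nu> b"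
          by (simp add: power_mult_distrib mult.assoc[symmetric] flip: power_add)
      qed
      then show "L x * (\<Prod>b\<in>B. H b (\<lambda>j. X j x) ^ \<nu> b)
        = (\<Prod>b\<in>B. (lead (\<lambda>j. X j x) ^ \<kappa>) ^ (t - \<nu> b) * (lead (\<lambda>j. X j x) ^ \<kappa> * H b (\<lambda>j. X j x)) ^ \<nu> b)"
        by (simp add: prod.distrib L_def power_mult)
    qed
  qed
  have "card (Box (t * E)) < card A"
  proof -
    have "card (Box (t * E)) = Suc (t * E) ^ card J * n" by (simp add: card_Box n_def)
    also have "\<dots> \<le> (Suc t * Suc E) ^ card J * n" by (intro mult_right_mono power_mono) auto
    also have "\<dots> = Suc t ^ card J * (Suc E ^ card J * n)" by (simp only: power_mult_distrib mult.assoc)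
    also have "\<dots> = Suc t ^ card J * t" by (simp only: t_def)
    also have "\<dots> < Suc t ^ Suc (card J)" by simp
    also have "\<dots> \<le> Suc t ^ card B" using B(2) by (intro power_increasing) auto
    also have "\<dots> = card A" using B(1) by (simp add: A_def card_PiE)
    finally show ?thesis .
  qed
  moreover have finA: "finite A" unfolding A_def using B(1) by (intro finite_PiE) auto
  ultimately obtain l where l: "\<exists>\<nu>\<in>A. l \<nu> \<noteq> 0"
    "\<And>x. x \<in> Z \<Longrightarrow> (\<Sum>\<nu>\<in>A. l \<nu> * (L x * (\<Prod>b\<in>B. H b (\<lambda>j. X j x) ^ \<nu> b))) = 0"
    using dependent_family[of A "\<lambda>\<nu> x. L x * (\<Prod>b\<in>B. H b (\<lambda>j. X j x) ^ \<nu> b)", OF _ h] by blast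
  define Q where "Q w = (\<Sum>\<nu>\<in>A. l \<nu> * (\<Prod>b\<in>B. w b ^ \<nu> b))" for w :: "_ \<Rightarrow> 'k"
  have "Q \<in> polyfun B" unfolding Q_def[abs_def] by (intro polyfun_intros) auto
  moreover have "\<exists>w. Q w \<noteq> 0" unfolding Q_def A_def
    using l(1) monomials_independent[OF B(1)] unfolding A_def by blast
  moreover have "Q (\<lambda>b. H b (\<lambda>j. X j x)) = 0" if "x \<in> Z" "lead (\<lambda>j. X j x) \<noteq> 0" for x
  proof -
    have "L x * Q (\<lambda>b. H b (\<lambda>j. X j x)) = 0"
      using l(2)[OF that(1)] unfolding Q_def sum_distrib_left by (simp add: algebra_simps)
    then show ?thesis using that(2) by (simp add: L_def)
  qed
  ultimately show ?thesis by blast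
qed

text \<open>The same count with coefficients in the variables \<open>J\<close>: their products with
  the \<open>P a\<close> lie in \<open>V (t + t)\<close>, and
  \<open>Suc (t + t) \<le> 2 * Suc t\<close> explains the factor \<open>2 ^ card J\<close>. The
  bound is independent of the polynomials \<open>P a\<close>, which makes finite generation
  possible.\<close>

lemma linear_dependence:
  assumes A: "finite A" "(\<Prod>i\<in>- J. N i) * 2 ^ card J < card A"
    and P: "\<And>a. a \<in> A \<Longrightarrow> P a \<in> polyfun UNIV"
  shows "\<exists>b. (\<forall>a. b a \<in> polyfun J) \<and> (\<exists>a\<in>A. \<exists>z. b a z \<noteq> 0) \<and>
    (\<forall>x\<in>Z. lead (\<lambda>j. X j x) \<noteq> 0 \<longrightarrow> (\<Sum>a\<in>A. b a (\<lambda>j. X j x) * P a (\<lambda>j. X j x)) = 0)"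
proof -
  \<comment> \<open>One number \<open>t\<close> serves as the shift of the \<open>P a\<close> and as
    the exponent bound of the coefficients.\<close>
  obtain \<kappa> t where D: "\<And>a. a \<in> A \<Longrightarrow> bd (\<lambda>x. lead (\<lambda>j. X j x) ^ \<kappa> * P a (\<lambda>j. X j x)) t"
    using bd_lead_family[of A P] A(1) P by blast
  define S where "S = PiE J (\<lambda>_. {..t})"
  have finS: "finite S" unfolding S_def by (intro finite_PiE) auto
  have h: "(\<lambda>x. lead (\<lambda>j. X j x) ^ \<kappa> * P (fst a) (\<lambda>j. X j x) * (\<Prod>i\<in>J. X i x ^ snd a i)) \<in> V (t + t)"
    if "a \<in> A \<times> S" for a
  proof -
    define \<beta> where "\<beta> i = (if i \<in> J then snd a i else 0)" for i
    have "\<beta> \<in> Box t" using that N unfolding \<beta>_def Box_iff S_def by (auto simp: PiE_def Pi_def Suc_le_eq)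
    moreover have "mon \<beta> x = (\<Prod>i\<in>J. X i x ^ snd a i)" for x
      unfolding mon_def \<beta>_def by (rule prod.mono_neutral_cong_right) auto
    ultimately have "(\<lambda>x. \<Prod>i\<in>J. X i x ^ snd a i) \<in> V t" using mon_V[of \<beta> t] by (auto intro: V_cong)
    then show ?thesis using D[of "fst a"] that unfolding bd_def by auto
  qed
  have "card (Box (t + t)) < card (A \<times> S)"
  proof -
    have "card (Box (t + t)) = Suc (t + t) ^ card J * (\<Prod>i\<in>- J. N i)" by (simp add: card_Box)
    also have "\<dots> \<le> (2 * Suc t) ^ card J * (\<Prod>i\<in>- J. N i)" by (intro mult_right_mono power_mono) auto
    also have "\<dots> = (\<Prod>i\<in>- J. N i) * 2 ^ card J * Suc t ^ card J" by (simp only: power_mult_distrib mult_ac)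
    also have "\<dots> < card A * Suc t ^ card J" using A(2) by (intro mult_strict_right_mono) auto
    also have "\<dots> = card (A \<times> S)" by (simp add: S_def card_PiE card_cartesian_product)
    finally show ?thesis .
  qed
  then obtain l where l: "\<exists>a\<in>A \<times> S. l a \<noteq> 0"
    "\<And>x. x \<in> Z \<Longrightarrow> (\<Sum>a\<in>A \<times> S. l a * (lead (\<lambda>j. X j x) ^ \<kappa> * P (fst a) (\<lambda>j. X j x) * (\<Prod>i\<in>J. X i x ^ snd a i))) = 0"
    using dependent_family[of "A \<times> S" "\<lambda>a x. lead (\<lambda>j. X j x) ^ \<kappa> * P (fst a) (\<lambda>j. X j x) * (\<Prod>i\<in>J. X i x ^ snd a i)", OF finite_cartesian_product[OF A(1) finS] h]
    by blast
  define b where "b a z = (\<Sum>\<beta>\<in>S. l (a, \<beta>) * (\<Prod>i\<in>J. z i ^ \<beta> i))" for a and z :: "'n \<Rightarrow> 'k"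
  have "b a \<in> polyfun J" for a unfolding b_def[abs_def] by (intro polyfun_intros) auto
  moreover have "\<exists>a\<in>A. \<exists>z. b a z \<noteq> 0"
  proof -
    obtain a \<beta> where "a \<in> A" "\<beta> \<in> S" "l (a, \<beta>) \<noteq> 0" using l(1) by auto
    then show ?thesis using monomials_independent[of J \<beta> t "\<lambda>\<beta>. l (a, \<beta>)"] unfolding b_def S_def by auto
  qed
  moreover have "(\<Sum>a\<in>A. b a (\<lambda>j. X j x) * P a (\<lambda>j. X j x)) = 0" if "x \<in> Z" "lead (\<lambda>j. X j x) \<noteq> 0" for x
  proof -
    have "0 = (\<Sum>a\<in>A. \<Sum>\<beta>\<in>S. l (a, \<beta>) * (lead (\<lambda>j. X j x) ^ \<kappa> * P a (\<lambda>j. X j x) * (\<Prod>i\<in>J. X i x ^ \<beta> i)))"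
      using l(2)[OF that(1)] by (simp add: sum.cartesian_product case_prod_beta)
    also have "\<dots> = lead (\<lambda>j. X j x) ^ \<kappa> * (\<Sum>a\<in>A. b a (\<lambda>j. X j x) * P a (\<lambda>j. X j x))"
      unfolding b_def sum_distrib_left sum_distrib_right by (intro sum.cong) (auto simp: algebra_simps)
    finally show ?thesis using that(2) by simp
  qed
  ultimately show ?thesis by blast
qed

end

section \<open>Transcendence dimension\<close>

lemma alg_indep_empty: "A \<noteq> {} \<Longrightarrow> alg_indep A g {}"
  unfolding alg_indep_def by (metis all_not_in_conv polyfun_cong empty_iff)

lemma not_alg_indep_empty: "\<not> alg_indep {} (g :: 'i \<Rightarrow> 'x \<Rightarrow> 'k::comm_ring_1) J"
  unfolding alg_indep_def by (auto intro!: bexI[of _ "\<lambda>_. 1"] polyfun.const)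

abbreviation coords :: "'n \<Rightarrow> 'k ^ 'n \<Rightarrow> 'k" where "coords \<equiv> \<lambda>i x. x $ i"

text \<open>The dimension of the Zariski closure, except that the empty set gets dimension 0.\<close>

definition adim :: "(real ^ 'n::finite) set \<Rightarrow> nat" where
  "adim A = Max (insert 0 {card J | J. alg_indep A coords J})"

lemma finite_adim: "finite (insert 0 {card J | J :: 'n::finite set. alg_indep (A :: (real ^ 'n) set) coords J})"
  by (simp add: setcompr_eq_image)

lemma adim_ge: "alg_indep A coords J \<Longrightarrow> card J \<le> adim A"
  unfolding adim_def by (intro Max_ge finite_adim) auto

lemma adim_attained:
  assumes "A \<noteq> {}"
  obtains J where "alg_indep A coords J" "card J = adim A"
proof -
  have "adim A \<in> insert 0 {card J | J. alg_indep A coords J}"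
    unfolding adim_def by (intro Max_in finite_adim) auto
  then consider "adim A = 0" | J where "alg_indep A coords J" "adim A = card J" by auto
  then show ?thesis
    by cases (use that alg_indep_empty[OF assms, of coords] in auto)
qed

lemma adim_mono:
  assumes "A \<subseteq> B"
  shows "adim A \<le> adim B"
proof (cases "A = {}")
  case True
  then show ?thesis using not_alg_indep_empty by (auto simp: adim_def)
next
  case False
  then obtain J where J: "alg_indep A coords J" "card J = adim A" by (rule adim_attained)
  then show ?thesis using adim_ge[OF alg_indep_mono[OF J(1) assms order_refl]] by simp
qed

lemma algebraic_relation:
  fixes g :: "'i \<Rightarrow> 'x \<Rightarrow> 'k::field_char_0"
  assumes "alg_indep A g J" "\<not> alg_indep A g (insert i J)"
  obtains N c where "1 \<le> N" "\<And>k. c k \<in> polyfun J" "\<exists>z. c N z \<noteq> 0"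
    "\<And>x. x \<in> A \<Longrightarrow> (\<Sum>k\<le>N. c k (\<lambda>j. g j x) * g i x ^ k) = 0"
proof -
  obtain q w where q: "q \<in> polyfun (insert i J)" "\<And>x. x \<in> A \<Longrightarrow> q (\<lambda>j. g j x) = 0" "q w \<noteq> 0"
    using assms(2) unfolding alg_indep_def by blast
  obtain N c where c: "\<And>k. c k \<in> polyfun J" "\<And>z. q z = (\<Sum>k\<le>N. c k z * z i ^ k)" "\<exists>z. c N z \<noteq> 0"
    using polyfun_expand_lead[OF q(1,3)] by metis
  have r: "(\<Sum>k\<le>N. c k (\<lambda>j. g j x) * g i x ^ k) = 0" if "x \<in> A" for x
    using q(2)[OF that] c(2) by simp
  have "N \<noteq> 0"
  proof
    assume "N = 0"
    then have "c N (\<lambda>j. g j x) = 0" if "x \<in> A" for x using r[OF that] by simp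
    then show False using alg_indepD[OF assms(1) c(1)] c(3) by blast
  qed
  then show ?thesis using that[of N c] c r by auto
qed

text \<open>The dependence found where \<open>lead\<close> is nonzero has to be combined with one on
  the locus \<open>lead = 0\<close>. That locus may have the same \<open>adim\<close>, but
  \<open>J\<close> is no longer independent on it, so the induction runs over the number of
  independent sets of coordinates.\<close>

lemma polynomials_dependent:
  fixes A :: "(real ^ 'n::finite) set"
  assumes B: "finite B" "adim A < card B" and H: "\<And>b. b \<in> B \<Longrightarrow> H b \<in> polyfun UNIV"
  shows "\<not> alg_indep A (\<lambda>b x. H b (($) x)) B"
  using B(2)
proof (induction "card {J. alg_indep A coords J}" arbitrary: A rule: less_induct)
  case less
  show ?case
  proof (cases "A = {}")
    case True
    then show ?thesis using not_alg_indep_empty by blast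
  next
    case False
    then obtain J where J: "alg_indep A coords J" "card J = adim A" by (rule adim_attained)
    define R where "R i N c \<longleftrightarrow> 1 \<le> N \<and> (\<forall>k. c k \<in> polyfun J) \<and> (\<exists>z. c N z \<noteq> 0) \<and>
      (\<forall>x\<in>A. (\<Sum>k\<le>N. c k (($) x) * x $ i ^ k) = 0)" for i N and c :: "nat \<Rightarrow> ('n \<Rightarrow> real) \<Rightarrow> real"
    have "\<exists>N c. R i N c" if "i \<notin> J" for i
    proof -
      have "\<not> alg_indep A coords (insert i J)"
        using adim_ge[of A "insert i J"] J(2) that by auto
      then show ?thesis unfolding R_def by (rule algebraic_relation[OF J(1)]) blast
    qed
    then obtain N c where R: "\<And>i. i \<notin> J \<Longrightarrow> R i (N i) (c i)" by metis
    have cs: "1 \<le> N i" "c i k \<in> polyfun J" "\<exists>z. c i (N i) z \<noteq> 0"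
      "x \<in> A \<Longrightarrow> (\<Sum>k\<le>N i. c i k (($) x) * x $ i ^ k) = 0" if "i \<notin> J" for i k x
      using R[OF that] unfolding R_def by auto
    interpret algebraic_over A coords J N c
      using cs(1,2,4) by unfold_locales
    have lead_nz: "\<exists>z. lead z \<noteq> 0" unfolding lead_def
      using polyfun_nonzero_prod[of "- J" "\<lambda>i. c i (N i)" J] cs(2,3) by simp
    have "card J < card B" using less.prems J(2) by simp
    then have "\<exists>Q\<in>polyfun B. (\<exists>w. Q w \<noteq> 0) \<and> (\<forall>x\<in>A. lead (($) x) \<noteq> 0 \<longrightarrow> Q (\<lambda>b. H b (($) x)) = 0)"
      by (rule algebraic_dependence[of B H, OF B(1) _ H])
    then obtain Q where Q: "Q \<in> polyfun B" "\<exists>w. Q w \<noteq> 0"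
      "\<forall>x\<in>A. lead (($) x) \<noteq> 0 \<longrightarrow> Q (\<lambda>b. H b (($) x)) = 0"
      by (elim bexE conjE) (rule that)
    define A0 where "A0 = {x\<in>A. lead (($) x) = 0}"
    have "\<not> alg_indep A0 coords J"
    proof
      assume A0: "alg_indep A0 coords J"
      obtain z where z: "lead z \<noteq> 0" using lead_nz by blast
      show False by (rule alg_indep_point[where q=lead, OF A0 lead_polyfun z]) (simp add: A0_def)
    qed
    moreover have "{J. alg_indep A0 coords J} \<subseteq> {J. alg_indep A coords J}"
      by (intro Collect_mono impI, erule alg_indep_mono) (auto simp: A0_def)
    ultimately have "{J. alg_indep A0 coords J} \<subset> {J. alg_indep A coords J}" using J(1) by blast
    then have "card {J. alg_indep A0 coords J} < card {J. alg_indep A coords J}"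
      by (intro psubset_card_mono) auto
    moreover have "adim A0 \<le> adim A" by (rule adim_mono) (auto simp: A0_def)
    ultimately have "\<not> alg_indep A0 (\<lambda>b x. H b (($) x)) B" using less by simp
    moreover have "\<not> alg_indep {x\<in>A. lead (($) x) \<noteq> 0} (\<lambda>b x. H b (($) x)) B"
    proof
      assume *: "alg_indep {x\<in>A. lead (($) x) \<noteq> 0} (\<lambda>b x. H b (($) x)) B"
      obtain w where w: "Q w \<noteq> 0" using Q(2) by blast
      show False by (rule alg_indep_point[where q=Q, OF * Q(1) w]) (use Q(3) in simp)
    qed
    ultimately show ?thesis
      using alg_indep_split[of A "\<lambda>b x. H b (($) x)" B A0 "{x\<in>A. lead (($) x) \<noteq> 0}"]
      unfolding A0_def by blast
  qed
qed

section \<open>Generic points of algebraic sets\<close>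

lemma continuous_polyfun:
  fixes P :: "('n::finite \<Rightarrow> 'k::real_normed_field) \<Rightarrow> 'k"
  assumes "P \<in> polyfun J"
  shows "continuous_on S (\<lambda>x::'k ^ 'n. P (($) x))"
  using assms by induction (auto intro!: continuous_intros)

lemma polyfun_nonzero_dense:
  fixes P :: "('n::finite \<Rightarrow> real) \<Rightarrow> real"
  assumes "P \<in> polyfun J" "P z \<noteq> 0" "0 < e"
  shows "\<exists>w::real ^ 'n. dist w p < e \<and> P (($) w) \<noteq> 0"
proof -
  define v where "v = (\<chi> i. z i) - p"
  obtain Q where Q: "\<And>t. P (\<lambda>i. p $ i + t * v $ i) = poly Q t"
    using polyfun_line[OF assms(1), of "($) p" "($) v"] by blast
  have "poly Q 1 = P z" using Q[of 1] by (simp add: v_def)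
  then have "Q \<noteq> 0" using assms(2) by auto
  then have "finite {t. poly Q t = 0}" by (rule poly_roots_finite)
  moreover have "infinite {0<..<e / (norm v + 1)}"
    using assms(3) by (intro infinite_Ioo) (simp add: add_nonneg_pos)
  ultimately obtain t where t: "0 < t" "t < e / (norm v + 1)" "poly Q t \<noteq> 0"
    by (metis (mono_tags, lifting) finite_subset greaterThanLessThan_iff mem_Collect_eq subsetI)
  have "t * norm v \<le> t * (norm v + 1)" using t by simp
  also have "\<dots> < e" using t(2) by (simp add: pos_less_divide_eq add_nonneg_pos)
  finally have "dist (p + t *\<^sub>R v) p < e" using t by (simp add: dist_norm)
  moreover have "(($) (p + t *\<^sub>R v)) = (\<lambda>i. p $ i + t * v $ i)" by (rule ext) simp
  then have "P (($) (p + t *\<^sub>R v)) = poly Q t" using Q[of t] by metis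
  ultimately show ?thesis using t(3) by metis
qed

text \<open>Near \<open>(p, t0)\<close> the derivative in \<open>t\<close> is positive, so
  \<open>\<phi> w\<close> is strictly increasing there. The signs at both ends of the interval
  persist for nearby \<open>w\<close>, and the intermediate value theorem gives the root.\<close>

lemma implicit_root_pos:
  fixes \<phi> \<psi> :: "'a::metric_space \<Rightarrow> real \<Rightarrow> real"
  assumes cont: "continuous_on UNIV (\<lambda>(w, t). \<phi> w t)" "continuous_on UNIV (\<lambda>(w, t). \<psi> w t)"
    and deriv: "\<And>w t. (\<phi> w has_real_derivative \<psi> w t) (at t)"
    and p: "\<phi> p t0 = 0" "0 < \<psi> p t0"
  shows "\<exists>\<epsilon>>0. \<exists>\<delta>>0. \<forall>w. dist w p \<le> \<delta> \<longrightarrow> (\<exists>!t. \<bar>t - t0\<bar> \<le> \<epsilon> \<and> \<phi> w t = 0)"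
proof -
  have "isCont (\<lambda>(w, t). \<psi> w t) (p, t0)"
    using cont(2) by (simp add: continuous_on_eq_continuous_at)
  then obtain d where d: "d > 0" "\<And>z. dist z (p, t0) < d \<Longrightarrow> dist (case z of (w, t) \<Rightarrow> \<psi> w t) (\<psi> p t0) < \<psi> p t0"
    using p(2) unfolding continuous_at_eps_delta by auto
  \<comment> \<open>A third of \<open>d\<close> leaves room, because the distance in the product is
    at most the sum of two distances.\<close>
  define \<epsilon> where "\<epsilon> = d / 3"
  have pos: "0 < \<psi> w t" if "dist w p \<le> \<epsilon>" "\<bar>t - t0\<bar> \<le> \<epsilon>" for w t
  proof -
    have "dist (w, t) (p, t0) \<le> dist w p + dist t t0"
      unfolding dist_Pair_Pair by (rule sqrt_sum_squares_le_sum) auto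
    also have "\<dots> < d" using that d(1) by (simp add: \<epsilon>_def dist_real_def)
    finally show ?thesis using d(2)[of "(w, t)"] by (auto simp: dist_real_def)
  qed
  have mono: "\<phi> w s < \<phi> w t" if "dist w p \<le> \<epsilon>" "t0 - \<epsilon> \<le> s" "s < t" "t \<le> t0 + \<epsilon>" for w s t
  proof (rule DERIV_pos_imp_increasing[OF that(3)])
    fix x assume "s \<le> x" "x \<le> t"
    then show "\<exists>y. DERIV (\<phi> w) x :> y \<and> 0 < y" using deriv pos[of w x] that by (intro exI[of _ "\<psi> w x"]) auto
  qed
  have e0: "0 < \<epsilon>" using d by (simp add: \<epsilon>_def)
  have c: "isCont (\<lambda>w. \<phi> w t) p" for t
    using continuous_on_compose2[OF cont(1), of UNIV "\<lambda>w. (w, t)"]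
    by (simp add: continuous_on_eq_continuous_at continuous_on_Pair)
  have "0 < \<phi> p (t0 + \<epsilon>)" "\<phi> p (t0 - \<epsilon>) < 0"
    using mono[of p t0 "t0 + \<epsilon>"] mono[of p "t0 - \<epsilon>" t0] e0 p by auto
  note ends = this
  have lim: "((\<lambda>w. \<phi> w t) \<longlongrightarrow> \<phi> p t) (nhds p)" for t
    using tendsto_at_iff_tendsto_nhds[of "\<lambda>w. \<phi> w t" p] c[of t] by (simp add: continuous_at)
  have "eventually (\<lambda>w. 0 < \<phi> w (t0 + \<epsilon>)) (nhds p)" "eventually (\<lambda>w. \<phi> w (t0 - \<epsilon>) < 0) (nhds p)"
    using order_tendstoD(1)[OF lim ends(1)] order_tendstoD(2)[OF lim ends(2)] by auto
  then have "eventually (\<lambda>w. 0 < \<phi> w (t0 + \<epsilon>) \<and> \<phi> w (t0 - \<epsilon>) < 0) (nhds p)"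
    by (rule eventually_conj)
  then obtain \<delta> where \<delta>: "\<delta> > 0" "\<And>w. dist w p < \<delta> \<Longrightarrow> 0 < \<phi> w (t0 + \<epsilon>) \<and> \<phi> w (t0 - \<epsilon>) < 0"
    unfolding eventually_nhds_metric by auto
  have "\<exists>!t. \<bar>t - t0\<bar> \<le> \<epsilon> \<and> \<phi> w t = 0" if w: "dist w p \<le> min \<epsilon> (\<delta> / 2)" for w
  proof -
    have "dist w p < \<delta>" "dist w p \<le> \<epsilon>" using w \<delta>(1) by auto
    then have "\<exists>t\<ge>t0 - \<epsilon>. t \<le> t0 + \<epsilon> \<and> \<phi> w t = 0"
      using \<delta>(2)[of w] e0 DERIV_isCont[OF deriv] by (intro IVT) (auto intro: less_imp_le)
    then obtain t where "t0 - \<epsilon> \<le> t" "t \<le> t0 + \<epsilon>" "\<phi> w t = 0" by blast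
    then have t: "\<bar>t - t0\<bar> \<le> \<epsilon>" "\<phi> w t = 0" by auto
    moreover have "s = t" if "\<bar>s - t0\<bar> \<le> \<epsilon>" "\<phi> w s = 0" for s
      using mono[OF \<open>dist w p \<le> \<epsilon>\<close>, of s t] mono[OF \<open>dist w p \<le> \<epsilon>\<close>, of t s] that t
      by (cases s t rule: linorder_cases) (auto simp: abs_le_iff)
    ultimately show ?thesis by blast
  qed
  moreover have "0 < min \<epsilon> (\<delta> / 2)" using e0 \<delta> by simp
  ultimately show ?thesis using e0 by blast
qed

lemma implicit_root:
  fixes \<phi> \<psi> :: "'a::metric_space \<Rightarrow> real \<Rightarrow> real"
  assumes cont: "continuous_on UNIV (\<lambda>(w, t). \<phi> w t)" "continuous_on UNIV (\<lambda>(w, t). \<psi> w t)"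
    and deriv: "\<And>w t. (\<phi> w has_real_derivative \<psi> w t) (at t)"
    and p: "\<phi> p t0 = 0" "\<psi> p t0 \<noteq> 0"
  shows "\<exists>\<epsilon>>0. \<exists>\<delta>>0. \<forall>w. dist w p \<le> \<delta> \<longrightarrow> (\<exists>!t. \<bar>t - t0\<bar> \<le> \<epsilon> \<and> \<phi> w t = 0)"
proof (cases "0 < \<psi> p t0")
  case True
  then show ?thesis using implicit_root_pos[OF cont deriv p(1)] by blast
next
  case False
  have "continuous_on UNIV (\<lambda>(w, t). - \<phi> w t)" "continuous_on UNIV (\<lambda>(w, t). - \<psi> w t)"
    using cont by (auto simp: case_prod_beta intro: continuous_on_minus)
  moreover have "((\<lambda>t. - \<phi> w t) has_real_derivative - \<psi> w t) (at t)" for w t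
    by (rule DERIV_minus[OF deriv])
  ultimately show ?thesis
    using implicit_root_pos[of "\<lambda>w t. - \<phi> w t" "\<lambda>w t. - \<psi> w t" p t0] False p by simp
qed

text \<open>The derivative of a relation of minimal degree cannot vanish on the set.\<close>

lemma separable_relations:
  fixes A :: "(real ^ 'n::finite) set"
  assumes J: "alg_indep A coords J" "\<forall>i. i \<notin> J \<longrightarrow> \<not> alg_indep A coords (insert i J)"
  shows "\<exists>u\<in>polyfun UNIV. \<exists>N c. alg_indep {x\<in>A. u (($) x) \<noteq> 0} coords J \<and>
    (\<forall>i. i \<notin> J \<longrightarrow> 1 \<le> N i \<and> (\<forall>k. c i k \<in> polyfun J) \<and> (\<exists>z. c i (N i) z \<noteq> 0) \<and>
      (\<forall>x\<in>A. u (($) x) \<noteq> 0 \<longrightarrow> (\<Sum>k\<le>N i. c i k (($) x) * x $ i ^ k) = 0 \<and>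
        (\<Sum>k\<le>N i. c i k (($) x) * (real k * x $ i ^ (k - 1))) \<noteq> 0))"
proof -
  define R where "R u i N c \<longleftrightarrow> 1 \<le> N \<and> (\<forall>k. c k \<in> polyfun J) \<and> (\<exists>z. c N z \<noteq> 0) \<and>
      (\<forall>x\<in>A. u (($) x) \<noteq> 0 \<longrightarrow> (\<Sum>k\<le>N. c k (($) x) * x $ i ^ k) = 0 \<and>
        (\<Sum>k\<le>N. c k (($) x) * (real k * x $ i ^ (k - 1))) \<noteq> 0)"
    for u :: "('n \<Rightarrow> real) \<Rightarrow> real" and i N and c :: "nat \<Rightarrow> ('n \<Rightarrow> real) \<Rightarrow> real"
  have "\<exists>u\<in>polyfun UNIV. \<exists>N c. alg_indep {x\<in>A. u (($) x) \<noteq> 0} coords J \<and> (\<forall>i\<in>I. R u i (N i) (c i))"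
    if "finite I" "I \<inter> J = {}" for I
    using that
  proof (induction I rule: finite_induct)
    case empty
    show ?case using J(1) by (intro bexI[of _ "\<lambda>_. 1"] polyfun.const) simp
  next
    case (insert i I)
    have "I \<inter> J = {}" using insert.prems by auto
    from insert.IH[OF this] obtain u N c where u: "u \<in> polyfun UNIV"
      "alg_indep {x\<in>A. u (($) x) \<noteq> 0} coords J" "\<forall>i\<in>I. R u i (N i) (c i)"
      by (elim bexE exE conjE) (rule that)
    have iJ: "i \<notin> J" using insert.prems by auto
    \<comment> \<open>The relation for \<open>i\<close> is chosen on the smaller set where the
      earlier relations are already separable; it is taken of least degree there.\<close>
    define A' where "A' = {x\<in>A. u (($) x) \<noteq> 0}"
    define S where "S n \<longleftrightarrow> (\<exists>d. (\<forall>k. d k \<in> polyfun J) \<and> (\<exists>z. d n z \<noteq> 0) \<and>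
      (\<forall>x\<in>A'. (\<Sum>k\<le>n. d k (($) x) * x $ i ^ k) = 0))" for n
    have A': "alg_indep A' coords J" using u(2) by (simp add: A'_def)
    have "\<not> alg_indep A' coords (insert i J)"
      using J(2) iJ alg_indep_mono[of A' coords "insert i J" A "insert i J"] by (auto simp: A'_def)
    then have "\<exists>n. S n" unfolding S_def by (rule algebraic_relation[OF A']) blast
    then have Sn: "S (LEAST n. S n)" by (rule LeastI_ex)
    define n where "n = (LEAST n. S n)"
    have min: "\<not> S m" if "m < n" for m using that not_less_Least unfolding n_def by blast
    have S0: "\<not> S 0"
    proof
      assume "S 0"
      then obtain d where d: "\<forall>k. d k \<in> polyfun J" "\<exists>z. d 0 z \<noteq> 0"
        "\<forall>x\<in>A'. (\<Sum>k\<le>0. d k (($) x) * x $ i ^ k) = 0"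
        unfolding S_def by blast
      obtain z where z: "d 0 z \<noteq> 0" using d(2) by blast
      show False by (rule alg_indep_point[where q="d 0", OF A' d(1)[rule_format] z]) (use d(3) in simp)
    qed
    obtain d where d: "\<And>k. d k \<in> polyfun J" "\<exists>z. d n z \<noteq> 0"
      "\<And>x. x \<in> A' \<Longrightarrow> (\<Sum>k\<le>n. d k (($) x) * x $ i ^ k) = 0"
      using Sn unfolding S_def n_def by blast
    have "n \<noteq> 0" using Sn S0 unfolding n_def by metis
    then obtain m where m: "n = Suc m" by (cases n) auto
    define e where "e z = (\<Sum>k\<le>n. d k z * (real k * z i ^ (k - 1)))" for z
    have e_alt: "e z = (\<Sum>k\<le>m. (real (Suc k) * d (Suc k) z) * z i ^ k)" for z
      unfolding e_def m by (subst sum.atMost_Suc_shift) (simp add: algebra_simps)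
    have e_poly: "e \<in> polyfun UNIV"
      unfolding e_def[abs_def] by (intro polyfun_intros polyfun_mono[OF d(1)]) auto
    define A'' where "A'' = {x\<in>A'. e (($) x) \<noteq> 0}"
    \<comment> \<open>Otherwise some nonzero \<open>h\<close> vanishes on \<open>A''\<close>, and
      \<open>h\<close> times the derivative \<open>e\<close> is a relation of degree
      \<open>m < n\<close> on all of \<open>A'\<close>. Its top coefficient is nonzero because the
      characteristic is 0.\<close>
    have "alg_indep A'' coords J"
    proof (rule ccontr)
      assume "\<not> ?thesis"
      then obtain h w where h: "h \<in> polyfun J" "\<And>x. x \<in> A'' \<Longrightarrow> h (($) x) = 0" "h w \<noteq> 0"
        unfolding alg_indep_def by blast
      have "(\<lambda>z. h z * (real (Suc k) * d (Suc k) z)) \<in> polyfun J" for k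
        by (intro polyfun_intros h d)
      moreover have "\<exists>z. h z * (real (Suc m) * d (Suc m) z) \<noteq> 0"
      proof -
        obtain z where "d n z \<noteq> 0" using d(2) by blast
        then obtain x where "h x \<noteq> 0" "d n x \<noteq> 0"
          using polyfun_nonzero_both[of h J "d n" w z] h(1,3) d(1) by auto
        then show ?thesis by (intro exI[of _ x]) (simp add: m)
      qed
      moreover have "(\<Sum>k\<le>m. h (($) x) * (real (Suc k) * d (Suc k) (($) x)) * x $ i ^ k) = 0" if "x \<in> A'" for x
      proof -
        have "h (($) x) * e (($) x) = 0" using h(2)[of x] that by (auto simp: A''_def)
        then show ?thesis unfolding e_alt sum_distrib_left by (simp only: mult.assoc)
      qed
      ultimately have "S m" unfolding S_def
        by (intro exI[of _ "\<lambda>k z. h z * (real (Suc k) * d (Suc k) z)"]) simp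
      then show False using min[of m] m by simp
    qed
    moreover have "A'' = {x\<in>A. u (($) x) * e (($) x) \<noteq> 0}" by (auto simp: A''_def A'_def)
    moreover have "R (\<lambda>z. u z * e z) j ((N(i := n)) j) ((c(i := d)) j)" if "j \<in> insert i I" for j
    proof (cases "j = i")
      case True
      have "R (\<lambda>z. u z * e z) i n d"
        unfolding R_def using d(1,2) d(3)[unfolded A'_def] m by (auto simp: e_def)
      then show ?thesis by (simp add: True)
    next
      case False
      then have "R u j (N j) (c j)" using u(3) that by simp
      then have "R (\<lambda>z. u z * e z) j (N j) (c j)" unfolding R_def by simp
      then show ?thesis using False by simp
    qed
    moreover have "(\<lambda>z. u z * e z) \<in> polyfun UNIV" by (intro polyfun.mult u e_poly)
    ultimately show ?case
      by (intro bexI[of _ "\<lambda>z. u z * e z"] exI[of _ "N(i := n)"] exI[of _ "c(i := d)"]) auto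
  qed
  from this[of "- J"] show ?thesis unfolding R_def by (simp add: Ball_def)
qed

context algebraic_over
begin

text \<open>A factorisation of the algebraic relation of a polynomial over the variables in \<^term>\<open>J\<close>:
  wherever the constant coefficient does not vanish, zero is an isolated value.\<close>

lemma isolated_zero:
  assumes "P \<in> polyfun UNIV"
  shows "\<exists>h\<in>polyfun J. \<exists>G\<in>polyfun UNIV. (\<exists>z. h z \<noteq> 0) \<and>
    (\<forall>x\<in>Z. lead (\<lambda>j. X j x) \<noteq> 0 \<longrightarrow>
       P (\<lambda>j. X j x) = 0 \<or> h (\<lambda>j. X j x) + P (\<lambda>j. X j x) * G (\<lambda>j. X j x) = 0)"
proof -
  \<comment> \<open>\<open>None\<close> stands for \<open>P\<close> and \<open>Some j\<close> for
    the coordinate \<open>j\<close>: one function more than \<open>card J\<close>, hence a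
    relation.\<close>
  define H where "H = case_option P (\<lambda>j z. z j)"
  have "card J < card (insert None (Some ` J))" by (simp add: card_insert_if card_image)
  moreover have H: "H b \<in> polyfun UNIV" if "b \<in> insert None (Some ` J)" for b
    using that assms polyfun.var[of _ UNIV] by (auto simp: H_def)
  moreover have "finite (insert None (Some ` J))" by simp
  ultimately have "\<exists>Q\<in>polyfun (insert None (Some ` J)). (\<exists>w. Q w \<noteq> 0) \<and>
    (\<forall>x\<in>Z. lead (\<lambda>j. X j x) \<noteq> 0 \<longrightarrow> Q (\<lambda>b. H b (\<lambda>j. X j x)) = 0)"
    by (intro algebraic_dependence)
  then obtain Q where Q: "Q \<in> polyfun (insert None (Some ` J))" "\<exists>w. Q w \<noteq> 0"
    "\<forall>x\<in>Z. lead (\<lambda>j. X j x) \<noteq> 0 \<longrightarrow> Q (\<lambda>b. H b (\<lambda>j. X j x)) = 0"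
    by (elim bexE conjE) (rule that)
  obtain w where w: "Q w \<noteq> 0" using Q(2) by blast
  obtain M e where e: "\<And>k. e k \<in> polyfun (Some ` J)" "\<And>z. Q z = (\<Sum>k\<le>M. e k z * z None ^ k)"
    using polyfun_expand[OF Q(1)] by blast
  have "\<exists>k. k \<le> M \<and> (\<exists>w. e k w \<noteq> 0)"
  proof (rule ccontr)
    assume "\<not> ?thesis"
    then have "Q w = 0" unfolding e(2) by (intro sum.neutral) auto
    then show False using w by simp
  qed
  then have L: "(LEAST k. k \<le> M \<and> (\<exists>w. e k w \<noteq> 0)) \<le> M \<and> (\<exists>w. e (LEAST k. k \<le> M \<and> (\<exists>w. e k w \<noteq> 0)) w \<noteq> 0)"
    by (rule LeastI_ex)
  \<comment> \<open>\<open>s\<close> is the lowest power of \<open>P\<close> that occurs in the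
    relation; after division by \<open>P ^ s\<close> the constant coefficient is nonzero.\<close>
  define s where "s = (LEAST k. k \<le> M \<and> (\<exists>w. e k w \<noteq> 0))"
  have s: "s \<le> M" "\<exists>w. e s w \<noteq> 0" using L by (auto simp: s_def)
  have below: "e k w = 0" if "k < s" for k w
    using not_less_Least[of k "\<lambda>k. k \<le> M \<and> (\<exists>w. e k w \<noteq> 0)"] that s(1) by (auto simp: s_def)
  define sub where "sub z = case_option 0 z" for z :: "'n \<Rightarrow> 'k"
  define d where "d k z = e k (sub z)" for k z
  have d: "d k \<in> polyfun J" for k
    unfolding d_def[abs_def] sub_def
    by (rule polyfun_compose[OF e(1), of "\<lambda>b z. case_option 0 z b"]) (auto intro: polyfun.var)
  define G where "G z = (\<Sum>k\<in>{s<..M}. d k z * P z ^ (k - Suc s))" for z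
  have "G \<in> polyfun UNIV" unfolding G_def[abs_def]
    by (intro polyfun_intros polyfun_mono[OF d] assms) auto
  moreover have "\<exists>z. d s z \<noteq> 0"
  proof -
    obtain w where w: "e s w \<noteq> 0" using s by blast
    have "d s (\<lambda>j. w (Some j)) = e s w" unfolding d_def
      by (rule polyfun_cong[OF e(1)]) (auto simp: sub_def)
    then show ?thesis using w by metis
  qed
  moreover have "P (\<lambda>j. X j x) = 0 \<or> d s (\<lambda>j. X j x) + P (\<lambda>j. X j x) * G (\<lambda>j. X j x) = 0"
    if "x \<in> Z" "lead (\<lambda>j. X j x) \<noteq> 0" for x
  proof -
    let ?z = "\<lambda>j. X j x"
    have eq: "e k (\<lambda>b. H b ?z) = d k ?z" for k
      unfolding d_def by (rule polyfun_cong[OF e(1)]) (auto simp: sub_def H_def)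
    have "0 = (\<Sum>k\<le>M. d k ?z * P ?z ^ k)"
      using Q(3)[rule_format, OF that] unfolding e(2) eq by (simp add: H_def)
    also have "\<dots> = (\<Sum>k\<in>{s..M}. d k ?z * P ?z ^ k)"
      using below by (intro sum.mono_neutral_right) (auto simp: d_def)
    also have "{s..M} = insert s {s<..M}" using s(1) by auto
    also have "(\<Sum>k\<in>insert s {s<..M}. d k ?z * P ?z ^ k) = d s ?z * P ?z ^ s + (\<Sum>k\<in>{s<..M}. d k ?z * P ?z ^ k)"
      by simp
    also have "(\<Sum>k\<in>{s<..M}. d k ?z * P ?z ^ k) = P ?z ^ s * (P ?z * G ?z)"
    proof -
      have "d k ?z * P ?z ^ k = P ?z ^ s * (P ?z * (d k ?z * P ?z ^ (k - Suc s)))" if "k \<in> {s<..M}" for k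
      proof -
        have "k = s + Suc (k - Suc s)" using that by auto
        then have "P ?z ^ k = P ?z ^ s * (P ?z * P ?z ^ (k - Suc s))" by (metis power_add power_Suc)
        then show ?thesis by simp
      qed
      then show ?thesis unfolding G_def sum_distrib_left by (intro sum.cong) auto
    qed
    finally have "P ?z ^ s * (d s ?z + P ?z * G ?z) = 0" by (simp add: algebra_simps)
    then show ?thesis by auto
  qed
  ultimately show ?thesis using d by blast
qed

text \<open>This replaces Hilbert's basis theorem: up to denominators in the variables in \<^term>\<open>J\<close>, finitely
  many members of \<^term>\<open>I\<close> generate it on \<^term>\<open>Z\<close>.\<close>

lemma finite_generators:
  assumes I: "I \<subseteq> polyfun UNIV"
  shows "\<exists>S\<subseteq>I. finite S \<and> (\<forall>P\<in>I. \<exists>\<beta>\<in>polyfun J. (\<exists>z. \<beta> z \<noteq> 0) \<and>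
    (\<forall>x\<in>Z. lead (\<lambda>j. X j x) \<noteq> 0 \<longrightarrow> (\<forall>R\<in>S. R (\<lambda>j. X j x) = 0) \<longrightarrow>
       \<beta> (\<lambda>j. X j x) * P (\<lambda>j. X j x) = 0))"
proof -
  define dep where "dep S \<longleftrightarrow> (\<exists>b. (\<forall>R. b R \<in> polyfun J) \<and> (\<exists>R\<in>S. \<exists>z. b R z \<noteq> 0) \<and>
    (\<forall>x\<in>Z. lead (\<lambda>j. X j x) \<noteq> 0 \<longrightarrow> (\<Sum>R\<in>S. b R (\<lambda>j. X j x) * R (\<lambda>j. X j x)) = 0))"
    for S :: "(('n \<Rightarrow> 'k) \<Rightarrow> 'k) set"
  define ok where "ok m \<longleftrightarrow> (\<exists>S\<subseteq>I. finite S \<and> \<not> dep S \<and> card S = m)" for m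
  \<comment> \<open>By \<open>linear_dependence\<close> an independent finite subset of
    \<open>I\<close> has at most \<open>K\<close> members, so a largest one exists and serves as
    \<open>S\<close>.\<close>
  define K where "K = (\<Prod>i\<in>- J. N i) * 2 ^ card J"
  have bound: "m \<le> K" if okm: "ok m" for m
  proof (rule ccontr)
    assume "\<not> m \<le> K"
    obtain S where S: "S \<subseteq> I" "finite S" "\<not> dep S" "card S = m"
      using okm unfolding ok_def by blast
    have "K < card S" using S(4) \<open>\<not> m \<le> K\<close> by simp
    moreover have "R \<in> polyfun UNIV" if "R \<in> S" for R using that S(1) I by blast
    ultimately have "dep S" unfolding dep_def K_def
      by (rule linear_dependence[where A = S and P = "\<lambda>R. R", OF S(2)])
    then show False using S by simp
  qed
  have "ok 0" unfolding ok_def dep_def by (intro exI[of _ "{}"]) simp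
  then have G: "ok (GREATEST m. ok m)" using bound by (rule GreatestI_nat)
  then obtain S where S: "S \<subseteq> I" "finite S" "\<not> dep S" "card S = (GREATEST m. ok m)"
    unfolding ok_def by blast
  have "\<exists>\<beta>\<in>polyfun J. (\<exists>z. \<beta> z \<noteq> 0) \<and>
    (\<forall>x\<in>Z. lead (\<lambda>j. X j x) \<noteq> 0 \<longrightarrow> (\<forall>R\<in>S. R (\<lambda>j. X j x) = 0) \<longrightarrow>
       \<beta> (\<lambda>j. X j x) * P (\<lambda>j. X j x) = 0)" if P: "P \<in> I" for P
  proof (cases "P \<in> S")
    case True
    then show ?thesis by (intro bexI[of _ "\<lambda>_. 1"] polyfun.const) auto
  next
    case False
    have "dep (insert P S)"
    proof (rule ccontr)
      assume "\<not> dep (insert P S)"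
      then have "ok (Suc (card S))" unfolding ok_def
        using S P False by (intro exI[of _ "insert P S"]) auto
      then have "Suc (card S) \<le> card S" unfolding S(4) using bound by (rule Greatest_le_nat)
      then show False by simp
    qed
    then obtain b where b: "\<forall>R. b R \<in> polyfun J" "\<exists>R\<in>insert P S. \<exists>z. b R z \<noteq> 0"
      "\<forall>x\<in>Z. lead (\<lambda>j. X j x) \<noteq> 0 \<longrightarrow> (\<Sum>R\<in>insert P S. b R (\<lambda>j. X j x) * R (\<lambda>j. X j x)) = 0"
      unfolding dep_def by (elim exE conjE) (rule that)
    have eq: "b P (\<lambda>j. X j x) * P (\<lambda>j. X j x) + (\<Sum>R\<in>S. b R (\<lambda>j. X j x) * R (\<lambda>j. X j x)) = 0"
      if "x \<in> Z" "lead (\<lambda>j. X j x) \<noteq> 0" for x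
      using b(3)[rule_format, OF that] S(2) False by simp
    \<comment> \<open>A relation without \<open>P\<close> would be one among the members of
      \<open>S\<close>. Hence the coefficient of \<open>P\<close> is nonzero and can serve as
      \<open>\<beta>\<close>.\<close>
    have "\<exists>z. b P z \<noteq> 0"
    proof (rule ccontr)
      assume z: "\<not> ?thesis"
      then have "\<exists>R\<in>S. \<exists>z. b R z \<noteq> 0" using b(2) by auto
      then have "dep S" unfolding dep_def
        using eq z b(1) by (intro exI[of _ b]) simp
      then show False using S(3) by simp
    qed
    moreover have "b P (\<lambda>j. X j x) * P (\<lambda>j. X j x) = 0"
      if "x \<in> Z" "lead (\<lambda>j. X j x) \<noteq> 0" "\<forall>R\<in>S. R (\<lambda>j. X j x) = 0" for x
    proof -
      have "(\<Sum>R\<in>S. b R (\<lambda>j. X j x) * R (\<lambda>j. X j x)) = 0" using that(3) by (intro sum.neutral) auto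
      then show ?thesis using eq[OF that(1,2)] by simp
    qed
    ultimately show ?thesis using b(1) by (intro bexI[of _ "b P"]) auto
  qed
  then show ?thesis using S(1,2) by blast
qed

end

definition zariski_closure :: "('k::comm_ring_1 ^ 'n::finite) set \<Rightarrow> ('k ^ 'n) set" where
  "zariski_closure A = {x. \<forall>P\<in>polyfun UNIV. (\<forall>a\<in>A. P (($) a) = 0) \<longrightarrow> P (($) x) = 0}"

lemma zariski_closure_superset: "A \<subseteq> zariski_closure A"
  unfolding zariski_closure_def by auto

text \<open>Near a generic point the Zariski closure is the graph of a continuous function of the
  coordinates in \<open>J\<close>, and \<open>\<gamma>\<close> is the projection onto this graph.\<close>

lemma zariski_closure_retract:
  fixes A :: "(real ^ 'n::finite) set"
  assumes J: "alg_indep A coords J" "\<forall>i. i \<notin> J \<longrightarrow> \<not> alg_indep A coords (insert i J)"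
  shows "\<exists>p\<in>A. \<exists>\<delta>>0. \<exists>\<gamma>. continuous_on (ball p \<delta>) \<gamma> \<and> \<gamma> p = p \<and>
    (\<forall>w\<in>ball p \<delta>. \<gamma> w \<in> zariski_closure A \<and> (\<forall>j\<in>J. \<gamma> w $ j = w $ j)) \<and>
    (\<forall>x\<in>zariski_closure A \<inter> ball p \<delta>. \<gamma> x = x)"
proof -
  obtain u N c where u: "u \<in> polyfun UNIV" "alg_indep {x\<in>A. u (($) x) \<noteq> 0} coords J"
    and uc: "\<forall>i. i \<notin> J \<longrightarrow> 1 \<le> N i \<and> (\<forall>k. c i k \<in> polyfun J) \<and> (\<exists>z. c i (N i) z \<noteq> 0) \<and>
      (\<forall>x\<in>A. u (($) x) \<noteq> 0 \<longrightarrow> (\<Sum>k\<le>N i. c i k (($) x) * x $ i ^ k) = 0 \<and>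
        (\<Sum>k\<le>N i. c i k (($) x) * (real k * x $ i ^ (k - 1))) \<noteq> 0)"
    using separable_relations[OF J] by (elim bexE exE conjE) (rule that)
  have cs: "1 \<le> N i" "c i k \<in> polyfun J" "\<exists>z. c i (N i) z \<noteq> 0" if "i \<notin> J" for i k
    using uc that by auto
  have rels: "(\<Sum>k\<le>N i. c i k (($) x) * x $ i ^ k) = 0"
     "(\<Sum>k\<le>N i. c i k (($) x) * (real k * x $ i ^ (k - 1))) \<noteq> 0"
    if "i \<notin> J" "x \<in> A" "u (($) x) \<noteq> 0" for i x
    using uc that by auto
  define \<phi> \<psi> where "\<phi> i w t = (\<Sum>k\<le>N i. c i k (($) w) * t ^ k)"
    and "\<psi> i w t = (\<Sum>k\<le>N i. c i k (($) w) * (real k * t ^ (k - 1)))" for i and w :: "real ^ 'n" and t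
  \<comment> \<open>\<open>Z\<close> is cut out by the chosen relations alone and need not coincide
    with the closure of \<open>A\<close>. The generators \<open>S\<close> and
    \<open>isolated_zero\<close> will show that the branch through \<open>p\<close> lies in the
    closure.\<close>
  define Z where "Z = {x :: real ^ 'n. \<forall>i. i \<notin> J \<longrightarrow> \<phi> i x (x $ i) = 0}"
  interpret algebraic_over Z coords J N c
    using cs(1,2) by unfold_locales (auto simp: Z_def \<phi>_def)
  define I where "I = {P\<in>polyfun UNIV. \<forall>a\<in>A. P (($) a) = 0}"
  have "I \<subseteq> polyfun UNIV" by (auto simp: I_def)
  from finite_generators[OF this] obtain S where S: "S \<subseteq> I" "finite S"
    "\<forall>P\<in>I. \<exists>\<beta>\<in>polyfun J. (\<exists>z. \<beta> z \<noteq> 0) \<and>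
    (\<forall>x\<in>Z. lead (($) x) \<noteq> 0 \<longrightarrow> (\<forall>R\<in>S. R (($) x) = 0) \<longrightarrow> \<beta> (($) x) * P (($) x) = 0)"
    by (elim exE conjE) (rule that)
  define iz where "iz P h G \<longleftrightarrow> h \<in> polyfun J \<and> G \<in> polyfun UNIV \<and> (\<exists>z. h z \<noteq> 0) \<and>
    (\<forall>x\<in>Z. lead (($) x) \<noteq> 0 \<longrightarrow> P (($) x) = 0 \<or> h (($) x) + P (($) x) * G (($) x) = 0)"
    for P h G :: "('n \<Rightarrow> real) \<Rightarrow> real"
  have "\<exists>h G. iz P h G" if "P \<in> S" for P
  proof -
    have "P \<in> polyfun UNIV" using that S(1) by (auto simp: I_def)
    from isolated_zero[OF this] show ?thesis unfolding iz_def by blast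
  qed
  then obtain h G where "\<And>P. P \<in> S \<Longrightarrow> iz P (h P) (G P)" by metis
  then have hG: "h P \<in> polyfun J" "G P \<in> polyfun UNIV" "\<exists>z. h P z \<noteq> 0"
    "x \<in> Z \<Longrightarrow> lead (($) x) \<noteq> 0 \<Longrightarrow> P (($) x) = 0 \<or> h P (($) x) + P (($) x) * G P (($) x) = 0"
    if "P \<in> S" for P x
    using that unfolding iz_def by auto
  have "\<exists>z. lead z \<noteq> 0" unfolding lead_def
    using polyfun_nonzero_prod[of "- J" "\<lambda>i. c i (N i)" J] cs(2,3) by simp
  moreover have "\<exists>z. (\<Prod>P\<in>S. h P z) \<noteq> 0"
    using polyfun_nonzero_prod[of S h J] hG(1,3) S(2) by simp
  moreover have hp: "(\<lambda>z. \<Prod>P\<in>S. h P z) \<in> polyfun J" by (intro polyfun_prod hG)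
  ultimately obtain z where z: "lead z \<noteq> 0" "(\<Prod>P\<in>S. h P z) \<noteq> 0"
    using polyfun_nonzero_both[of lead J "\<lambda>z. \<Prod>P\<in>S. h P z"] lead_polyfun by blast
  \<comment> \<open>A point of \<open>A\<close> at which \<open>u\<close> and \<open>lh\<close> are
    nonzero avoids all degenerate loci at once.\<close>
  define lh where "lh z = lead z * (\<Prod>P\<in>S. h P z)" for z
  have lh: "lh \<in> polyfun J" "lh z \<noteq> 0"
    unfolding lh_def[abs_def] using z by (auto intro: polyfun.mult lead_polyfun hp)
  obtain p where p: "p \<in> A" "u (($) p) \<noteq> 0" "lh (($) p) \<noteq> 0"
    by (rule alg_indep_point[where q=lh, OF u(2) lh]) (use that in auto)
  have lead_p: "lead (($) p) \<noteq> 0" and h_p: "\<And>P. P \<in> S \<Longrightarrow> h P (($) p) \<noteq> 0"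
    using p(3) S(2) by (auto simp: lh_def)

  have cont: "continuous_on UNIV (\<lambda>(w, t). \<phi> i w t)" "continuous_on UNIV (\<lambda>(w, t). \<psi> i w t)"
    if "i \<notin> J" for i
    unfolding \<phi>_def \<psi>_def case_prod_beta
    by (intro continuous_intros continuous_on_compose2[OF continuous_polyfun[OF cs(2)[OF that], of UNIV]]; simp)+
  have deriv: "(\<phi> i w has_real_derivative \<psi> i w t) (at t)" for i w t
    unfolding \<phi>_def \<psi>_def by (auto intro!: derivative_eq_intros sum.cong)
  have "\<exists>\<epsilon>>0. \<exists>\<delta>>0. \<forall>w. dist w p \<le> \<delta> \<longrightarrow> (\<exists>!t. \<bar>t - p $ i\<bar> \<le> \<epsilon> \<and> \<phi> i w t = 0)"
    if "i \<notin> J" for i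
    by (rule implicit_root[OF cont[OF that] deriv])
      (use rels[OF that p(1,2)] in \<open>auto simp: \<phi>_def \<psi>_def\<close>)
  then obtain \<epsilon> \<delta>' where ed: "\<And>i. i \<notin> J \<Longrightarrow> 0 < \<epsilon> i" "\<And>i. i \<notin> J \<Longrightarrow> 0 < \<delta>' i"
    "\<And>i w. i \<notin> J \<Longrightarrow> dist w p \<le> \<delta>' i \<Longrightarrow> \<exists>!t. \<bar>t - p $ i\<bar> \<le> \<epsilon> i \<and> \<phi> i w t = 0"
    by metis
  define \<delta>0 where "\<delta>0 = Min (insert 1 (\<delta>' ` (- J) \<union> \<epsilon> ` (- J)))"
  have \<delta>0: "0 < \<delta>0" "\<delta>0 \<le> \<delta>' i" "\<delta>0 \<le> \<epsilon> i" if "i \<notin> J" for i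
    using that ed(1,2) unfolding \<delta>0_def by (auto simp: Min_gr_iff)
  have \<delta>0_pos: "0 < \<delta>0" using ed(1,2) unfolding \<delta>0_def by (subst Min_gr_iff) auto
  \<comment> \<open>The value depends only on the coordinates of \<open>w\<close> in
    \<open>J\<close>, since the coefficients \<open>c i k\<close> do.\<close>
  define \<gamma> where "\<gamma> w = (\<chi> i. if i \<in> J then w $ i else THE t. \<bar>t - p $ i\<bar> \<le> \<epsilon> i \<and> \<phi> i w t = 0)" for w
  have \<gamma>J: "\<gamma> w $ j = w $ j" if "j \<in> J" for w j using that by (simp add: \<gamma>_def)
  have root: "\<bar>\<gamma> w $ i - p $ i\<bar> \<le> \<epsilon> i \<and> \<phi> i w (\<gamma> w $ i) = 0" if "w \<in> cball p \<delta>0" "i \<notin> J" for w i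
  proof -
    have "dist w p \<le> \<delta>' i" using that \<delta>0(2)[OF that(2)] by (simp add: dist_commute)
    from theI'[OF ed(3)[OF that(2) this]] show ?thesis using that(2) by (simp add: \<gamma>_def)
  qed
  have uniq: "x = \<gamma> w" if "w \<in> cball p \<delta>0" "\<And>j. j \<in> J \<Longrightarrow> x $ j = w $ j"
    "\<And>i. i \<notin> J \<Longrightarrow> \<bar>x $ i - p $ i\<bar> \<le> \<epsilon> i \<and> \<phi> i w (x $ i) = 0" for x w
  proof (rule vec_eq_iff[THEN iffD2, rule_format])
    fix i show "x $ i = \<gamma> w $ i"
    proof (cases "i \<in> J")
      case True
      then show ?thesis using that(2) \<gamma>J by simp
    next
      case False
      have "dist w p \<le> \<delta>' i" using that(1) \<delta>0(2)[OF False] by (simp add: dist_commute)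
      from ed(3)[OF False this] that(3)[OF False] root[OF that(1) False] show ?thesis by blast
    qed
  qed
  have cong: "\<phi> i w t = \<phi> i w' t" if "i \<notin> J" "\<And>j. j \<in> J \<Longrightarrow> w $ j = w' $ j" for i w w' t
  proof -
    have "c i k (($) w) = c i k (($) w')" for k
      by (rule polyfun_cong[OF cs(2)[OF that(1)]]) (rule that(2))
    then show ?thesis by (simp add: \<phi>_def)
  qed
  have \<gamma>Z: "\<gamma> w \<in> Z" if "w \<in> cball p \<delta>0" for w
    unfolding Z_def
  proof (intro CollectI allI impI)
    fix i assume i: "i \<notin> J"
    show "\<phi> i (\<gamma> w) (\<gamma> w $ i) = 0"
      using root[OF that i] cong[of i "\<gamma> w" w, OF i \<gamma>J] by simp
  qed
  have \<gamma>p: "\<gamma> p = p"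
    by (rule uniq[symmetric]) (use \<delta>0_pos ed(1) rels(1) p in \<open>auto simp: \<phi>_def less_imp_le\<close>)
  define B where "B = cbox (p - (\<chi> i. max \<delta>0 (\<epsilon> i))) (p + (\<chi> i. max \<delta>0 (\<epsilon> i)))"
  have \<gamma>B: "\<gamma> w \<in> B" if w: "w \<in> cball p \<delta>0" for w
  proof -
    have "\<bar>\<gamma> w $ i - p $ i\<bar> \<le> max \<delta>0 (\<epsilon> i)" for i
    proof (cases "i \<in> J")
      case True
      have "\<bar>(w - p) $ i\<bar> \<le> norm (w - p)" by (rule component_le_norm_cart)
      then show ?thesis using True \<gamma>J w by (simp add: dist_norm norm_minus_commute le_max_iff_disj)
    next
      case False
      then show ?thesis using root[OF w False] by (simp add: le_max_iff_disj)
    qed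
    then show ?thesis unfolding B_def mem_box_cart by (simp add: abs_le_iff algebra_simps)
  qed
  \<comment> \<open>Uniqueness of the roots makes the graph a closed set, and a map into a compact
    box with closed graph is continuous.\<close>
  have "continuous_on (cball p \<delta>0) \<gamma>"
  proof (rule continuous_from_closed_graph)
    show "compact B" unfolding B_def by (rule compact_cbox)
    show "\<gamma> \<in> cball p \<delta>0 \<rightarrow> B" using \<gamma>B by auto
    have "(\<lambda>w. (w, \<gamma> w)) ` cball p \<delta>0 = (cball p \<delta>0 \<times> B) \<inter>
      {(w, x). \<forall>i. (i \<in> J \<longrightarrow> x $ i = w $ i) \<and> (i \<notin> J \<longrightarrow> \<bar>x $ i - p $ i\<bar> \<le> \<epsilon> i \<and> \<phi> i w (x $ i) = 0)}"
      (is "_ = ?R")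
    proof (intro equalityI subsetI)
      fix y assume "y \<in> (\<lambda>w. (w, \<gamma> w)) ` cball p \<delta>0"
      then show "y \<in> ?R" using \<gamma>B \<gamma>J root by auto
    next
      fix y assume y: "y \<in> ?R"
      then have "snd y = \<gamma> (fst y)" by (intro uniq) auto
      then show "y \<in> (\<lambda>w. (w, \<gamma> w)) ` cball p \<delta>0" using y by (intro image_eqI[of _ _ "fst y"]) auto
    qed
    moreover have "closed \<dots>"
    proof (intro closed_Int closed_Times closed_cball)
      show "closed B" unfolding B_def by (rule closed_cbox)
      have "closed {y :: (real^'n) \<times> (real^'n). \<phi> i (fst y) (snd y $ i) = 0}" if "i \<notin> J" for i
        by (intro closed_Collect_eq continuous_intros
          continuous_on_compose2[OF cont(1)[OF that], of UNIV "\<lambda>y. (fst y, snd y $ i)", simplified])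
      note closed_root = this
      have "closed {y. (i \<in> J \<longrightarrow> snd y $ i = fst y $ i) \<and>
          (i \<notin> J \<longrightarrow> \<bar>snd y $ i - p $ i\<bar> \<le> \<epsilon> i \<and> \<phi> i (fst y) (snd y $ i) = 0)}" for i
      proof (cases "i \<in> J")
        case True
        then show ?thesis by (simp, intro closed_Collect_eq continuous_intros)
      next
        case False
        have "closed {y :: (real^'n) \<times> (real^'n). \<bar>snd y $ i - p $ i\<bar> \<le> \<epsilon> i}"
          by (intro closed_Collect_le continuous_intros)
        then show ?thesis using False closed_root[OF False] by (auto intro: closed_Collect_conj)
      qed
      then show "closed {(w, x). \<forall>i. (i \<in> J \<longrightarrow> x $ i = w $ i) \<and> (i \<notin> J \<longrightarrow> \<bar>x $ i - p $ i\<bar> \<le> \<epsilon> i \<and> \<phi> i w (x $ i) = 0)}"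
        unfolding case_prod_beta by (rule closed_Collect_all)
    qed
    ultimately show "closed ((\<lambda>w. (w, \<gamma> w)) ` cball p \<delta>0)" by simp
  qed
  then have \<gamma>cont: "continuous_on (ball p \<delta>0) \<gamma>"
    by (rule continuous_on_subset) auto
  have poly_cont: "continuous_on (ball p \<delta>0) (\<lambda>w. P (($) (\<gamma> w)))" if "P \<in> polyfun K" for P K
    by (rule continuous_on_compose2[OF continuous_polyfun[OF that, of UNIV] \<gamma>cont]) simp
  have nbhd: "\<exists>d>0. \<forall>w\<in>ball p d. F w \<noteq> 0" if "continuous_on (ball p \<delta>0) F" "F p \<noteq> 0" for F :: "real ^ 'n \<Rightarrow> real"
  proof -
    have "isCont F p" using that(1) \<delta>0_pos by (simp add: continuous_on_eq_continuous_at)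
    from continuous_at_avoid[OF this that(2)] show ?thesis by (auto simp: dist_commute)
  qed
  obtain d1 where d1: "0 < d1" "\<forall>w\<in>ball p d1. u (($) w) \<noteq> 0"
    using nbhd[OF continuous_polyfun[OF u(1)]] p(2) by blast
  have Pp: "P (($) p) = 0" if "P \<in> S" for P using S(1) that p(1) by (auto simp: I_def)
  \<comment> \<open>Where \<open>F\<close> is nonzero, the second alternative of
    \<open>isolated_zero\<close> is excluded for every generator, so all members of \<open>S\<close>
    vanish at \<open>\<gamma> w\<close>.\<close>
  define F where "F w = lead (($) (\<gamma> w)) * (\<Prod>P\<in>S. h P (($) (\<gamma> w)) + P (($) (\<gamma> w)) * G P (($) (\<gamma> w)))" for w
  have SP: "P \<in> polyfun UNIV" if "P \<in> S" for P using that S(1) by (auto simp: I_def)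
  have "continuous_on (ball p \<delta>0) F" unfolding F_def
    by (intro continuous_intros poly_cont[OF lead_polyfun] poly_cont[OF hG(1)] poly_cont[OF hG(2)] poly_cont[OF SP])
  moreover have "F p \<noteq> 0"
  proof -
    have "h P (($) p) + P (($) p) * G P (($) p) \<noteq> 0" if "P \<in> S" for P
      using h_p[OF that] Pp[OF that] by simp
    then show ?thesis using lead_p S(2) by (simp add: F_def \<gamma>p)
  qed
  ultimately obtain d2 where d2: "0 < d2" "\<forall>w\<in>ball p d2. F w \<noteq> 0" using nbhd by blast
  define \<delta> where "\<delta> = min \<delta>0 (min d1 d2)"
  have \<delta>: "0 < \<delta>" "ball p \<delta> \<subseteq> ball p \<delta>0" "ball p \<delta> \<subseteq> ball p d1" "ball p \<delta> \<subseteq> ball p d2"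
    using \<delta>0_pos d1 d2 by (auto simp: \<delta>_def)
  have cb: "ball p \<delta> \<subseteq> cball p \<delta>0" using \<delta>(2) ball_subset_cball by blast
  have vanish: "P (($) (\<gamma> w)) = 0" if P: "P \<in> I" and w: "w \<in> ball p \<delta>" for P w
  proof (rule ccontr)
    \<comment> \<open>The contradiction: \<open>\<beta>\<close> takes the same value at
      \<open>v\<close> and \<open>\<gamma> v\<close>, and it cannot vanish on a whole ball. So
      \<open>P\<close> vanishes at \<open>\<gamma> v\<close> for some \<open>v\<close> arbitrarily
      near \<open>w\<close>.\<close>
    assume nz: "P (($) (\<gamma> w)) \<noteq> 0"
    have PU: "P \<in> polyfun UNIV" using P by (simp add: I_def)
    have gen: "R (($) (\<gamma> v)) = 0" if "R \<in> S" "v \<in> ball p \<delta>" for R v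
    proof -
      have "F v \<noteq> 0" using d2(2) \<delta>(4) that(2) by blast
      then have "lead (($) (\<gamma> v)) \<noteq> 0" "h R (($) (\<gamma> v)) + R (($) (\<gamma> v)) * G R (($) (\<gamma> v)) \<noteq> 0"
        using that(1) S(2) by (auto simp: F_def)
      moreover have "\<gamma> v \<in> Z" using \<gamma>Z cb that(2) by blast
      ultimately show ?thesis using hG(4)[OF that(1), of "\<gamma> v"] by blast
    qed
    obtain \<beta> where \<beta>: "\<beta> \<in> polyfun J" "\<exists>z. \<beta> z \<noteq> 0"
      "\<forall>x\<in>Z. lead (($) x) \<noteq> 0 \<longrightarrow> (\<forall>R\<in>S. R (($) x) = 0) \<longrightarrow> \<beta> (($) x) * P (($) x) = 0"
      using S(3)[rule_format, OF P] by (elim bexE conjE) (rule that)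
    have "isCont (\<lambda>w. P (($) (\<gamma> w))) w"
      using poly_cont[OF PU] w \<delta>(2) by (auto simp: continuous_on_eq_continuous_at)
    from continuous_at_avoid[OF this nz] obtain e where e: "e > 0"
      "\<forall>v. dist w v < e \<longrightarrow> P (($) (\<gamma> v)) \<noteq> 0" by blast
    obtain e' where e': "e' > 0" "ball w e' \<subseteq> ball p \<delta>" using w openE[OF open_ball] by blast
    obtain z where "\<beta> z \<noteq> 0" using \<beta>(2) by blast
    then obtain v where v: "dist v w < min e e'" "\<beta> (($) v) \<noteq> 0"
      using polyfun_nonzero_dense[of \<beta> J z "min e e'" w] \<beta>(1) e(1) e'(1) by auto
    have "v \<in> ball w e'" using v(1) by (simp add: dist_commute)
    then have vb: "v \<in> ball p \<delta>" using e'(2) by blast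
    have "\<beta> (($) (\<gamma> v)) = \<beta> (($) v)" by (rule polyfun_cong[OF \<beta>(1)]) (rule \<gamma>J)
    moreover have "lead (($) (\<gamma> v)) \<noteq> 0" using d2(2) \<delta>(4) vb by (auto simp: F_def)
    moreover have "\<gamma> v \<in> Z" using \<gamma>Z cb vb by blast
    ultimately have "P (($) (\<gamma> v)) = 0" using \<beta>(3) gen[OF _ vb] v(2) by auto
    then show False using e(2) v(1) by (auto simp: dist_commute)
  qed
  have fix_Z: "\<gamma> x = x" if x: "x \<in> zariski_closure A" "x \<in> ball p \<delta>" for x
  proof (rule uniq[symmetric])
    show "x \<in> cball p \<delta>0" using x(2) cb by blast
    fix i assume i: "i \<notin> J"
    have "\<bar>(x - p) $ i\<bar> \<le> norm (x - p)" by (rule component_le_norm_cart)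
    also have "\<dots> \<le> \<delta>0" using x(2) \<delta>(2) by (auto simp: dist_norm norm_minus_commute)
    also have "\<dots> \<le> \<epsilon> i" by (rule \<delta>0(3)[OF i])
    finally have "\<bar>x $ i - p $ i\<bar> \<le> \<epsilon> i" by simp
    moreover have "\<phi> i x (x $ i) = 0"
    proof -
      \<comment> \<open>The factor \<open>u\<close> turns a relation that holds on \<open>A\<close>
        where \<open>u\<close> is nonzero into a polynomial vanishing on all of
        \<open>A\<close>.\<close>
      define q where "q z = u z * (\<Sum>k\<le>N i. c i k z * z i ^ k)" for z
      have "q \<in> polyfun UNIV" unfolding q_def[abs_def]
        by (intro polyfun_intros u(1) polyfun_mono[OF cs(2)[OF i]]) auto
      moreover have "\<forall>a\<in>A. q (($) a) = 0" using rels(1)[OF i] by (auto simp: q_def)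
      ultimately have "q (($) x) = 0" using x(1) unfolding zariski_closure_def by blast
      moreover have "u (($) x) \<noteq> 0" using d1(2) \<delta>(3) x(2) by blast
      ultimately show ?thesis by (simp add: q_def \<phi>_def)
    qed
    ultimately show "\<bar>x $ i - p $ i\<bar> \<le> \<epsilon> i \<and> \<phi> i x (x $ i) = 0" by simp
  qed simp
  have "\<gamma> w \<in> zariski_closure A" if "w \<in> ball p \<delta>" for w
    using vanish[OF _ that] unfolding zariski_closure_def I_def by blast
  moreover have "continuous_on (ball p \<delta>) \<gamma>" using \<gamma>cont \<delta>(2) by (rule continuous_on_subset)
  ultimately show ?thesis using p(1) \<delta>(1) \<gamma>p \<gamma>J fix_Z
    by (intro bexI[of _ p] exI[of _ \<delta>] exI[of _ \<gamma>]) auto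
qed

section \<open>Submersions with finite fibers\<close>

text \<open>The map \<open>v + A (\<phi> v) - A (D v)\<close> has the identity as derivative at
  \<open>v0\<close>, hence its image contains a ball. It moves \<open>v\<close> only by vectors of
  \<open>L\<close>, so points of \<open>L\<close> are reached from \<open>L\<close>.\<close>

lemma open_image_in_subspace:
  fixes \<phi> :: "'a::euclidean_space \<Rightarrow> 'b::euclidean_space" and A :: "'b \<Rightarrow> 'a"
  assumes V: "open V" "v0 \<in> V" and L: "subspace L"
    and \<phi>: "continuous_on V \<phi>" "(\<phi> has_derivative D) (at v0)"
    and A: "linear A" "range A \<subseteq> L"
  shows "\<exists>e>0. \<forall>w\<in>L. dist w (v0 + A (\<phi> v0) - A (D v0)) < e \<longrightarrow>
    (\<exists>v\<in>V \<inter> L. v + A (\<phi> v) - A (D v) = w)"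
proof -
  define \<theta> where "\<theta> v = v + A (\<phi> v) - A (D v)" for v
  have D: "linear D" using \<phi>(2) by (simp add: has_derivative_linear)
  have bA: "bounded_linear A" and bD: "bounded_linear D"
    using A(1) D by (simp_all add: linear_conv_bounded_linear)
  have "(\<theta> has_derivative (\<lambda>v. v + A (D v) - A (D v))) (at v0)"
    unfolding \<theta>_def
    by (intro derivative_intros bounded_linear.has_derivative[OF bA] \<phi>(2) bounded_linear_imp_has_derivative bD)
  then have d: "(\<theta> has_derivative id) (at v0)" by (simp add: id_def)
  have c: "continuous_on V \<theta>"
    unfolding \<theta>_def
    by (intro continuous_intros linear_continuous_on_compose[OF _ A(1)] linear_continuous_on_compose[OF _ D] \<phi>(1))
  have "\<theta> v0 \<in> interior (\<theta> ` V)"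
    by (rule sussmann_open_mapping[OF V(1) c V(2) d bounded_linear_ident])
      (use V in \<open>auto simp: interior_open id_def o_def\<close>)
  then obtain e where e: "e > 0" "ball (\<theta> v0) e \<subseteq> \<theta> ` V" unfolding mem_interior by blast
  have "\<exists>v\<in>V \<inter> L. \<theta> v = w" if w: "w \<in> L" "dist w (\<theta> v0) < e" for w
  proof -
    have "w \<in> \<theta> ` V" using w(2) e(2) by (auto simp: dist_commute)
    then obtain v where v: "v \<in> V" "\<theta> v = w" by blast
    have "v = w + (A (D v) - A (\<phi> v))" using v(2) by (simp add: \<theta>_def algebra_simps)
    also have "\<dots> \<in> L" using w(1) A(2) by (intro subspace_add[OF L] subspace_diff[OF L]) auto
    finally show ?thesis using v by blast
  qed
  then show ?thesis using e(1) unfolding \<theta>_def by blast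
qed

text \<open>With \<open>A\<close> a right inverse of \<open>D\<close> on \<open>L'\<close>, applying
  \<open>D\<close> to \<open>v + A (\<phi> v) - A (D v)\<close> gives \<open>\<phi> v\<close>.
  Prescribing this perturbed identity therefore prescribes \<open>\<phi>\<close>: all nearby points
  of \<open>L'\<close> are reached, and moving along the kernel of \<open>D\<close> leaves
  \<open>\<phi>\<close> unchanged.\<close>

lemma local_submersion:
  fixes \<phi> :: "'a::euclidean_space \<Rightarrow> 'b::euclidean_space"
  assumes V: "open V" "v0 \<in> V \<inter> L" and L: "subspace L" "subspace L'"
    and \<phi>: "continuous_on V \<phi>" "(\<phi> has_derivative D) (at v0)" "\<phi> ` (V \<inter> L) \<subseteq> L'"
    and D: "D ` L = L'"
  shows "\<exists>e>0. \<forall>y\<in>L'. dist y (\<phi> v0) < e \<longrightarrow> (\<exists>v\<in>V \<inter> L. \<phi> v = y)"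
    and "dim L \<noteq> dim L' \<Longrightarrow> infinite {v\<in>V \<inter> L. \<phi> v = \<phi> v0}"
proof -
  have lD: "linear D" using \<phi>(2) by (simp add: has_derivative_linear)
  obtain A where A: "range A \<subseteq> L" "linear A" "\<And>y. y \<in> L' \<Longrightarrow> D (A y) = y"
    using linear_exists_right_inverse_on[OF lD L(1)] unfolding D by auto
  have bA: "bounded_linear A" using A(2) by (simp add: linear_conv_bounded_linear)
  obtain e where e: "e > 0" "\<And>w. w \<in> L \<Longrightarrow> dist w (v0 + A (\<phi> v0) - A (D v0)) < e \<Longrightarrow>
    \<exists>v\<in>V \<inter> L. v + A (\<phi> v) - A (D v) = w"
    using open_image_in_subspace[OF V(1) _ L(1) \<phi>(1,2) A(2,1)] V(2) by blast
  have base: "v0 + A (\<phi> v0) - A (D v0) \<in> L"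
    using V(2) A(1) by (intro subspace_add[OF L(1)] subspace_diff[OF L(1)]) auto
  have DL: "D v \<in> L'" if "v \<in> L" for v using D that by blast
  have key: "D (v + A (\<phi> v) - A (D v)) = \<phi> v" if "v \<in> V \<inter> L" for v
  proof -
    have "\<phi> v \<in> L'" "D v \<in> L'" using \<phi>(3) that DL by auto
    then show ?thesis using A(3) by (simp add: linear_add[OF lD] linear_diff[OF lD])
  qed
  show "\<exists>e>0. \<forall>y\<in>L'. dist y (\<phi> v0) < e \<longrightarrow> (\<exists>v\<in>V \<inter> L. \<phi> v = y)"
  proof -
    obtain B where B: "B > 0" "\<And>x. norm (A x) \<le> norm x * B" using bounded_linear.pos_bounded[OF bA] by blast
    have "\<exists>v\<in>V \<inter> L. \<phi> v = y" if y: "y \<in> L'" "dist y (\<phi> v0) < e / B" for y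
    proof -
      define w where "w = v0 + A (\<phi> v0) - A (D v0) + A (y - \<phi> v0)"
      have "w \<in> L" unfolding w_def using base A(1) by (intro subspace_add[OF L(1)]) auto
      moreover have "dist w (v0 + A (\<phi> v0) - A (D v0)) < e"
        using B(2)[of "y - \<phi> v0"] y(2) B(1) by (simp add: w_def dist_norm pos_less_divide_eq)
      ultimately obtain v where v: "v \<in> V \<inter> L" "v + A (\<phi> v) - A (D v) = w" using e(2) by blast
      have "y - \<phi> v0 \<in> L'" using y(1) \<phi>(3) V(2) by (intro subspace_diff[OF L(2)]) auto
      then have "D w = \<phi> v0 + (y - \<phi> v0)"
        unfolding w_def by (simp add: linear_add[OF lD] key[OF V(2)] A(3))
      then show ?thesis using key[OF v(1)] v by (intro bexI[of _ v]) auto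
    qed
    then show ?thesis using e(1) B(1) by (intro exI[of _ "e / B"]) auto
  qed
  show "infinite {v\<in>V \<inter> L. \<phi> v = \<phi> v0}" if dim: "dim L \<noteq> dim L'"
  proof -
    have "\<not> inj_on D (span L)"
      using dim_image_eq[OF lD, of L] dim D by auto
    then obtain x y where xy: "x \<in> L" "y \<in> L" "x \<noteq> y" "D x = D y"
      unfolding inj_on_def span_eq_iff[THEN iffD2, OF L(1)] by blast
    define \<kappa> where "\<kappa> = x - y"
    have \<kappa>: "\<kappa> \<in> L" "\<kappa> \<noteq> 0" "D \<kappa> = 0"
      using xy subspace_diff[OF L(1)] by (auto simp: \<kappa>_def linear_diff[OF lD])
    define T where "T = {0<..<e / norm \<kappa>}"
    have "\<exists>v. v \<in> V \<inter> L \<and> v + A (\<phi> v) - A (D v) = v0 + A (\<phi> v0) - A (D v0) + t *\<^sub>R \<kappa>" if "t \<in> T" for t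
    proof -
      have "v0 + A (\<phi> v0) - A (D v0) + t *\<^sub>R \<kappa> \<in> L"
        using base \<kappa> L(1) by (intro subspace_add subspace_scale) auto
      moreover have "dist (v0 + A (\<phi> v0) - A (D v0) + t *\<^sub>R \<kappa>) (v0 + A (\<phi> v0) - A (D v0)) < e"
        using that \<kappa> by (simp add: T_def dist_norm pos_less_divide_eq)
      ultimately show ?thesis using e(2) by blast
    qed
    then obtain v where v: "\<And>t. t \<in> T \<Longrightarrow> v t \<in> V \<inter> L"
      "\<And>t. t \<in> T \<Longrightarrow> v t + A (\<phi> (v t)) - A (D (v t)) = v0 + A (\<phi> v0) - A (D v0) + t *\<^sub>R \<kappa>"
      by metis
    have fib: "\<phi> (v t) = \<phi> v0" if "t \<in> T" for t
      using key[OF v(1)[OF that]] key[OF V(2)] \<kappa>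
      unfolding v(2)[OF that] linear_add[OF lD, of _ "t *\<^sub>R \<kappa>"] by (simp add: linear_scale[OF lD])
    have "inj_on v T"
    proof (rule inj_onI)
      fix s t assume st: "s \<in> T" "t \<in> T" "v s = v t"
      then have "s *\<^sub>R \<kappa> = t *\<^sub>R \<kappa>" using v(2)[OF st(1)] v(2)[OF st(2)] by (metis add_left_cancel)
      then show "s = t" using \<kappa>(2) scaleR_cancel_right by blast
    qed
    moreover have "infinite T" unfolding T_def using e(1) \<kappa> by (intro infinite_Ioo) simp
    ultimately have "infinite (v ` T)" by (simp add: finite_image_iff)
    moreover have "v ` T \<subseteq> {v\<in>V \<inter> L. \<phi> v = \<phi> v0}" using v(1) fib by auto
    ultimately show ?thesis using finite_subset by blast
  qed
qed

section \<open>Local injectivity of continuously differentiable maps\<close>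

definition C1_on :: "'a::real_normed_vector set \<Rightarrow> ('a \<Rightarrow> 'b::real_normed_vector) \<Rightarrow> ('a \<Rightarrow> 'a \<Rightarrow> 'b) \<Rightarrow> bool" where
  "C1_on V f D \<longleftrightarrow> (\<forall>x\<in>V. (f has_derivative D x) (at x)) \<and> (\<forall>v. continuous_on V (\<lambda>x. D x v))"

lemma C1_on_continuous: "C1_on V f D \<Longrightarrow> continuous_on V f"
  unfolding C1_on_def by (meson continuous_at_imp_continuous_on has_derivative_continuous)

lemma C1_on_subset: "C1_on V f D \<Longrightarrow> W \<subseteq> V \<Longrightarrow> C1_on W f D"
  unfolding C1_on_def by (meson continuous_on_subset subsetD)

lemma C1_on_compose:
  fixes f :: "'b::euclidean_space \<Rightarrow> 'c::real_normed_vector"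
  assumes g: "C1_on V g D" and f: "C1_on U f E" and sub: "g ` V \<subseteq> U"
  shows "C1_on V (f \<circ> g) (\<lambda>x. E (g x) \<circ> D x)"
  unfolding C1_on_def
proof (intro conjI ballI allI)
  fix x assume "x \<in> V"
  then show "(f \<circ> g has_derivative E (g x) \<circ> D x) (at x)"
    using g f sub unfolding C1_on_def by (intro diff_chain_at) auto
next
  fix v
  have "(E (g x) \<circ> D x) v = (\<Sum>c\<in>Basis. (D x v \<bullet> c) *\<^sub>R E (g x) c)" if "x \<in> V" for x
  proof -
    have lin: "linear (E (g x))" using f sub that unfolding C1_on_def by (auto intro: has_derivative_linear)
    have "E (g x) (D x v) = E (g x) (\<Sum>c\<in>Basis. (D x v \<bullet> c) *\<^sub>R c)" by (simp add: euclidean_representation)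
    then show ?thesis by (simp add: linear_sum[OF lin] linear_scale[OF lin])
  qed
  moreover have "continuous_on V (\<lambda>x. (\<Sum>c\<in>Basis. (D x v \<bullet> c) *\<^sub>R E (g x) c))"
    using f g sub C1_on_continuous[OF g] unfolding C1_on_def
    by (intro continuous_intros) (auto intro: continuous_on_compose2)
  ultimately show "continuous_on V (\<lambda>x. (E (g x) \<circ> D x) v)"
    by (simp cong: continuous_on_cong)
qed

text \<open>Here \<open>A\<close> is a left inverse of \<open>D v0\<close> on \<open>L\<close>. On
  \<open>L\<close> the perturbed identity \<open>v + A (\<phi> v) - A (D v0 v)\<close> reduces to
  \<open>A (\<phi> v)\<close>, and it is injective near \<open>v0\<close>.\<close>

lemma C1_locally_injective_on_subspace:
  fixes \<phi> :: "'a::euclidean_space \<Rightarrow> 'b::euclidean_space"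
  assumes V: "open V" "v0 \<in> V" and L: "subspace L" and \<phi>: "C1_on V \<phi> D" and inj: "inj_on (D v0) L"
  shows "\<exists>e>0. inj_on \<phi> (ball v0 e \<inter> L)"
proof -
  have der: "(\<phi> has_derivative D x) (at x)" if "x \<in> V" for x using \<phi> that by (auto simp: C1_on_def)
  have lD: "linear (D x)" if "x \<in> V" for x using der[OF that] by (rule has_derivative_linear)
  obtain A where A: "linear A" "\<And>v. v \<in> L \<Longrightarrow> A (D v0 v) = v"
    using linear_exists_left_inverse_on[OF lD[OF V(2)] L inj] by blast
  have bA: "bounded_linear A" using A(1) by (simp add: linear_conv_bounded_linear)
  have bD0: "bounded_linear (D v0)" using lD[OF V(2)] by (simp add: linear_conv_bounded_linear)
  define \<theta> where "\<theta> v = v + A (\<phi> v) - A (D v0 v)" for v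
  define T where "T x v = v + A (D x v) - A (D v0 v)" for x v
  have dT: "(\<theta> has_derivative T x) (at x)" if "x \<in> V" for x
    unfolding \<theta>_def T_def
    by (intro derivative_intros bounded_linear.has_derivative[OF bA] der[OF that] bounded_linear_imp_has_derivative bD0)
  have "\<exists>d>0. \<forall>x. dist v0 x < d \<longrightarrow> onorm (\<lambda>v. T x v - T v0 v) < e" if "e > 0" for e
  proof -
    \<comment> \<open>\<open>S\<close> bounds the operator norm through the basis vectors; pointwise
      continuity of the derivative, as in \<open>C1_on\<close>, makes it continuous.\<close>
    define S where "S x = (\<Sum>b\<in>Basis. norm (A (D x b) - A (D v0 b)))" for x
    have "continuous_on V S" unfolding S_def using \<phi> unfolding C1_on_def
      by (intro continuous_intros linear_continuous_on_compose[OF _ A(1)]) auto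
    then have "isCont S v0" using V by (simp add: continuous_on_eq_continuous_at)
    then obtain d where d: "d > 0" "\<And>x. dist x v0 < d \<Longrightarrow> dist (S x) (S v0) < e"
      using \<open>e > 0\<close> unfolding continuous_at_eps_delta by blast
    obtain d' where d': "d' > 0" "ball v0 d' \<subseteq> V" using V openE by blast
    have "onorm (\<lambda>v. T x v - T v0 v) < e" if "dist v0 x < min d d'" for x
    proof -
      have x: "x \<in> V" using that d'(2) by auto
      have "bounded_linear (\<lambda>v. A (D x v) - A (D v0 v))"
        using lD[OF x] lD[OF V(2)] A(1) linear_compose[of _ A, unfolded o_def]
        by (intro bounded_linear_sub) (auto simp: linear_conv_bounded_linear[symmetric])
      then have "onorm (\<lambda>v. A (D x v) - A (D v0 v)) \<le> S x"
        unfolding S_def by (rule onorm_componentwise)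
      also have "S x < e" using d(2)[of x] that by (simp add: dist_commute S_def dist_real_def)
      finally show ?thesis by (simp add: T_def)
    qed
    then show ?thesis using d(1) d'(1) by (intro exI[of _ "min d d'"]) auto
  qed
  then obtain r where r: "r > 0" "ball v0 r \<subseteq> V" "inj_on \<theta> (ball v0 r)"
    using has_derivative_locally_injective[OF V(2,1) bounded_linear_ident _ dT] by (auto simp: T_def o_def id_def)
  have "inj_on \<phi> (ball v0 r \<inter> L)"
  proof (rule inj_onI)
    fix x y assume xy: "x \<in> ball v0 r \<inter> L" "y \<in> ball v0 r \<inter> L" "\<phi> x = \<phi> y"
    then have "\<theta> x = \<theta> y" by (simp add: \<theta>_def A(2))
    then show "x = y" using r(3) xy by (auto dest: inj_onD)
  qed
  then show ?thesis using r(1) by blast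
qed

section \<open>Smooth maps and charts of submanifolds\<close>

lemma differentiable_upto_cong:
  assumes "open T" "\<And>t. t \<in> T \<Longrightarrow> f t = g t" "differentiable_upto r T f"
  shows "differentiable_upto r T g"
  using assms(2,3)
proof (induction r arbitrary: f g)
  case 0
  then show ?case by (simp cong: continuous_on_cong)
next
  case (Suc r)
  have d: "f differentiable (at t)" if "t \<in> T" for t using Suc.prems(2) that by simp
  have "g differentiable (at t)" if t: "t \<in> T" for t
  proof -
    obtain D where "(f has_derivative D) (at t)" using d[OF t] unfolding differentiable_def by blast
    then have "(g has_derivative D) (at t)"
      by (rule has_derivative_transform_within_open[OF _ assms(1) t]) (rule Suc.prems(1))
    then show ?thesis unfolding differentiable_def by blast
  qed
  moreover have "differentiable_upto r T (\<lambda>t. frechet_derivative g (at t) v)" for v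
  proof (rule Suc.IH)
    show "differentiable_upto r T (\<lambda>t. frechet_derivative f (at t) v)" using Suc.prems(2) by simp
    show "frechet_derivative f (at t) v = frechet_derivative g (at t) v" if "t \<in> T" for t
      using frechet_derivative_transform_within_open[of f t T g, OF d[OF that] assms(1) that] Suc.prems(1)
      by metis
  qed
  ultimately show ?case by simp
qed

text \<open>Provides the curves that realise tangent vectors: straight lines in a chart, mapped back
  by \<open>h\<close>.\<close>

lemma differentiable_upto_line:
  fixes h :: "'a::real_normed_vector \<Rightarrow> 'b::real_normed_vector"
  assumes "open T" "\<And>t. t \<in> T \<Longrightarrow> v + t *\<^sub>R w \<in> V" "differentiable_upto r V h"
  shows "differentiable_upto r T (\<lambda>t. h (v + t *\<^sub>R w))"
  using assms(3)
proof (induction r arbitrary: h)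
  case 0
  then show ?case
    by (auto intro!: continuous_on_compose2[of V h] continuous_intros assms(2))
next
  case (Suc r)
  have d: "((\<lambda>t. h (v + t *\<^sub>R w)) has_derivative (\<lambda>s. frechet_derivative h (at (v + t *\<^sub>R w)) (s *\<^sub>R w))) (at t)"
    if "t \<in> T" for t
  proof -
    have "(h has_derivative frechet_derivative h (at (v + t *\<^sub>R w))) (at (v + t *\<^sub>R w))"
      using Suc.prems assms(2)[OF that] by (simp add: frechet_derivative_works)
    moreover have "((\<lambda>t. v + t *\<^sub>R w) has_derivative (\<lambda>s. s *\<^sub>R w)) (at t)"
      by (auto intro!: derivative_eq_intros)
    ultimately show ?thesis using diff_chain_at[of "\<lambda>t. v + t *\<^sub>R w" _ t h] by (simp add: o_def)
  qed
  have "differentiable_upto r T (\<lambda>t. frechet_derivative (\<lambda>t. h (v + t *\<^sub>R w)) (at t) s)" for s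
  proof (rule differentiable_upto_cong[OF assms(1)])
    show "differentiable_upto r T (\<lambda>t. frechet_derivative h (at (v + t *\<^sub>R w)) (s *\<^sub>R w))"
      using Suc.IH[of "\<lambda>x. frechet_derivative h (at x) (s *\<^sub>R w)"] Suc.prems by simp
    show "frechet_derivative h (at (v + t *\<^sub>R w)) (s *\<^sub>R w) = frechet_derivative (\<lambda>t. h (v + t *\<^sub>R w)) (at t) s"
      if "t \<in> T" for t using frechet_derivative_at[OF d[OF that]] by metis
  qed
  then show ?case using d by (auto simp: differentiable_def)
qed

lemma smooth_on_C1: "smooth_on V f \<Longrightarrow> C1_on V f (\<lambda>x. frechet_derivative f (at x))"
  unfolding smooth_on_def C1_on_def
  using differentiable_upto.simps(2)[of 0 V f] by (auto simp: frechet_derivative_works)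

lemma smooth_on_has_derivative:
  "smooth_on V f \<Longrightarrow> x \<in> V \<Longrightarrow> (f has_derivative frechet_derivative f (at x)) (at x)"
  using smooth_on_C1 unfolding C1_on_def by blast

locale chart =
  fixes k :: nat and S :: "'a::euclidean_space set" and p :: 'a and U V g h L
  assumes pS: "p \<in> S" "p \<in> U" and smooth: "smooth_on U g" "smooth_on V h"
    and homeo: "homeomorphism U V g h" and L: "subspace (L :: 'a set)" "dim L = k"
    and flat: "g ` (S \<inter> U) = V \<inter> L"
begin

abbreviation "H \<equiv> frechet_derivative h (at (g p))"
abbreviation "G \<equiv> frechet_derivative g (at p)"

lemma opens: "open U" "open V" using smooth by (auto simp: smooth_on_def)

lemma inverses: "x \<in> U \<Longrightarrow> h (g x) = x" "v \<in> V \<Longrightarrow> g (h v) = v" "x \<in> U \<Longrightarrow> g x \<in> V" "v \<in> V \<Longrightarrow> h v \<in> U"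
  using homeo by (auto simp: homeomorphism_def)

lemma conts: "continuous_on U g" "continuous_on V h"
  using homeo by (auto simp: homeomorphism_def)

lemma g_flat: "x \<in> S \<Longrightarrow> x \<in> U \<Longrightarrow> g x \<in> V \<inter> L"
  using flat by blast

lemma h_flat: "v \<in> V \<Longrightarrow> v \<in> L \<Longrightarrow> h v \<in> S"
proof -
  assume v: "v \<in> V" "v \<in> L"
  then have "v \<in> g ` (S \<inter> U)" using flat by blast
  then obtain x where "x \<in> S" "x \<in> U" "v = g x" by blast
  then show "h v \<in> S" using inverses(1) by simp
qed

lemma base: "g p \<in> V \<inter> L" using g_flat pS by blast

lemma derivs: "(g has_derivative G) (at p)" "(h has_derivative H) (at (g p))"
  using smooth_on_has_derivative smooth pS base by auto

lemma GH: "G (H v) = v"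
proof -
  have "(g \<circ> h has_derivative G \<circ> H) (at (g p))"
    by (rule diff_chain_at) (use derivs inverses pS in auto)
  moreover have "(g \<circ> h has_derivative id) (at (g p))"
    by (rule has_derivative_transform_within_open[OF has_derivative_id opens(2)])
      (use base inverses in auto)
  ultimately have "G \<circ> H = id" by (rule has_derivative_unique)
  then show ?thesis by (metis comp_apply id_apply)
qed

lemma HG: "H (G v) = v"
proof -
  have "(h \<circ> g has_derivative H \<circ> G) (at p)"
    by (rule diff_chain_at) (use derivs in auto)
  moreover have "(h \<circ> g has_derivative id) (at p)"
    by (rule has_derivative_transform_within_open[OF has_derivative_id opens(1)])
      (use pS inverses in auto)
  ultimately have "H \<circ> G = id" by (rule has_derivative_unique)
  then show ?thesis by (metis comp_apply id_apply)
qed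

lemma linear_H: "linear H"
  using derivs(2) by (rule has_derivative_linear)

text \<open>In the chart a curve in \<open>S\<close> stays in \<open>L\<close>, and comparison with
  its image under a linear retraction onto \<open>L\<close> shows that the velocity lies in
  \<open>L\<close> too. Conversely, lines in \<open>L\<close> give all directions.\<close>

lemma tangent_space_eq: "tangent_space S p = H ` L"
proof (intro equalityI subsetI)
  fix v assume "v \<in> tangent_space S p"
  then obtain c e where c: "0 < e" "smooth_on {-e<..<e::real} c" "c ` {-e<..<e} \<subseteq> S" "c 0 = p"
    "(c has_vector_derivative v) (at 0)" unfolding tangent_space_def by blast
  obtain pr where pr: "range pr \<subseteq> L" "linear pr" "\<And>v. v \<in> L \<Longrightarrow> pr v = v"
    using linear_exists_left_inverse_on[OF linear_id L(1) inj_on_id] by auto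
  have pr_L: "pr x \<in> L" for x using pr(1) by blast
  have bpr: "bounded_linear pr" using pr(2) by (simp add: linear_conv_bounded_linear)
  have "(g has_derivative G) (at (c 0))" using derivs(1) c(4) by simp
  from diff_chain_at[OF c(5)[unfolded has_vector_derivative_def] this]
  have gc: "(g \<circ> c has_derivative (\<lambda>t. G (t *\<^sub>R v))) (at 0)" by (simp add: o_def)
  have "continuous_on {-e<..<e} c" using C1_on_continuous[OF smooth_on_C1[OF c(2)]] .
  then have "open ({-e<..<e} \<inter> c -` U)" by (rule continuous_open_preimage) (simp_all add: opens(1))
  moreover have "0 \<in> {-e<..<e} \<inter> c -` U" using c pS by auto
  moreover have "pr ((g \<circ> c) t) = (g \<circ> c) t" if "t \<in> {-e<..<e} \<inter> c -` U" for t
  proof -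
    have "c t \<in> S" "c t \<in> U" using that c(3) by auto
    then show ?thesis using pr(3) g_flat[of "c t"] by simp
  qed
  ultimately have "((g \<circ> c) has_derivative (\<lambda>t. pr (G (t *\<^sub>R v)))) (at 0)"
    using has_derivative_transform_within_open[OF bounded_linear.has_derivative[OF bpr gc]] by blast
  from has_derivative_unique[OF gc this] have "G (1 *\<^sub>R v) = pr (G (1 *\<^sub>R v))" by (rule fun_cong)
  then have "G v \<in> L" using pr_L by (metis scaleR_one)
  then show "v \<in> H ` L" using HG by (metis imageI)
next
  fix v assume "v \<in> H ` L"
  then obtain w where w: "w \<in> L" "v = H w" by blast
  have "open ((\<lambda>t::real. g p + t *\<^sub>R w) -` V)"
    by (rule open_vimage[OF opens(2)]) (intro continuous_intros)
  moreover have "0 \<in> (\<lambda>t::real. g p + t *\<^sub>R w) -` V" using base by simp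
  ultimately obtain e where e: "e > 0" "ball 0 e \<subseteq> (\<lambda>t::real. g p + t *\<^sub>R w) -` V"
    using openE by blast
  have b: "{-e<..<e} = ball (0::real) e" by (auto simp: dist_real_def)
  define c where "c t = h (g p + t *\<^sub>R w)" for t
  have inV: "g p + t *\<^sub>R w \<in> V" if "t \<in> {-e<..<e}" for t using e(2) that unfolding b by blast
  have "smooth_on {-e<..<e} c"
    using differentiable_upto_line[of "{-e<..<e}" "g p" w V] inV smooth(2)
    unfolding smooth_on_def c_def by auto
  moreover have "c ` {-e<..<e} \<subseteq> S"
  proof
    fix x assume "x \<in> c ` {-e<..<e}"
    then obtain t where t: "t \<in> {-e<..<e}" "x = c t" by blast
    have "g p + t *\<^sub>R w \<in> L" using base w L(1) by (auto intro: subspace_add subspace_scale)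
    then show "x \<in> S" unfolding t(2) c_def using h_flat[OF inV[OF t(1)]] by blast
  qed
  moreover have "c 0 = p" using inverses pS by (simp add: c_def)
  moreover have "(c has_vector_derivative v) (at 0)"
  proof -
    have "(h has_derivative H) (at (g p + 0 *\<^sub>R w))" using derivs(2) by simp
    moreover have "((\<lambda>t. g p + t *\<^sub>R w) has_derivative (\<lambda>s. s *\<^sub>R w)) (at 0)"
      by (auto intro!: derivative_eq_intros)
    ultimately have "(c has_derivative (\<lambda>s. H (s *\<^sub>R w))) (at 0)"
      using diff_chain_at[of "\<lambda>t. g p + t *\<^sub>R w" _ 0 h] by (simp add: o_def c_def[abs_def])
    then show ?thesis unfolding has_vector_derivative_def w(2) by (simp add: linear_scale[OF linear_H])
  qed
  ultimately show "v \<in> tangent_space S p" using e(1) unfolding tangent_space_def by blast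
qed

end

lemma smooth_point_chart:
  assumes "smooth_point k S p"
  obtains U V g h L where "chart k S p U V g h L"
  using assms unfolding smooth_point_def chart_def by blast

text \<open>In charts \<open>f\<close> maps an open piece of \<open>L\<close> to \<open>L'\<close>,
  with a derivative from \<open>L\<close> onto \<open>L'\<close>. A kernel would make the fiber
  infinite, so the dimensions agree and the derivative is injective on \<open>L\<close> as
  well.\<close>

lemma submersion_finite_fiber:
  fixes f :: "'a::euclidean_space \<Rightarrow> 'b::euclidean_space"
  assumes M: "smooth_submanifold r M" and N: "smooth_submanifold j N" and f: "smooth_submersion f M N"
    and p: "p \<in> M" and fin: "finite {x\<in>M. f x = f p}"
  shows "r = j" and "\<exists>e>0. inj_on f (M \<inter> ball p e)"
    and "open W \<Longrightarrow> p \<in> W \<Longrightarrow> \<exists>e>0. N \<inter> ball (f p) e \<subseteq> f ` (M \<inter> W)"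
proof -
  have q: "f p \<in> N" using f p unfolding smooth_submersion_def by blast
  obtain U V g h L where "chart r M p U V g h L"
    using M p smooth_point_chart unfolding smooth_submanifold_def by blast
  then interpret c: chart r M p U V g h L .
  obtain U' V' g' h' L' where "chart j N (f p) U' V' g' h' L'"
    using N q smooth_point_chart unfolding smooth_submanifold_def by blast
  then interpret d: chart j N "f p" U' V' g' h' L' .
  obtain Uf where Uf: "M \<subseteq> Uf" "smooth_on Uf f" using f unfolding smooth_submersion_def by blast
  have opUf: "open Uf" and contf: "continuous_on Uf f"
    using Uf(2) C1_on_continuous[OF smooth_on_C1] by (auto simp: smooth_on_def)
  let ?F = "frechet_derivative f (at p)"
  have tan: "?F ` tangent_space M p = tangent_space N (f p)"
    using f p unfolding smooth_submersion_def by blast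
  define D where "D = d.G \<circ> ?F \<circ> c.H"
  have DL: "D ` L = L'"
  proof -
    have "D ` L = d.G ` (?F ` (c.H ` L))" by (auto simp: D_def image_image)
    also have "\<dots> = d.G ` (d.H ` L')" using tan unfolding c.tangent_space_eq d.tangent_space_eq by simp
    also have "\<dots> = L'" by (simp add: image_image d.GH)
    finally show ?thesis .
  qed
  define V1 where "V1 = {v\<in>V. h v \<in> Uf}"
  have V1: "open V1" "V1 \<subseteq> V" "g p \<in> V1"
    using continuous_open_preimage[OF c.conts(2) c.opens(2) opUf] c.base c.inverses(1) c.pS p Uf(1)
    by (auto simp: V1_def vimage_def Int_def)
  have fh: "continuous_on V1 (f \<circ> h)"
    by (intro continuous_on_compose continuous_on_subset[OF c.conts(2) V1(2)] continuous_on_subset[OF contf])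
      (auto simp: V1_def)
  define P where "P W = {v\<in>V1. h v \<in> W \<and> f (h v) \<in> U'}" for W
  have P: "open (P W)" "g p \<in> P W" if "open W" "p \<in> W" for W
  proof -
    have "open (V1 \<inter> h -` W)"
      using continuous_open_preimage[OF continuous_on_subset[OF c.conts(2) V1(2)] V1(1) that(1)] .
    moreover have "open (V1 \<inter> (f \<circ> h) -` U')"
      using continuous_open_preimage[OF fh V1(1) d.opens(1)] .
    ultimately have "open ((V1 \<inter> h -` W) \<inter> (V1 \<inter> (f \<circ> h) -` U'))" by (rule open_Int)
    also have "(V1 \<inter> h -` W) \<inter> (V1 \<inter> (f \<circ> h) -` U') = P W" by (auto simp: P_def)
    finally show "open (P W)" .
    show "g p \<in> P W" using V1(3) that(2) c.inverses(1) c.pS d.pS by (simp add: P_def)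
  qed
  define \<phi> where "\<phi> = g' \<circ> (f \<circ> h)"
  have \<phi>c: "continuous_on (P W) \<phi>" for W
    unfolding \<phi>_def
    by (intro continuous_on_compose continuous_on_subset[OF fh] continuous_on_subset[OF d.conts(1)]) (auto simp: P_def)
  have hp: "h (g p) = p" using c.inverses(1) c.pS by simp
  have \<phi>d: "(\<phi> has_derivative D) (at (g p))"
  proof -
    have "(f has_derivative ?F) (at (h (g p)))"
      unfolding hp using smooth_on_has_derivative[OF Uf(2)] Uf(1) p by blast
    from diff_chain_at[OF c.derivs(2) this] have "(f \<circ> h has_derivative ?F \<circ> c.H) (at (g p))" .
    moreover have "(g' has_derivative d.G) (at ((f \<circ> h) (g p)))" using d.derivs(1) hp by simp
    ultimately show ?thesis unfolding \<phi>_def D_def comp_assoc by (rule diff_chain_at)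
  qed
  have \<phi>L: "\<phi> ` (P W \<inter> L) \<subseteq> L'" for W
  proof
    fix y assume "y \<in> \<phi> ` (P W \<inter> L)"
    then obtain v where v: "v \<in> P W" "v \<in> L" "y = g' (f (h v))" by (auto simp: \<phi>_def)
    have "h v \<in> M" using c.h_flat v V1(2) by (auto simp: P_def)
    then have "f (h v) \<in> N" using f by (auto simp: smooth_submersion_def)
    then show "y \<in> L'" using d.g_flat v by (auto simp: P_def)
  qed
  show dims: "r = j"
  proof (rule ccontr)
    assume "r \<noteq> j"
    then have "infinite {v\<in>P UNIV \<inter> L. \<phi> v = \<phi> (g p)}"
      using local_submersion(2)[OF P(1) _ c.L(1) d.L(1) \<phi>c \<phi>d \<phi>L DL, of UNIV] P(2)[of UNIV] c.base c.L(2) d.L(2)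
      by auto
    moreover have "inj_on h {v\<in>P UNIV \<inter> L. \<phi> v = \<phi> (g p)}"
      using c.inverses(2) V1(2) by (intro inj_on_inverseI[of _ g]) (auto simp: P_def)
    ultimately have "infinite (h ` {v\<in>P UNIV \<inter> L. \<phi> v = \<phi> (g p)})" by (simp add: finite_image_iff)
    moreover have "h ` {v\<in>P UNIV \<inter> L. \<phi> v = \<phi> (g p)} \<subseteq> {x\<in>M. f x = f p}"
    proof
      fix x assume "x \<in> h ` {v\<in>P UNIV \<inter> L. \<phi> v = \<phi> (g p)}"
      then obtain v where v: "v \<in> P UNIV" "v \<in> L" "g' (f (h v)) = g' (f p)" "x = h v"
        by (auto simp: \<phi>_def hp)
      have "f (h v) = f p" using d.inverses(1) v d.pS by (metis (mono_tags, lifting) P_def mem_Collect_eq)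
      then show "x \<in> {x\<in>M. f x = f p}" using c.h_flat v V1(2) by (auto simp: P_def)
    qed
    ultimately show False using fin finite_subset by blast
  qed
  show "\<exists>e>0. N \<inter> ball (f p) e \<subseteq> f ` (M \<inter> W)" if W: "open W" "p \<in> W" for W
  proof -
    obtain e where e: "e > 0" "\<And>y. y \<in> L' \<Longrightarrow> dist y (\<phi> (g p)) < e \<Longrightarrow> \<exists>v\<in>P W \<inter> L. \<phi> v = y"
      using local_submersion(1)[OF P(1)[OF W] _ c.L(1) d.L(1) \<phi>c \<phi>d \<phi>L DL] P(2)[OF W] c.base by auto
    have "isCont g' (f p)" using d.conts(1) d.opens(1) d.pS by (simp add: continuous_on_eq_continuous_at)
    then obtain e1 where e1: "e1 > 0" "\<And>y. dist y (f p) < e1 \<Longrightarrow> dist (g' y) (g' (f p)) < e"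
      using e(1) unfolding continuous_at_eps_delta by blast
    obtain e2 where e2: "e2 > 0" "ball (f p) e2 \<subseteq> U'" using d.opens(1) d.pS openE by blast
    have "N \<inter> ball (f p) (min e1 e2) \<subseteq> f ` (M \<inter> W)"
    proof
      fix z assume z: "z \<in> N \<inter> ball (f p) (min e1 e2)"
      then have zU: "z \<in> U'" using e2 by auto
      then have "g' z \<in> L'" using z d.g_flat by blast
      moreover have "dist (g' z) (\<phi> (g p)) < e" using e1(2)[of z] z by (simp add: \<phi>_def hp dist_commute)
      ultimately obtain v where v: "v \<in> P W" "v \<in> L" "g' (f (h v)) = g' z" using e(2) by (auto simp: \<phi>_def)
      have "f (h v) = z" using d.inverses(1) v zU by (metis (mono_tags, lifting) P_def mem_Collect_eq)
      moreover have "h v \<in> M \<inter> W" using c.h_flat v V1(2) by (auto simp: P_def)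
      ultimately show "z \<in> f ` (M \<inter> W)" by blast
    qed
    then show ?thesis using e1 e2 by (intro exI[of _ "min e1 e2"]) auto
  qed
  show "\<exists>e>0. inj_on f (M \<inter> ball p e)"
  proof -
    have C1: "C1_on V1 (f \<circ> h) (\<lambda>x. frechet_derivative f (at (h x)) \<circ> frechet_derivative h (at x))"
      by (rule C1_on_compose[OF C1_on_subset[OF smooth_on_C1[OF c.smooth(2)] V1(2)] smooth_on_C1[OF Uf(2)]])
        (auto simp: V1_def)
    have lD: "linear D" using \<phi>d by (rule has_derivative_linear)
    \<comment> \<open>The right inverse \<open>A\<close> embeds \<open>L'\<close> into
      \<open>L\<close>; equal dimensions make it onto, so it is also a left inverse.\<close>
    have "inj_on D L"
    proof -
      obtain A where A: "range A \<subseteq> L" "linear A" "\<And>y. y \<in> L' \<Longrightarrow> D (A y) = y"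
        using linear_exists_right_inverse_on[OF lD c.L(1)] unfolding DL by auto
      have "inj_on A (span L')" using A(3) d.L(1) by (metis inj_on_inverseI span_eq_iff)
      then have "dim (A ` L') = dim L" using dim_image_eq[OF A(2)] c.L(2) d.L(2) dims by simp
      then have "A ` L' = L"
        using A(1) c.L(1) linear_subspace_image[OF A(2) d.L(1)] by (intro subspace_dim_equal) auto
      then have "A (D v) = v" if "v \<in> L" for v using A(3) that by (metis imageE)
      then show ?thesis by (rule inj_on_inverseI)
    qed
    then have "inj_on (frechet_derivative f (at (h (g p))) \<circ> c.H) L"
      unfolding hp D_def by (auto simp: inj_on_def)
    then obtain e where e: "e > 0" "inj_on (f \<circ> h) (ball (g p) e \<inter> L)"
      using C1_locally_injective_on_subspace[OF V1(1,3) c.L(1) C1] by blast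
    have "isCont g p" using c.conts(1) c.opens(1) c.pS by (simp add: continuous_on_eq_continuous_at)
    then obtain e1 where e1: "e1 > 0" "\<And>y. dist y p < e1 \<Longrightarrow> dist (g y) (g p) < e"
      using e(1) unfolding continuous_at_eps_delta by blast
    obtain e2 where e2: "e2 > 0" "ball p e2 \<subseteq> U" using c.opens(1) c.pS openE by blast
    have "inj_on f (M \<inter> ball p (min e1 e2))"
    proof (rule inj_onI)
      fix x y assume xy: "x \<in> M \<inter> ball p (min e1 e2)" "y \<in> M \<inter> ball p (min e1 e2)" "f x = f y"
      have xU: "x \<in> U" "y \<in> U" using xy e2 by auto
      then have "g x \<in> ball (g p) e \<inter> L" "g y \<in> ball (g p) e \<inter> L"
        using xy e1(2)[of x] e1(2)[of y] c.g_flat by (auto simp: dist_commute)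
      moreover have "(f \<circ> h) (g x) = (f \<circ> h) (g y)" using xy xU c.inverses(1) by simp
      ultimately have "g x = g y" using inj_onD[OF e(2)] by metis
      then show "x = y" using c.inverses(1) xU by metis
    qed
    then show ?thesis using e1 e2 by (intro exI[of _ "min e1 e2"]) auto
  qed
qed

section \<open>Dimension of unions of strata\<close>

text \<open>A linear projection to \<open>L\<close> maps \<open>S\<close> onto a set that contains a
  ball of \<open>L\<close>, so \<open>k\<close> linear forms are algebraically independent on
  \<open>S\<close>. They need not be coordinates, which is where
  \<open>polynomials_dependent\<close> enters.\<close>

lemma smooth_point_adim:
  fixes S :: "(real ^ 'n::finite) set"
  assumes "smooth_point k S p"
  shows "k \<le> adim S"
proof -
  obtain U V g h L where "chart k S p U V g h L" using smooth_point_chart[OF assms] .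
  then interpret chart k S p U V g h L .
  have "inj_on H L" using GH by (rule inj_on_inverseI)
  then obtain A where A: "range A \<subseteq> L" "linear A" "\<And>v. v \<in> L \<Longrightarrow> A (H v) = v"
    using linear_exists_left_inverse_on[OF linear_H L(1)] by auto
  obtain e where e: "e > 0" "\<And>w. w \<in> L \<Longrightarrow> dist w (g p + A (h (g p)) - A (H (g p))) < e \<Longrightarrow>
      \<exists>v\<in>V \<inter> L. v + A (h v) - A (H v) = w"
    using open_image_in_subspace[OF opens(2) _ L(1) conts(2) derivs(2) A(2,1)] base by blast
  have ball: "\<exists>x\<in>S. A x = w" if w: "w \<in> L" "dist w (A p) < e" for w
  proof -
    have "g p + A (h (g p)) - A (H (g p)) = A p" using A(3) base inverses(1) pS by simp
    then obtain v where v: "v \<in> V" "v \<in> L" "v + A (h v) - A (H v) = w" using e(2)[OF w(1)] w(2) by auto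
    then have "A (h v) = w" using A(3) by simp
    then show ?thesis using h_flat v by blast
  qed
  from orthonormal_basis_subspace[OF L(1)] obtain B where B: "B \<subseteq> L" "pairwise orthogonal B"
    "\<And>x. x \<in> B \<Longrightarrow> norm x = 1" "independent B" "card B = dim L" "span B = L"
    by metis
  have finB: "finite B" using B(4) by (rule independent_imp_finite)
  define P where "P b z = (\<Sum>i\<in>UNIV. z i * (A (axis i 1) \<bullet> b))" for b z
  have P: "P b (($) x) = A x \<bullet> b" for b x
  proof -
    have "A x = A (\<Sum>i\<in>UNIV. x $ i *\<^sub>R axis i 1)" using basis_expansion[of x] by (simp add: scalar_mult_eq_scaleR)
    then show ?thesis by (simp add: P_def linear_sum[OF A(2)] linear_scale[OF A(2)] inner_sum_left)
  qed
  have "alg_indep S (\<lambda>b x. P b (($) x)) B"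
    unfolding alg_indep_def
  proof (intro ballI impI allI)
    fix q z assume q: "q \<in> polyfun B" "\<forall>x\<in>S. q (\<lambda>b. P b (($) x)) = 0"
    define u where "u = (\<Sum>b\<in>B. (z b - A p \<bullet> b) *\<^sub>R b)"
    have ub: "u \<bullet> c = z c - A p \<bullet> c" if "c \<in> B" for c
    proof -
      have "b \<bullet> c = (if b = c then 1 else 0)" if "b \<in> B" for b
        using B(2,3) that \<open>c \<in> B\<close> by (auto simp: pairwise_def orthogonal_def norm_eq_1)
      then have "u \<bullet> c = (\<Sum>b\<in>B. if b = c then z b - A p \<bullet> b else 0)"
        unfolding u_def inner_sum_left by (intro sum.cong) auto
      then show ?thesis using finB that by simp
    qed
    have uL: "u \<in> L" unfolding u_def using B(1) L(1) by (auto intro!: subspace_sum subspace_scale)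
    obtain Q where Q: "\<And>t. q (\<lambda>b. A p \<bullet> b + t * (z b - A p \<bullet> b)) = poly Q t"
      using polyfun_line[OF q(1), of "\<lambda>b. A p \<bullet> b" "\<lambda>b. z b - A p \<bullet> b"] by blast
    have zero: "poly Q t = 0" if "t \<in> {0<..<e / (norm u + 1)}" for t
    proof -
      have "t * norm u \<le> t * (norm u + 1)" using that by simp
      also have "\<dots> < e" using that by (simp add: pos_less_divide_eq add_nonneg_pos)
      finally have "dist (A p + t *\<^sub>R u) (A p) < e" using that by (simp add: dist_norm)
      moreover have "A p + t *\<^sub>R u \<in> L" using A(1) uL L(1) by (auto intro: subspace_add subspace_scale)
      ultimately obtain x where x: "x \<in> S" "A x = A p + t *\<^sub>R u" using ball by blast
      have "q (\<lambda>b. A p \<bullet> b + t * (z b - A p \<bullet> b)) = q (\<lambda>b. P b (($) x))"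
        by (rule polyfun_cong[OF q(1)]) (simp add: P x(2) inner_add_left ub)
      then show ?thesis using q(2) x(1) Q by metis
    qed
    have "infinite {0<..<e / (norm u + 1)}"
      using e(1) by (intro infinite_Ioo) (simp add: add_nonneg_pos)
    moreover have "{0<..<e / (norm u + 1)} \<subseteq> {t. poly Q t = 0}" using zero by blast
    ultimately have "infinite {t. poly Q t = 0}" using finite_subset by blast
    then have "Q = 0" using poly_roots_finite by blast
    then have "q (\<lambda>b. A p \<bullet> b + 1 * (z b - A p \<bullet> b)) = 0" unfolding Q by simp
    then show "q z = 0" by simp
  qed
  moreover have "P b \<in> polyfun UNIV" for b
    unfolding P_def[abs_def] by (intro polyfun_intros) auto
  ultimately have "card B \<le> adim S"
    using polynomials_dependent[OF finB, of S P] by force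
  then show ?thesis using B(5) L(2) by simp
qed

lemma differentiable_upto_subset: "differentiable_upto r S f \<Longrightarrow> T \<subseteq> S \<Longrightarrow> differentiable_upto r T f"
  by (induction r arbitrary: f) (auto intro: continuous_on_subset)

lemma smooth_on_subset: "smooth_on S f \<Longrightarrow> T \<subseteq> S \<Longrightarrow> open T \<Longrightarrow> smooth_on T f"
  unfolding smooth_on_def using differentiable_upto_subset by blast

lemma smooth_point_local:
  assumes "smooth_point k S p" "open N" "p \<in> N" "S \<inter> N = T \<inter> N"
  shows "smooth_point k T p"
proof -
  obtain U V g h L where "chart k S p U V g h L" using smooth_point_chart[OF assms(1)] .
  then interpret chart k S p U V g h L .
  define V' where "V' = V \<inter> h -` N"
  have V': "open V'" unfolding V'_def by (rule continuous_open_preimage[OF conts(2) opens(2) assms(2)])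
  have gV': "g ` (U \<inter> N) = V'"
  proof (intro equalityI subsetI)
    fix v assume "v \<in> V'"
    then show "v \<in> g ` (U \<inter> N)" using inverses by (intro image_eqI[of _ _ "h v"]) (auto simp: V'_def)
  qed (use inverses in \<open>auto simp: V'_def\<close>)
  have "homeomorphism (U \<inter> N) V' g h"
    by (rule homeomorphism_of_subsets[OF homeo]) (auto simp: V'_def gV')
  moreover have "g ` (T \<inter> (U \<inter> N)) = V' \<inter> L"
  proof -
    have "T \<inter> (U \<inter> N) = S \<inter> U \<inter> N" using assms(4) by blast
    moreover have "g ` (S \<inter> U \<inter> N) = V' \<inter> L"
    proof (intro equalityI subsetI)
      fix v assume v: "v \<in> V' \<inter> L"
      then have "h v \<in> S \<inter> U \<inter> N" "g (h v) = v" using h_flat inverses by (auto simp: V'_def)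
      then show "v \<in> g ` (S \<inter> U \<inter> N)" by (metis imageI)
    qed (use g_flat inverses in \<open>auto simp: V'_def\<close>)
    ultimately show ?thesis by simp
  qed
  moreover have "smooth_on (U \<inter> N) g" "smooth_on V' h"
    using smooth_on_subset[OF smooth(1)] smooth_on_subset[OF smooth(2)] opens assms(2) V' by (auto simp: V'_def)
  moreover have "p \<in> T" using assms pS by blast
  ultimately show ?thesis unfolding smooth_point_def using pS assms(3) L by blast
qed

section \<open>Zero sets of formal polynomials, flags and strata\<close>

definition mfun :: "('n::finite, 'k::comm_ring_1) mpoly \<Rightarrow> ('n \<Rightarrow> 'k) \<Rightarrow> 'k" where
  "mfun p z = (\<Sum>m\<in>Poly_Mapping.keys p. Poly_Mapping.lookup p m * (\<Prod>i\<in>UNIV. z i ^ Poly_Mapping.lookup m i))"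

lemma mpoly_eval_mfun: "mpoly_eval p x = mfun p (($) x)"
  by (simp add: mpoly_eval_def mfun_def)

lemma mfun_polyfun: "mfun p \<in> polyfun UNIV"
  unfolding mfun_def[abs_def] by (intro polyfun_intros) auto

lemma zariski_closure_algebraic: "algebraic_set Z \<Longrightarrow> A \<subseteq> Z \<Longrightarrow> zariski_closure A \<subseteq> Z"
  unfolding algebraic_set_def zero_set_def zariski_closure_def
  using mfun_polyfun by (fastforce simp: mpoly_eval_mfun)

lemma closed_zero_set:
  fixes P :: "('n::finite, 'k::real_normed_field) mpoly set"
  shows "closed (zero_set P)"
proof -
  have "zero_set P = (\<Inter>p\<in>P. {x. mfun p (($) x) = 0})" by (auto simp: zero_set_def mpoly_eval_mfun)
  moreover have "closed {x :: 'k ^ 'n. mfun p (($) x) = 0}" for p :: "('n, 'k) mpoly"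
    by (intro closed_Collect_eq continuous_polyfun[OF mfun_polyfun] continuous_on_const)
  ultimately show ?thesis by auto
qed

lemma closed_algebraic: "algebraic_set (Z :: ('k::real_normed_field ^ 'n::finite) set) \<Longrightarrow> closed Z"
  unfolding algebraic_set_def using closed_zero_set by blast

lemma flag_mono:
  assumes "\<forall>i<k. F i \<subseteq> F (Suc i)" "i \<le> j" "j \<le> k"
  shows "F i \<subseteq> F j"
  using assms(2,3) by (induction j rule: dec_induct) (use assms(1) in \<open>auto simp: Suc_le_eq\<close>)

lemma flag_diff_unique:
  assumes "\<forall>i<k. F i \<subseteq> F (Suc i)" "i \<le> k" "j \<le> k" "x \<in> flag_diff F i" "x \<in> flag_diff F j"
  shows "i = j"
proof -
  have "\<not> a < b" if "b \<le> k" "x \<in> flag_diff F a" "x \<in> flag_diff F b" for a b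
  proof
    assume "a < b"
    then have "F a \<subseteq> F (b - 1)" using that(1) by (intro flag_mono[OF assms(1)]) auto
    then show False using that \<open>a < b\<close> by (auto simp: flag_diff_def split: if_splits)
  qed
  then show ?thesis using assms by (meson linorder_cases)
qed

lemma flag_diff_exists:
  assumes "x \<in> F k"
  shows "\<exists>i\<le>k. x \<in> flag_diff F i"
proof -
  define i where "i = (LEAST i. x \<in> F i)"
  have "x \<in> F i" "i \<le> k" unfolding i_def using assms by (auto intro: LeastI Least_le)
  moreover have "x \<notin> F (i - 1)" if "i \<noteq> 0"
    using that not_less_Least[of "i - 1" "\<lambda>i. x \<in> F i"] by (simp add: i_def)
  ultimately show ?thesis unfolding flag_diff_def by (intro exI[of _ i]) auto
qed

lemma strata_exists:
  assumes "x \<in> F k"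
  obtains i M where "i \<le> k" "M \<in> components (flag_diff F i)" "x \<in> M" "M \<in> strata F k"
proof -
  obtain i where i: "i \<le> k" "x \<in> flag_diff F i" using flag_diff_exists[of x F k] assms by blast
  then obtain M where "M \<in> components (flag_diff F i)" "x \<in> M" by (metis UnionE Union_components)
  then show ?thesis using that i unfolding strata_def by auto
qed

lemma strata_level:
  assumes "M \<in> strata F k"
  obtains i where "i \<le> k" "M \<in> components (flag_diff F i)"
  using assms unfolding strata_def by auto

lemma strata_unique:
  assumes "\<forall>i<k. F i \<subseteq> F (Suc i)" "M \<in> strata F k" "N \<in> strata F k" "x \<in> M" "x \<in> N"
  shows "M = N"
proof -
  obtain i where i: "i \<le> k" "M \<in> components (flag_diff F i)" using strata_level[OF assms(2)] .
  obtain j where j: "j \<le> k" "N \<in> components (flag_diff F j)" using strata_level[OF assms(3)] .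
  have "x \<in> flag_diff F i" "x \<in> flag_diff F j" using i j assms(4,5) in_components_subset by blast+
  then have "i = j" using flag_diff_unique[OF assms(1) i(1) j(1)] by blast
  then show ?thesis using i j assms(4,5) components_eq by blast
qed

lemma whitney_stratificationD:
  assumes "whitney_stratification X F k"
  shows "\<And>i. i \<le> k \<Longrightarrow> algebraic_set (F i)" "\<forall>i<k. F i \<subseteq> F (Suc i)" "F k = X"
    "\<And>i S. i \<le> k \<Longrightarrow> S \<in> components (flag_diff F i) \<Longrightarrow> smooth_submanifold i S"
  using assms unfolding whitney_stratification_def by blast+

text \<open>Identifies \<open>adim\<close> with a dimension of strata and of smooth points. It is
  applied to flag members, which enter through their being unions of strata.\<close>

lemma strata_dimension:
  fixes A :: "(real ^ 'n::finite) set"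
  assumes strat: "whitney_stratification X XS k" and A: "A \<noteq> {}" "A \<subseteq> X"
    and union: "\<And>M. M \<in> strata XS k \<Longrightarrow> M \<inter> A \<noteq> {} \<Longrightarrow> M \<subseteq> A"
  obtains M p where "M \<in> components (flag_diff XS (adim A))" "adim A \<le> k" "M \<subseteq> A" "p \<in> M" "smooth_point (adim A) A p"
proof -
  note ws = whitney_stratificationD[OF strat]
  define ok where "ok r \<longleftrightarrow> (\<exists>J. alg_indep (A \<inter> XS r) coords J \<and> card J = adim A)" for r
  have "ok k" unfolding ok_def using adim_attained[OF A(1)] A(2) ws(3) by (metis inf.absorb1)
  \<comment> \<open>At the least level that carries the full dimension, \<open>J\<close> is
    dependent on the part below; so its independence survives on the open part
    \<open>A2\<close>.\<close>
  define r where "r = (LEAST r. ok r)"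
  have r: "ok r" "r \<le> k" and below: "\<And>i. i < r \<Longrightarrow> \<not> ok i"
    unfolding r_def using \<open>ok k\<close> by (auto intro: LeastI Least_le dest: not_less_Least)
  obtain J where J: "alg_indep (A \<inter> XS r) coords J" "card J = adim A" using r(1) unfolding ok_def by blast
  define C where "C = (if r = 0 then {} else XS (r - 1))"
  define A2 where "A2 = A \<inter> flag_diff XS r"
  have fd: "flag_diff XS r = XS r - C" by (simp add: flag_diff_def C_def)
  have "\<not> alg_indep (A \<inter> C) coords J"
  proof (cases "r = 0")
    case True
    then show ?thesis by (simp add: C_def not_alg_indep_empty)
  next
    case False
    then show ?thesis using below[of "r - 1"] J(2) unfolding ok_def C_def by auto
  qed
  then have J2: "alg_indep A2 coords J"
    using alg_indep_split[OF J(1), of A2 "A \<inter> C"] unfolding A2_def fd by blast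
  have "\<forall>i. i \<notin> J \<longrightarrow> \<not> alg_indep A2 coords (insert i J)"
  proof (intro allI impI notI)
    fix i assume i: "i \<notin> J" "alg_indep A2 coords (insert i J)"
    have "card (insert i J) \<le> adim A2" by (rule adim_ge[OF i(2)])
    moreover have "card (insert i J) = Suc (adim A)" using i(1) J(2) by simp
    moreover have "adim A2 \<le> adim A" by (rule adim_mono) (auto simp: A2_def)
    ultimately show False by simp
  qed
  from zariski_closure_retract[OF J2 this] obtain p \<delta> \<gamma> where p: "p \<in> A2" "0 < \<delta>"
    "continuous_on (ball p \<delta>) \<gamma>" "\<gamma> p = p"
    "\<forall>w\<in>ball p \<delta>. \<gamma> w \<in> zariski_closure A2 \<and> (\<forall>j\<in>J. \<gamma> w $ j = w $ j)"
    "\<forall>x\<in>zariski_closure A2 \<inter> ball p \<delta>. \<gamma> x = x"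
    by (elim bexE exE conjE) (rule that)
  have pA: "p \<in> A" "p \<in> flag_diff XS r" "p \<notin> C" using p(1) by (auto simp: A2_def fd)
  obtain M where M: "M \<in> components (flag_diff XS r)" "p \<in> M"
    using pA(2) by (metis UnionE Union_components)
  have Ms: "M \<in> strata XS k" using M r(2) unfolding strata_def by auto
  have MA: "M \<subseteq> A" using union[OF Ms] M(2) pA(1) by blast
  have smM: "smooth_point r M p" using ws(4)[OF r(2) M(1)] M(2) unfolding smooth_submanifold_def by blast
  have Zsub: "zariski_closure A2 \<subseteq> XS r"
    using ws(1)[OF r(2)] by (rule zariski_closure_algebraic) (auto simp: A2_def fd)
  have closC: "closed C"
    using closed_algebraic[OF ws(1)[of "r - 1"]] r(2) by (simp add: C_def)
  have "open (ball p \<delta> \<inter> \<gamma> -` (- C))"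
    by (rule continuous_open_preimage[OF p(3) open_ball]) (simp add: closC open_Compl)
  moreover have "p \<in> ball p \<delta> \<inter> \<gamma> -` (- C)" using p(2,4) pA(3) by simp
  ultimately obtain \<delta>' where \<delta>': "\<delta>' > 0" "ball p \<delta>' \<subseteq> ball p \<delta> \<inter> \<gamma> -` (- C)" using openE by blast
  have sub: "ball p \<delta>' \<subseteq> ball p \<delta>" using \<delta>'(2) by blast
  \<comment> \<open>The image of a ball is connected, lies in \<open>XS r\<close> and avoids
    \<open>C\<close>, so it stays in the component through \<open>p\<close>.\<close>
  have "\<gamma> ` ball p \<delta>' \<subseteq> M"
  proof (rule components_maximal[OF M(1)])
    show "connected (\<gamma> ` ball p \<delta>')"
      by (rule connected_continuous_image[OF continuous_on_subset[OF p(3) sub]]) simp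
    show "\<gamma> ` ball p \<delta>' \<subseteq> flag_diff XS r"
      unfolding fd using \<delta>'(2) p(5) Zsub by blast
    have "p \<in> \<gamma> ` ball p \<delta>'" using \<delta>'(1) p(4) by (metis centre_in_ball imageI)
    then show "M \<inter> \<gamma> ` ball p \<delta>' \<noteq> {}" using M(2) by blast
  qed
  then have \<gamma>M: "\<gamma> w \<in> M" if "w \<in> ball p \<delta>'" for w using that by blast
  have "adim A \<le> r"
  proof -
    obtain U V g h L where "chart r M p U V g h L" using smooth_point_chart[OF smM] .
    then interpret chart r M p U V g h L .
    define LJ where "LJ = {l :: real ^ 'n. \<forall>i. i \<notin> J \<longrightarrow> l $ i = 0}"
    have LJ: "subspace LJ" unfolding LJ_def subspace_def by auto
    have dimLJ: "dim LJ = card J"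
      unfolding LJ_def using dim_substandard_cart[where 'a = real, of J] by (simp add: dim_vec_eq)
    define Q where "Q = (\<lambda>l. p + l) -` (ball p \<delta>' \<inter> \<gamma> -` U)"
    have "open (ball p \<delta>' \<inter> \<gamma> -` U)"
      by (rule continuous_open_preimage[OF continuous_on_subset[OF p(3) sub] open_ball opens(1)])
    then have Q: "open Q" unfolding Q_def by (intro open_vimage continuous_intros)
    have Qb: "p + l \<in> ball p \<delta>'" "\<gamma> (p + l) \<in> U" if "l \<in> Q" for l using that by (auto simp: Q_def)
    \<comment> \<open>The retraction keeps the coordinates in \<open>J\<close>, so it is injective
      on translates of the coordinate plane \<open>LJ\<close> and embeds an open piece of it into
      the chart of \<open>M\<close>.\<close>
    have "dim LJ \<le> dim L"
    proof (rule invariance_of_dimension_subspaces)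
      show "openin (top_of_set LJ) (LJ \<inter> Q)" using Q by (rule openin_open_Int)
      show "continuous_on (LJ \<inter> Q) (\<lambda>l. g (\<gamma> (p + l)))"
      proof (rule continuous_on_compose2[OF conts(1)])
        show "continuous_on (LJ \<inter> Q) (\<lambda>l. \<gamma> (p + l))"
          by (rule continuous_on_compose2[OF continuous_on_subset[OF p(3) sub]]) (auto intro!: continuous_intros dest: Qb)
      qed (use Qb in auto)
      show "(\<lambda>l. g (\<gamma> (p + l))) \<in> LJ \<inter> Q \<rightarrow> L" using g_flat \<gamma>M Qb by blast
      show "inj_on (\<lambda>l. g (\<gamma> (p + l))) (LJ \<inter> Q)"
      proof (rule inj_onI)
        fix l m assume lm: "l \<in> LJ \<inter> Q" "m \<in> LJ \<inter> Q" "g (\<gamma> (p + l)) = g (\<gamma> (p + m))"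
        then have eq: "\<gamma> (p + l) = \<gamma> (p + m)" using inverses(1) Qb by (metis IntD2)
        have "l $ j = m $ j" if "j \<in> J" for j
        proof -
          have "p + l \<in> ball p \<delta>" "p + m \<in> ball p \<delta>" using lm Qb sub by blast+
          then have "\<gamma> (p + l) $ j = (p + l) $ j" "\<gamma> (p + m) $ j = (p + m) $ j" using p(5) that by blast+
          then show ?thesis using eq by simp
        qed
        moreover have "l $ j = m $ j" if "j \<notin> J" for j using lm that by (simp add: LJ_def)
        ultimately show "l = m" by (metis vec_eq_iff)
      qed
      have "0 \<in> LJ \<inter> Q" using p(4) pS \<delta>'(1) by (simp add: LJ_def Q_def)
      then show "LJ \<inter> Q \<noteq> {}" by blast
    qed (use LJ L in auto)
    then show ?thesis using dimLJ J(2) L(2) by simp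
  qed
  moreover have "r \<le> adim A" using smooth_point_adim[OF smM] adim_mono[OF MA] by simp
  ultimately have ra: "adim A = r" by simp
  have "smooth_point r A p"
  proof (rule smooth_point_local[OF smM])
    show "open (ball p \<delta>' \<inter> - C)" using closC by (intro open_Int) auto
    show "p \<in> ball p \<delta>' \<inter> - C" using \<delta>'(1) pA(3) by simp
    \<comment> \<open>A stratum inside \<open>A\<close> has dimension at most
      \<open>adim A = r\<close>. So points of \<open>A\<close> near \<open>p\<close> belong to
      \<open>A2\<close>, are fixed by \<open>\<gamma>\<close> and therefore lie in
      \<open>M\<close>.\<close>
    have "x \<in> M" if x: "x \<in> A" "x \<in> ball p \<delta>'" "x \<notin> C" for x
    proof -
      have "x \<in> XS k" using x(1) A(2) ws(3) by blast
      then obtain i N where N: "i \<le> k" "N \<in> components (flag_diff XS i)" "x \<in> N" "N \<in> strata XS k"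
        by (rule strata_exists)
      have "N \<subseteq> A" using union[OF N(4)] N(3) x(1) by blast
      moreover have "smooth_point i N x" using ws(4)[OF N(1,2)] N(3) unfolding smooth_submanifold_def by blast
      ultimately have "i \<le> r" using smooth_point_adim[of i N x] adim_mono[of N A] ra by simp
      then have "XS i \<subseteq> XS r" using flag_mono[OF ws(2)] r(2) by blast
      moreover have "x \<in> XS i" using N(2,3) in_components_subset by (fastforce simp: flag_diff_def)
      ultimately have "x \<in> A2" using x by (auto simp: A2_def fd)
      then have "\<gamma> x = x" using p(6) zariski_closure_superset[of A2] sub x(2) by blast
      then show ?thesis using \<gamma>M[OF x(2)] by simp
    qed
    then show "M \<inter> (ball p \<delta>' \<inter> - C) = A \<inter> (ball p \<delta>' \<inter> - C)" using MA by blast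
  qed
  then show ?thesis using that[of M p] M MA ra r(2) by simp
qed

section \<open>Complex algebraic sets\<close>

text \<open>For \<open>J = UNIV\<close> there are no relations to satisfy, and the boxes contain all
  exponent vectors bounded by \<open>s\<close>.\<close>

lemma polyfun_monomials:
  fixes q :: "('n::finite \<Rightarrow> 'k::field_char_0) \<Rightarrow> 'k"
  assumes "q \<in> polyfun UNIV"
  shows "\<exists>s l. \<forall>z. q z = (\<Sum>\<beta>\<in>PiE UNIV (\<lambda>_. {..s}). l \<beta> * (\<Prod>i\<in>UNIV. z i ^ \<beta> i))"
proof -
  interpret algebraic_over UNIV "\<lambda>i z. z i" UNIV "\<lambda>_. 1" "\<lambda>_ _ _. 0"
    by unfold_locales (auto intro: polyfun.const)
  obtain D where "bd (\<lambda>x. q (\<lambda>j. x j)) D" using bd_polyfun[OF assms] by blast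
  then have "(\<lambda>x. q (\<lambda>j. x j) * 1) \<in> V (0 + D)" using one_V[of 0] unfolding bd_def by (elim allE[of _ 0] ballE) auto
  then have "q \<in> V D" by simp
  then show ?thesis unfolding V_def Box_def mon_def by auto
qed

text \<open>The polynomial ring has countable dimension: infinitely many of the \<open>h c\<close>
  share one box of exponents, and more of them than there are monomials in the box are
  dependent.\<close>

lemma dependent_of_uncountable:
  fixes h :: "'c \<Rightarrow> ('n::finite \<Rightarrow> 'k::field_char_0) \<Rightarrow> 'k"
  assumes C: "uncountable C" and h: "\<And>c. c \<in> C \<Longrightarrow> h c \<in> polyfun UNIV"
  obtains S l where "S \<subseteq> C" "finite S" "\<exists>c\<in>S. l c \<noteq> 0" "\<And>z. (\<Sum>c\<in>S. l c * h c z) = 0"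
proof -
  define B where "B s = PiE (UNIV :: 'n set) (\<lambda>_. {..s})" for s :: nat
  have finB: "finite (B s)" for s unfolding B_def by (intro finite_PiE) auto
  define R where "R c s l \<longleftrightarrow> (\<forall>z. h c z = (\<Sum>\<beta>\<in>B s. l \<beta> * (\<Prod>i\<in>UNIV. z i ^ \<beta> i)))" for c s l
  have "\<exists>s l. R c s l" if "c \<in> C" for c
    using polyfun_monomials[OF h[OF that]] unfolding R_def B_def .
  then obtain s M where R: "\<And>c. c \<in> C \<Longrightarrow> R c (s c) (M c)" by metis
  have "\<exists>n. infinite {c\<in>C. s c = n}"
  proof (rule ccontr)
    assume "\<not> ?thesis"
    then have "countable (\<Union>n. {c\<in>C. s c = n})" by (auto intro: countable_finite)
    moreover have "(\<Union>n. {c\<in>C. s c = n}) = C" by auto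
    ultimately show False using C by simp
  qed
  then obtain n where "infinite {c\<in>C. s c = n}" by blast
  from infinite_arbitrarily_large[OF this] obtain S where S: "finite S" "card S = Suc (card (B n))" "S \<subseteq> {c\<in>C. s c = n}"
    by blast
  obtain l where l: "\<exists>c\<in>S. l c \<noteq> 0" "\<forall>\<beta>\<in>B n. (\<Sum>c\<in>S. l c * M c \<beta>) = 0"
    using underdetermined_system[OF finB S(1), of n M] S(2) by auto
  have "(\<Sum>c\<in>S. l c * h c z) = 0" for z
  proof -
    have "(\<Sum>c\<in>S. l c * h c z) = (\<Sum>c\<in>S. \<Sum>\<beta>\<in>B n. l c * M c \<beta> * (\<Prod>i\<in>UNIV. z i ^ \<beta> i))"
    proof (rule sum.cong[OF refl])
      fix c assume "c \<in> S"
      then have "R c n (M c)" using R[of c] S(3) by auto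
      then show "l c * h c z = (\<Sum>\<beta>\<in>B n. l c * M c \<beta> * (\<Prod>i\<in>UNIV. z i ^ \<beta> i))"
        by (simp add: R_def sum_distrib_left mult.assoc)
    qed
    also have "\<dots> = (\<Sum>\<beta>\<in>B n. (\<Sum>c\<in>S. l c * M c \<beta>) * (\<Prod>i\<in>UNIV. z i ^ \<beta> i))"
      by (subst sum.swap) (simp add: sum_distrib_right)
    also have "\<dots> = 0" using l(2) by simp
    finally show ?thesis .
  qed
  then show ?thesis using that[of S l] S(1,3) l(1) by auto
qed

lemma uncountable_complex_reals: "a < b \<Longrightarrow> uncountable (complex_of_real ` {a<..<b})"
  using countable_image_inj_on[of complex_of_real "{a<..<b}"] uncountable_open_interval[of a b]
  by (auto simp: inj_on_def)

section \<open>Ideals of polynomial functions and the Nullstellensatz\<close>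

definition poly_ideal :: "(('n \<Rightarrow> 'k::comm_ring_1) \<Rightarrow> 'k) set \<Rightarrow> bool" where
  "poly_ideal I \<longleftrightarrow> I \<subseteq> polyfun UNIV \<and> (\<lambda>_. 0) \<in> I \<and> (\<forall>p\<in>I. \<forall>q\<in>I. (\<lambda>z. p z + q z) \<in> I) \<and>
    (\<forall>p\<in>I. \<forall>q\<in>polyfun UNIV. (\<lambda>z. q z * p z) \<in> I)"

lemma poly_idealD:
  assumes "poly_ideal I"
  shows "p \<in> I \<Longrightarrow> p \<in> polyfun UNIV" "(\<lambda>_. 0) \<in> I" "p \<in> I \<Longrightarrow> q \<in> I \<Longrightarrow> (\<lambda>z. p z + q z) \<in> I"
    "p \<in> I \<Longrightarrow> q \<in> polyfun UNIV \<Longrightarrow> (\<lambda>z. q z * p z) \<in> I"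
  using assms unfolding poly_ideal_def by blast+

lemma poly_ideal_sum:
  assumes "poly_ideal I" "\<And>a. a \<in> A \<Longrightarrow> p a \<in> I"
  shows "(\<lambda>z. \<Sum>a\<in>A. p a z) \<in> I"
  using assms(2) by (induction A rule: infinite_finite_induct) (auto intro: poly_idealD[OF assms(1)])

definition adjoin :: "(('n \<Rightarrow> 'k::comm_ring_1) \<Rightarrow> 'k) set \<Rightarrow> (('n \<Rightarrow> 'k) \<Rightarrow> 'k) \<Rightarrow> (('n \<Rightarrow> 'k) \<Rightarrow> 'k) set" where
  "adjoin I a = {\<lambda>z. p z + r z * a z |p r. p \<in> I \<and> r \<in> polyfun UNIV}"

lemma adjoinI: "p \<in> I \<Longrightarrow> r \<in> polyfun UNIV \<Longrightarrow> (\<lambda>z. p z + r z * a z) \<in> adjoin I a"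
  unfolding adjoin_def by (intro CollectI exI[of _ p] exI[of _ r]) simp

lemma adjoinE:
  assumes "m \<in> adjoin I a"
  obtains p r where "p \<in> I" "r \<in> polyfun UNIV" "\<And>z. m z = p z + r z * a z"
  using assms unfolding adjoin_def by auto

lemma adjoin_ideal:
  assumes I: "poly_ideal I" and a: "a \<in> polyfun UNIV"
  shows "poly_ideal (adjoin I a)" "I \<subseteq> adjoin I a" "a \<in> adjoin I a"
proof -
  show sub: "I \<subseteq> adjoin I a"
  proof
    fix p assume "p \<in> I"
    from adjoinI[OF this polyfun.const[of 0], of a] have "(\<lambda>z. p z + 0 * a z) \<in> adjoin I a" .
    then show "p \<in> adjoin I a" by simp
  qed
  from adjoinI[OF poly_idealD(2)[OF I] polyfun.const[of 1], of a]
  have "(\<lambda>z. 0 + 1 * a z) \<in> adjoin I a" .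
  then show "a \<in> adjoin I a" by simp
  show "poly_ideal (adjoin I a)"
    unfolding poly_ideal_def
  proof (intro conjI ballI subsetI)
    fix m assume "m \<in> adjoin I a"
    then obtain p r where m: "p \<in> I" "r \<in> polyfun UNIV" "m = (\<lambda>z. p z + r z * a z)"
      unfolding adjoin_def by blast
    show "m \<in> polyfun UNIV" unfolding m(3) by (intro polyfun_intros m(2) a poly_idealD(1)[OF I m(1)])
    fix q :: "('a \<Rightarrow> 'b) \<Rightarrow> 'b" assume q: "q \<in> polyfun UNIV"
    from adjoinI[OF poly_idealD(4)[OF I m(1) q] polyfun.mult[OF q m(2)], of a]
    have "(\<lambda>z. q z * p z + (q z * r z) * a z) \<in> adjoin I a" .
    then show "(\<lambda>z. q z * m z) \<in> adjoin I a" by (simp add: m(3) algebra_simps)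
  next
    show "(\<lambda>_. 0) \<in> adjoin I a" using sub poly_idealD(2)[OF I] by blast
    fix m n assume "m \<in> adjoin I a" "n \<in> adjoin I a"
    then obtain p r q s where m: "p \<in> I" "r \<in> polyfun UNIV" "m = (\<lambda>z. p z + r z * a z)"
      "q \<in> I" "s \<in> polyfun UNIV" "n = (\<lambda>z. q z + s z * a z)"
      unfolding adjoin_def by blast
    from adjoinI[OF poly_idealD(3)[OF I m(1,4)] polyfun.add[OF m(2,5)], of a]
    have "(\<lambda>z. (p z + q z) + (r z + s z) * a z) \<in> adjoin I a" .
    then show "(\<lambda>z. m z + n z) \<in> adjoin I a" by (simp add: m(3,6) algebra_simps)
  qed
qed

definition prime_poly_ideal :: "(('n \<Rightarrow> 'k::comm_ring_1) \<Rightarrow> 'k) set \<Rightarrow> bool" where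
  "prime_poly_ideal I \<longleftrightarrow> poly_ideal I \<and> (\<lambda>_. 1) \<notin> I \<and>
    (\<forall>a\<in>polyfun UNIV. \<forall>b\<in>polyfun UNIV. (\<lambda>z. a z * b z) \<in> I \<longrightarrow> a \<in> I \<or> b \<in> I)"

lemma prime_poly_idealD:
  assumes "prime_poly_ideal I"
  shows "poly_ideal I" "(\<lambda>_. 1) \<notin> I"
    "a \<in> polyfun UNIV \<Longrightarrow> b \<in> polyfun UNIV \<Longrightarrow> (\<lambda>z. a z * b z) \<in> I \<Longrightarrow> a \<in> I \<or> b \<in> I"
  using assms unfolding prime_poly_ideal_def by blast+

text \<open>An ideal maximal among those disjoint from a multiplicative set is prime: if
  \<open>a\<close> and \<open>b\<close> lie outside but their product inside, members of
  \<open>M\<close> in the two enlarged ideals multiply to a member of \<open>M\<close> in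
  \<open>P\<close>. The maximal ideal comes from Zorn's lemma.\<close>

lemma maximal_avoiding_ideal:
  fixes I :: "(('n \<Rightarrow> 'k::comm_ring_1) \<Rightarrow> 'k) set"
  assumes I: "poly_ideal I" "I \<inter> M = {}" and M: "M \<subseteq> polyfun UNIV" "M \<noteq> {}"
    "\<forall>a\<in>M. \<forall>b\<in>M. (\<lambda>z. a z * b z) \<in> M"
  obtains P where "prime_poly_ideal P" "I \<subseteq> P" "P \<inter> M = {}"
    "\<And>a. a \<in> polyfun UNIV \<Longrightarrow> a \<notin> P \<Longrightarrow> adjoin P a \<inter> M \<noteq> {}"
proof -
  define \<A> where "\<A> = {K. poly_ideal K \<and> I \<subseteq> K \<and> K \<inter> M = {}}"
  have "\<exists>P\<in>\<A>. \<forall>K\<in>\<A>. P \<subseteq> K \<longrightarrow> K = P"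
  proof (rule subset_Zorn_nonempty)
    show "\<A> \<noteq> {}" using I by (auto simp: \<A>_def)
    fix \<C> assume C: "\<C> \<noteq> {}" "subset.chain \<A> \<C>"
    have CA: "poly_ideal K" "I \<subseteq> K" "K \<inter> M = {}" if "K \<in> \<C>" for K
    proof -
      have "K \<in> \<A>" using C(2) that by (auto simp: subset.chain_def)
      then show "poly_ideal K" "I \<subseteq> K" "K \<inter> M = {}" by (auto simp: \<A>_def)
    qed
    obtain K0 where K0: "K0 \<in> \<C>" using C(1) by blast
    have "poly_ideal (\<Union>\<C>)"
      unfolding poly_ideal_def
    proof (intro conjI ballI)
      show "\<Union>\<C> \<subseteq> polyfun UNIV" using poly_idealD(1)[OF CA(1)] by blast
      show "(\<lambda>_. 0) \<in> \<Union>\<C>" using poly_idealD(2)[OF CA(1)[OF K0]] K0 by blast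
    next
      fix p q assume "p \<in> \<Union>\<C>" "q \<in> \<Union>\<C>"
      then obtain K L where KL: "K \<in> \<C>" "L \<in> \<C>" "p \<in> K" "q \<in> L" by blast
      then have "K \<subseteq> L \<or> L \<subseteq> K" using C(2) by (auto simp: subset.chain_def)
      then obtain N where N: "N \<in> \<C>" "p \<in> N" "q \<in> N" using KL by blast
      show "(\<lambda>z. p z + q z) \<in> \<Union>\<C>" using poly_idealD(3)[OF CA(1)[OF N(1)] N(2,3)] N(1) by blast
    next
      fix p q :: "('n \<Rightarrow> 'k) \<Rightarrow> 'k" assume "p \<in> \<Union>\<C>" and q: "q \<in> polyfun UNIV"
      then obtain K where K: "K \<in> \<C>" "p \<in> K" by blast
      show "(\<lambda>z. q z * p z) \<in> \<Union>\<C>" using poly_idealD(4)[OF CA(1)[OF K(1)] K(2) q] K(1) by blast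
    qed
    moreover have "I \<subseteq> \<Union>\<C>" using CA(2)[OF K0] K0 by blast
    moreover have "\<Union>\<C> \<inter> M = {}" using CA(3) by blast
    ultimately show "\<Union>\<C> \<in> \<A>" by (simp add: \<A>_def)
  qed
  then obtain P where P: "P \<in> \<A>" "\<And>K. K \<in> \<A> \<Longrightarrow> P \<subseteq> K \<Longrightarrow> K = P" by blast
  have PI: "poly_ideal P" "I \<subseteq> P" "P \<inter> M = {}" using P(1) by (auto simp: \<A>_def)
  have ad: "adjoin P a \<inter> M \<noteq> {}" if a: "a \<in> polyfun UNIV" "a \<notin> P" for a
  proof
    assume "adjoin P a \<inter> M = {}"
    then have "adjoin P a \<in> \<A>" using adjoin_ideal[OF PI(1) a(1)] PI(2) by (auto simp: \<A>_def)
    then show False using P(2)[of "adjoin P a"] adjoin_ideal[OF PI(1) a(1)] a(2) by blast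
  qed
  have "prime_poly_ideal P"
    unfolding prime_poly_ideal_def
  proof (intro conjI ballI impI)
    show "(\<lambda>_. 1) \<notin> P"
    proof
      assume one: "(\<lambda>_. 1) \<in> P"
      obtain m where "m \<in> M" using M(2) by blast
      then have "(\<lambda>z. m z * 1) \<in> P" using poly_idealD(4)[OF PI(1) one] M(1) by blast
      then show False using \<open>m \<in> M\<close> PI(3) by auto
    qed
    fix a b :: "('n \<Rightarrow> 'k) \<Rightarrow> 'k"
    assume ab: "a \<in> polyfun UNIV" "b \<in> polyfun UNIV" "(\<lambda>z. a z * b z) \<in> P"
    show "a \<in> P \<or> b \<in> P"
    proof (rule ccontr)
      assume n: "\<not> (a \<in> P \<or> b \<in> P)"
      obtain m where "m \<in> adjoin P a" "m \<in> M" using ad[OF ab(1)] n by blast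
      then obtain p r where m: "m \<in> M" "p \<in> P" "r \<in> polyfun UNIV" "\<And>z. m z = p z + r z * a z"
        by (auto elim: adjoinE)
      obtain m' where "m' \<in> adjoin P b" "m' \<in> M" using ad[OF ab(2)] n by blast
      then obtain p' r' where m': "m' \<in> M" "p' \<in> P" "r' \<in> polyfun UNIV" "\<And>z. m' z = p' z + r' z * b z"
        by (auto elim: adjoinE)
      have "(\<lambda>z. (m' z * p z + (r z * a z) * p' z) + (r z * r' z) * (a z * b z)) \<in> P"
      proof (rule poly_idealD(3)[OF PI(1) poly_idealD(3)[OF PI(1)]])
        show "(\<lambda>z. m' z * p z) \<in> P" using m'(1) M(1) by (intro poly_idealD(4)[OF PI(1) m(2)]) auto
        show "(\<lambda>z. (r z * a z) * p' z) \<in> P"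
          by (rule poly_idealD(4)[OF PI(1) m'(2) polyfun.mult[OF m(3) ab(1)]])
        show "(\<lambda>z. (r z * r' z) * (a z * b z)) \<in> P"
          by (rule poly_idealD(4)[OF PI(1) ab(3) polyfun.mult[OF m(3) m'(3)]])
      qed
      moreover have "(\<lambda>z. (m' z * p z + (r z * a z) * p' z) + (r z * r' z) * (a z * b z)) = (\<lambda>z. m z * m' z)"
        by (rule ext) (simp add: m(4) m'(4) algebra_simps)
      ultimately show False using M(3) m(1) m'(1) PI(3) by (metis disjoint_iff)
    qed
  qed (rule PI(1))
  then show ?thesis using that PI ad by blast
qed

text \<open>If all \<open>g - c\<close> are invertible modulo the ideal, up to factors \<open>m c\<close>, then the inverses are
  linearly dependent because polynomials have countable dimension. Clearing denominators in such a
  dependence yields the relation.\<close>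

lemma uncountable_relation:
  fixes P :: "(('n::finite \<Rightarrow> 'k::field_char_0) \<Rightarrow> 'k) set"
  assumes P: "poly_ideal P" and g: "g \<in> polyfun UNIV" and C: "uncountable C"
    and m: "\<And>c. c \<in> C \<Longrightarrow> m c \<in> adjoin P (\<lambda>z. g z - c)"
  obtains S l where "S \<subseteq> C" "finite S" "\<exists>c\<in>S. l c \<noteq> 0"
    "(\<lambda>z. \<Sum>c\<in>S. l c * m c z * (\<Prod>a\<in>S - {c}. g z - a)) \<in> P"
proof -
  have "\<exists>p h. p \<in> P \<and> h \<in> polyfun UNIV \<and> (\<forall>z. m c z = p z + h z * (g z - c))" if "c \<in> C" for c
    using m[OF that] by (elim adjoinE) blast
  then obtain p h where ph: "\<And>c. c \<in> C \<Longrightarrow> p c \<in> P \<and> h c \<in> polyfun UNIV \<and> (\<forall>z. m c z = p c z + h c z * (g z - c))"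
    by metis
  obtain S l where S: "S \<subseteq> C" "finite S" "\<exists>c\<in>S. l c \<noteq> 0" "\<And>z. (\<Sum>c\<in>S. l c * h c z) = 0"
    using dependent_of_uncountable[OF C, of h] ph by blast
  define q where "q c z = l c * (\<Prod>a\<in>S - {c}. g z - a)" for c z
  have "q c \<in> polyfun UNIV" for c unfolding q_def[abs_def] by (intro polyfun_intros g)
  then have "(\<lambda>z. \<Sum>c\<in>S. q c z * p c z) \<in> P"
    using ph S(1) by (intro poly_ideal_sum[OF P] poly_idealD(4)[OF P]) auto
  moreover have "(\<Sum>c\<in>S. l c * m c z * (\<Prod>a\<in>S - {c}. g z - a)) = (\<Sum>c\<in>S. q c z * p c z)" for z
  proof -
    have "l c * m c z * (\<Prod>a\<in>S - {c}. g z - a) = q c z * p c z + (l c * h c z) * (\<Prod>a\<in>S. g z - a)"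
      if "c \<in> S" for c
    proof -
      have m_eq: "m c z = p c z + h c z * (g z - c)" using ph S(1) that by blast
      have prod_eq: "(\<Prod>a\<in>S. g z - a) = (g z - c) * (\<Prod>a\<in>S - {c}. g z - a)"
        using S(2) that by (rule prod.remove)
      show ?thesis unfolding q_def m_eq prod_eq by (simp only: distrib_left distrib_right mult_ac)
    qed
    then have "(\<Sum>c\<in>S. l c * m c z * (\<Prod>a\<in>S - {c}. g z - a))
      = (\<Sum>c\<in>S. q c z * p c z) + (\<Sum>c\<in>S. l c * h c z) * (\<Prod>a\<in>S. g z - a)"
      by (simp add: sum.distrib sum_distrib_right)
    then show ?thesis using S(4) by simp
  qed
  ultimately show ?thesis using that[of S l] S by simp
qed

text \<open>Up to scalars the products are the Lagrange basis for the nodes \<open>S\<close>; at a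
  node \<open>c\<close> only the term of \<open>c\<close> survives.\<close>

lemma lagrange_nonzero:
  fixes l :: "'k::field_char_0 \<Rightarrow> 'k"
  assumes "finite S" "\<exists>c\<in>S. l c \<noteq> 0"
  obtains Q where "Q \<noteq> 0" "\<And>t. poly Q t = (\<Sum>c\<in>S. l c * (\<Prod>a\<in>S - {c}. t - a))"
proof -
  define Q where "Q = (\<Sum>c\<in>S. smult (l c) (\<Prod>a\<in>S - {c}. [:- a, 1:]))"
  have Q: "poly Q t = (\<Sum>c\<in>S. l c * (\<Prod>a\<in>S - {c}. t - a))" for t
    by (simp add: Q_def poly_sum poly_prod)
  obtain c where c: "c \<in> S" "l c \<noteq> 0" using assms(2) by blast
  have "poly Q c = l c * (\<Prod>a\<in>S - {c}. c - a)"
    unfolding Q using assms(1) c(1) by (subst sum.remove[of _ c]) (auto intro!: sum.neutral)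
  then have "poly Q c \<noteq> 0" using assms(1) c by auto
  then have "Q \<noteq> 0" using poly_0 by metis
  then show ?thesis using Q by (rule that)
qed

text \<open>Over the complex numbers \<open>Q\<close> splits into linear factors, and a prime ideal
  contains one of them. So an element algebraic modulo \<open>P\<close> is congruent to a
  constant.\<close>

lemma prime_ideal_linear_factor:
  fixes P :: "(('n::finite \<Rightarrow> complex) \<Rightarrow> complex) set"
  assumes P: "prime_poly_ideal P" and g: "g \<in> polyfun UNIV"
  shows "Q \<noteq> 0 \<Longrightarrow> (\<lambda>z. poly Q (g z)) \<in> P \<Longrightarrow> \<exists>c. (\<lambda>z. g z - c) \<in> P"
proof (induction "degree Q" arbitrary: Q)
  case 0
  then obtain a where a: "Q = [:a:]" using degree_eq_zeroE[of Q] by (metis 0(1))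
  then have "(\<lambda>z. inverse a * poly Q (g z)) \<in> P"
    using 0 by (intro poly_idealD(4)[OF prime_poly_idealD(1)[OF P]] polyfun.const)
  then have "(\<lambda>_. 1) \<in> P" using 0 a by simp
  then show ?case using prime_poly_idealD(2)[OF P] by blast
next
  case (Suc n)
  have "\<not> constant (poly Q)" using Suc(2) constant_degree by (metis Zero_not_Suc)
  then obtain a where "poly Q a = 0" using fundamental_theorem_of_algebra by blast
  then obtain Q' where Q: "Q = [:- a, 1:] * Q'" by (metis dvdE poly_eq_0_iff_dvd)
  have pq: "(\<lambda>z. poly R (g z)) \<in> polyfun UNIV" for R :: "complex poly"
    unfolding poly_altdef by (intro polyfun_intros g)
  have "(\<lambda>z. (g z - a) * poly Q' (g z)) \<in> P" using Suc(4) unfolding Q by (simp add: algebra_simps)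
  then have "(\<lambda>z. g z - a) \<in> P \<or> (\<lambda>z. poly Q' (g z)) \<in> P"
    by (rule prime_poly_idealD(3)[OF P polyfun_diff[OF g polyfun.const] pq])
  moreover have nz: "Q' \<noteq> 0" using Suc(3) Q by auto
  moreover have "degree Q = 1 + degree Q'"
    unfolding Q using nz by (subst degree_mult_eq) auto
  then have "n = degree Q'" using Suc(2) by simp
  ultimately show ?case using Suc(1)[of Q'] by blast
qed

text \<open>The argument for uncountable fields. Modulo an ideal maximal among those avoiding the
  powers of \<open>p\<close>, every coordinate is congruent to a constant, for otherwise
  \<open>uncountable_relation\<close> makes it algebraic. The constants are the coordinates of the
  point.\<close>

lemma nullstellensatz:
  fixes I :: "(('n::finite \<Rightarrow> complex) \<Rightarrow> complex) set"
  assumes I: "poly_ideal I" and p: "p \<in> polyfun UNIV" "\<And>k. (\<lambda>z. p z ^ k) \<notin> I"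
  obtains z where "p z \<noteq> 0" "\<And>q. q \<in> I \<Longrightarrow> q z = 0"
proof -
  define M where "M = range (\<lambda>k z. p z ^ k)"
  have M: "I \<inter> M = {}" "M \<subseteq> polyfun UNIV" "M \<noteq> {}"
    using p(2) polyfun_power[OF p(1)] unfolding M_def by blast+
  have Mmult: "(\<lambda>z. a z * b z) \<in> M" if ab: "a \<in> M" "b \<in> M" for a b
  proof -
    obtain k l where "a = (\<lambda>z. p z ^ k)" "b = (\<lambda>z. p z ^ l)" using ab unfolding M_def by blast
    then have "(\<lambda>z. a z * b z) = (\<lambda>z. p z ^ (k + l))" by (simp add: power_add)
    then show ?thesis unfolding M_def by (rule range_eqI)
  qed
  obtain P where P: "prime_poly_ideal P" "I \<subseteq> P" "P \<inter> M = {}"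
    "\<And>a. a \<in> polyfun UNIV \<Longrightarrow> a \<notin> P \<Longrightarrow> adjoin P a \<inter> M \<noteq> {}"
    using maximal_avoiding_ideal[OF I M] Mmult by blast
  have PI: "poly_ideal P" using P(1) by (rule prime_poly_idealD)
  have vi: "(\<lambda>z. z i) \<in> polyfun UNIV" for i :: 'n by (rule polyfun.var) simp
  have ppow: "(\<lambda>z. p z ^ k) \<in> M" for k by (auto simp: M_def)
  have "\<exists>c. (\<lambda>z. z i - c) \<in> P" for i
  proof (rule ccontr)
    assume n: "\<not> ?thesis"
    have "\<exists>k. (\<lambda>z. p z ^ k) \<in> adjoin P (\<lambda>z. z i - c)" for c
    proof -
      have "(\<lambda>z. z i - c) \<in> polyfun UNIV" by (intro polyfun_intros) simp
      from P(4)[OF this] n show ?thesis by (auto simp: M_def)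
    qed
    then obtain k where k: "\<And>c. (\<lambda>z. p z ^ k c) \<in> adjoin P (\<lambda>z. z i - c)" by metis
    define C where "C = complex_of_real ` {0<..<1}"
    \<comment> \<open>A common exponent for uncountably many \<open>c\<close>, so that
      \<open>p ^ n\<close> factors out of the relation and can be cancelled modulo the prime
      \<open>P\<close>.\<close>
    have "\<exists>n. uncountable {c\<in>C. k c = n}"
    proof (rule ccontr)
      assume "\<not> ?thesis"
      then have "countable (\<Union>n. {c\<in>C. k c = n})" by (intro countable_UN) auto
      moreover have "(\<Union>n. {c\<in>C. k c = n}) = C" by auto
      ultimately show False using uncountable_complex_reals[of 0 1] by (simp add: C_def)
    qed
    then obtain n where n': "uncountable {c\<in>C. k c = n}" by blast
    have "(\<lambda>z. p z ^ n) \<in> adjoin P (\<lambda>z. z i - c)" if "c \<in> {c\<in>C. k c = n}" for c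
      using k[of c] that by simp
    from uncountable_relation[OF PI vi n' this] obtain S l where S: "finite S" "\<exists>c\<in>S. l c \<noteq> 0"
      "(\<lambda>z. \<Sum>c\<in>S. l c * p z ^ n * (\<Prod>a\<in>S - {c}. z i - a)) \<in> P" .
    obtain Q where Q: "Q \<noteq> 0" "\<And>t. poly Q t = (\<Sum>c\<in>S. l c * (\<Prod>a\<in>S - {c}. t - a))"
      using lagrange_nonzero[OF S(1,2)] by blast
    have "(\<lambda>z. p z ^ n * poly Q (z i)) \<in> P"
      using S(3) unfolding Q(2) sum_distrib_left by (simp add: algebra_simps)
    moreover have "(\<lambda>z. poly Q (z i)) \<in> polyfun UNIV"
      unfolding poly_altdef by (intro polyfun_intros) simp
    ultimately have "(\<lambda>z. poly Q (z i)) \<in> P"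
      using prime_poly_idealD(3)[OF P(1) polyfun_power[OF p(1)]] ppow P(3) by blast
    from prime_ideal_linear_factor[OF P(1) vi Q(1) this] n show False by blast
  qed
  then obtain w where w: "\<And>i. (\<lambda>z. z i - w i) \<in> P" by metis
  \<comment> \<open>Congruence to constants passes from the coordinates to all polynomials. A member
    of \<open>P\<close> with nonzero value at \<open>w\<close> would then put a nonzero constant
    into \<open>P\<close>.\<close>
  have diff: "(\<lambda>z. q z - q w) \<in> P" if "q \<in> polyfun UNIV" for q
    using that
  proof induction
    case (const c)
    show ?case using poly_idealD(2)[OF PI] by simp
  next
    case (var i)
    show ?case by (rule w)
  next
    case (add a b)
    from poly_idealD(3)[OF PI add.IH] show ?case by (simp add: algebra_simps)
  next
    case (mult a b)
    have "(\<lambda>z. b z * (a z - a w) + a w * (b z - b w)) \<in> P"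
      by (rule poly_idealD(3)[OF PI poly_idealD(4)[OF PI mult.IH(1) mult.hyps(2)]
            poly_idealD(4)[OF PI mult.IH(2) polyfun.const]])
    then show ?case by (simp add: algebra_simps)
  qed
  have zero: "q w = 0" if "q \<in> P" for q
  proof (rule ccontr)
    assume nz: "q w \<noteq> 0"
    have q: "q \<in> polyfun UNIV" using poly_idealD(1)[OF PI that] .
    have "(\<lambda>z. (- inverse (q w)) * ((q z - q w) + (- 1) * q z)) \<in> P"
      by (rule poly_idealD(4)[OF PI poly_idealD(3)[OF PI diff[OF q]
            poly_idealD(4)[OF PI that polyfun.const]] polyfun.const])
    then have "(\<lambda>_. 1) \<in> P" using nz by simp
    then show False using prime_poly_idealD(2)[OF P(1)] by blast
  qed
  have "p w \<noteq> 0"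
  proof
    assume "p w = 0"
    then have "p \<in> P" using diff[OF p(1)] by simp
    then show False using ppow[of 1] P(3) by auto
  qed
  then show ?thesis using that[of w] zero P(2) by blast
qed

lemma poly_ideal_vanishing: "poly_ideal {q\<in>polyfun UNIV. \<forall>x\<in>S. q (($) x) = 0}"
  unfolding poly_ideal_def by (auto intro: polyfun.intros)

text \<open>A coordinate on a bounded set omits an interval of real values \<open>c\<close> beyond
  the bound. By the Nullstellensatz \<open>z i - c\<close> is invertible modulo the ideal for these
  uncountably many \<open>c\<close>, and the resulting relation is a univariate polynomial with the
  values of the coordinate among its roots.\<close>

lemma bounded_algebraic_finite:
  fixes S :: "(complex ^ 'n::finite) set"
  assumes alg: "algebraic_set S" and bdd: "bounded S"
  shows "finite S"
proof -
  define I where "I = {q\<in>polyfun UNIV. \<forall>x\<in>S. q (($) x) = 0}"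
  have I: "poly_ideal I" unfolding I_def by (rule poly_ideal_vanishing)
  have Z: "x \<in> S" if "\<And>q. q \<in> I \<Longrightarrow> q (($) x) = 0" for x
    using zariski_closure_algebraic[OF alg order_refl] that unfolding zariski_closure_def I_def by blast
  obtain B where B: "\<And>x. x \<in> S \<Longrightarrow> norm x \<le> B" using bdd unfolding bounded_iff by blast
  have "\<exists>Q. Q \<noteq> 0 \<and> (\<forall>x\<in>S. poly Q (x $ i) = 0)" for i
  proof -
    have vi: "(\<lambda>z. z i) \<in> polyfun UNIV" by (rule polyfun.var) simp
    define C where "C = complex_of_real ` {\<bar>B\<bar><..<\<bar>B\<bar> + 1}"
    have one: "(\<lambda>_. 1) \<in> adjoin I (\<lambda>z. z i - c)" if "c \<in> C" for c
    proof (rule ccontr)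
      assume n: "\<not> ?thesis"
      have vc: "(\<lambda>z. z i - c) \<in> polyfun UNIV" by (intro polyfun_intros) simp
      obtain z where z: "\<And>q. q \<in> adjoin I (\<lambda>z. z i - c) \<Longrightarrow> q z = 0"
        by (rule nullstellensatz[OF adjoin_ideal(1)[OF I vc] polyfun.const[of 1]]) (use n in auto)
      have e: "($) (\<chi> i. z i) = z" by (rule ext) simp
      have "(\<chi> i. z i) \<in> S"
        by (rule Z, unfold e, rule z, rule subsetD[OF adjoin_ideal(2)[OF I vc]])
      then have "norm (\<chi> i. z i) \<le> B" by (rule B)
      then have "norm (z i) \<le> B"
        using order_trans[OF Finite_Cartesian_Product.norm_nth_le[of "\<chi> i. z i" i]] by simp
      moreover have "z i = c" using z[OF adjoin_ideal(3)[OF I vc]] by simp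
      ultimately show False using that by (auto simp: C_def)
    qed
    have unc: "uncountable C" unfolding C_def by (rule uncountable_complex_reals) simp
    from uncountable_relation[OF I vi unc one] obtain T l where T: "finite T" "\<exists>c\<in>T. l c \<noteq> 0"
      "(\<lambda>z. \<Sum>c\<in>T. l c * 1 * (\<Prod>a\<in>T - {c}. z i - a)) \<in> I" .
    obtain Q where Q: "Q \<noteq> 0" "\<And>t. poly Q t = (\<Sum>c\<in>T. l c * (\<Prod>a\<in>T - {c}. t - a))"
      using lagrange_nonzero[OF T(1,2)] by blast
    have "poly Q (x $ i) = 0" if "x \<in> S" for x using T(3) that unfolding Q(2) I_def by simp
    then show ?thesis using Q(1) by blast
  qed
  then obtain Q where Q: "\<And>i. Q i \<noteq> 0" "\<And>i x. x \<in> S \<Longrightarrow> poly (Q i) (x $ i) = 0" by metis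
  have "finite (PiE UNIV (\<lambda>i. {t. poly (Q i) t = 0}))"
    by (intro finite_PiE finite poly_roots_finite Q(1))
  moreover have "S \<subseteq> vec_lambda ` PiE UNIV (\<lambda>i. {t. poly (Q i) t = 0})"
  proof
    fix x assume "x \<in> S"
    then show "x \<in> vec_lambda ` PiE UNIV (\<lambda>i. {t. poly (Q i) t = 0})"
      using Q(2) by (intro image_eqI[of _ _ "($) x"]) auto
  qed
  ultimately show ?thesis using finite_subset by blast
qed

section \<open>From polynomial functions to formal polynomials; zero sets of primes\<close>

lemma mfun_add: "mfun (p + q) z = mfun p z + mfun q z"
proof -
  define K where "K = Poly_Mapping.keys p \<union> Poly_Mapping.keys q"
  have ext: "mfun r z = (\<Sum>m\<in>K. Poly_Mapping.lookup r m * (\<Prod>i\<in>UNIV. z i ^ Poly_Mapping.lookup m i))"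
    if "Poly_Mapping.keys r \<subseteq> K" for r
    unfolding mfun_def using that
    by (intro sum.mono_neutral_left) (auto simp: K_def in_keys_iff)
  have "Poly_Mapping.keys (p + q) \<subseteq> K" unfolding K_def by (rule keys_add)
  then show ?thesis
    using ext[of "p + q"] ext[of p] ext[of q]
    by (simp add: K_def lookup_add sum.distrib algebra_simps)
qed

lemma polyfun_mpoly:
  fixes q :: "('n::finite \<Rightarrow> 'k::field_char_0) \<Rightarrow> 'k"
  assumes "q \<in> polyfun UNIV"
  shows "\<exists>p. mfun p = q"
proof -
  obtain s l where l: "\<And>z. q z = (\<Sum>\<beta>\<in>PiE UNIV (\<lambda>_. {..s}). l \<beta> * (\<Prod>i\<in>UNIV. z i ^ \<beta> i))"
    using polyfun_monomials[OF assms] by blast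
  have "\<exists>p. \<forall>z. mfun p z = (\<Sum>\<beta>\<in>A. l \<beta> * (\<Prod>i\<in>UNIV. z i ^ \<beta> i))" if "finite A" for A
    using that
  proof (induction A rule: finite_induct)
    case empty
    show ?case by (intro exI[of _ 0]) (simp add: mfun_def)
  next
    case (insert \<beta> A)
    then obtain p where p: "\<And>z. mfun p z = (\<Sum>\<beta>\<in>A. l \<beta> * (\<Prod>i\<in>UNIV. z i ^ \<beta> i))" by blast
    define m where "m = Poly_Mapping.Abs_poly_mapping \<beta>"
    have "Poly_Mapping.lookup m = \<beta>" unfolding m_def by (rule lookup_Abs_poly_mapping) simp
    then have "mfun (Poly_Mapping.single m (l \<beta>)) z = l \<beta> * (\<Prod>i\<in>UNIV. z i ^ \<beta> i)" for z
      by (simp add: mfun_def)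
    then show ?case using insert.hyps
      by (intro exI[of _ "Poly_Mapping.single m (l \<beta>) + p"]) (simp add: mfun_add p)
  qed
  moreover have "finite (PiE (UNIV :: 'n set) (\<lambda>_. {..s}))" by (intro finite_PiE) auto
  ultimately obtain p where "\<forall>z. mfun p z = (\<Sum>\<beta>\<in>PiE UNIV (\<lambda>_. {..s}). l \<beta> * (\<Prod>i\<in>UNIV. z i ^ \<beta> i))"
    by blast
  then have "mfun p = q" using l by (intro ext) simp
  then show ?thesis by blast
qed

definition zeros :: "(('n::finite \<Rightarrow> 'k::comm_ring_1) \<Rightarrow> 'k) set \<Rightarrow> ('k ^ 'n) set" where
  "zeros P = {x. \<forall>q\<in>P. q (($) x) = 0}"

lemma zerosD: "x \<in> zeros P \<Longrightarrow> q \<in> P \<Longrightarrow> q (($) x) = 0"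
  by (simp add: zeros_def)

lemma algebraic_zeros:
  fixes P :: "(('n::finite \<Rightarrow> 'k::field_char_0) \<Rightarrow> 'k) set"
  assumes "P \<subseteq> polyfun UNIV"
  shows "algebraic_set (zeros P)"
proof -
  have "x \<in> zeros P \<longleftrightarrow> x \<in> zero_set {p. mfun p \<in> P}" for x
  proof
    assume x: "x \<in> zero_set {p. mfun p \<in> P}"
    have "q (($) x) = 0" if q: "q \<in> P" for q
    proof -
      obtain p where "mfun p = q" using polyfun_mpoly assms q by blast
      then show ?thesis using x q by (auto simp: zero_set_def mpoly_eval_mfun)
    qed
    then show "x \<in> zeros P" by (simp add: zeros_def)
  qed (simp add: zeros_def zero_set_def mpoly_eval_mfun)
  then have "zeros P = zero_set {p. mfun p \<in> P}" by blast
  then show ?thesis unfolding algebraic_set_def by blast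
qed

lemma prime_ideal_power:
  assumes P: "prime_poly_ideal P" and a: "a \<in> polyfun UNIV" "(\<lambda>z. a z ^ k) \<in> P"
  shows "a \<in> P"
  using a(2)
proof (induction k)
  case 0
  then show ?case using prime_poly_idealD(2)[OF P] by simp
next
  case (Suc k)
  then show ?case using prime_poly_idealD(3)[OF P a(1) polyfun_power[OF a(1)]] by auto
qed

lemma prime_ideal_zero:
  fixes P :: "(('n::finite \<Rightarrow> complex) \<Rightarrow> complex) set"
  assumes "prime_poly_ideal P" "a \<in> polyfun UNIV" "a \<notin> P"
  obtains x where "x \<in> zeros P" "a (($) x) \<noteq> 0"
proof -
  obtain z where z: "a z \<noteq> 0" "\<And>q. q \<in> P \<Longrightarrow> q z = 0"
    using nullstellensatz[OF prime_poly_idealD(1)[OF assms(1)] assms(2)] prime_ideal_power[OF assms(1,2)] assms(3)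
    by metis
  have e: "($) (\<chi> i. z i) = z" by (rule ext) simp
  show ?thesis by (rule that[of "\<chi> i. z i"]) (use z in \<open>auto simp: zeros_def e\<close>)
qed

text \<open>Polynomials that vanish on \<open>A\<close> and on \<open>B\<close> but not at
  \<open>x\<close> and \<open>y\<close> have a product vanishing on the zero set. By the
  Nullstellensatz the product lies in \<open>P\<close>, and primeness gives the
  contradiction.\<close>

lemma irreducible_zeros:
  fixes P :: "(('n::finite \<Rightarrow> complex) \<Rightarrow> complex) set"
  assumes P: "prime_poly_ideal P"
  shows "irreducible_algebraic (zeros P)"
  unfolding irreducible_algebraic_def
proof (intro conjI allI impI)
  have PI: "poly_ideal P" using P by (rule prime_poly_idealD)
  show "algebraic_set (zeros P)" using PI by (intro algebraic_zeros) (auto simp: poly_ideal_def)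
  show "zeros P \<noteq> {}" using prime_ideal_zero[OF P polyfun.const prime_poly_idealD(2)[OF P]] by blast
  fix A B :: "(complex ^ 'n) set"
  assume AB: "algebraic_set A \<and> algebraic_set B \<and> zeros P \<subseteq> A \<union> B"
  show "zeros P \<subseteq> A \<or> zeros P \<subseteq> B"
  proof (rule ccontr)
    assume "\<not> ?thesis"
    then obtain x y where xy: "x \<in> zeros P" "x \<notin> A" "y \<in> zeros P" "y \<notin> B" by blast
    have "\<exists>a\<in>polyfun UNIV. a (($) x) \<noteq> 0 \<and> (\<forall>v\<in>S. a (($) v) = 0)" if "algebraic_set S" "x \<notin> S" for S and x :: "complex ^ 'n"
      using zariski_closure_algebraic[OF that(1) order_refl] that(2) unfolding zariski_closure_def by blast
    then obtain a b where a: "a \<in> polyfun UNIV" "a (($) x) \<noteq> 0" "\<forall>v\<in>A. a (($) v) = 0"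
      and b: "b \<in> polyfun UNIV" "b (($) y) \<noteq> 0" "\<forall>v\<in>B. b (($) v) = 0" using AB xy by metis
    have ab: "(\<lambda>z. a z * b z) \<in> polyfun UNIV" using a(1) b(1) by (rule polyfun.mult)
    have "(\<lambda>z. a z * b z) \<in> P"
    proof (rule ccontr)
      assume "\<not> ?thesis"
      from prime_ideal_zero[OF P ab this] obtain v where v: "v \<in> zeros P" "a (($) v) * b (($) v) \<noteq> 0" .
      have "v \<in> A \<or> v \<in> B" using AB v(1) by blast
      then show False using v(2) a(3) b(3) by auto
    qed
    then have "a \<in> P \<or> b \<in> P" using prime_poly_idealD(3)[OF P a(1) b(1)] by blast
    then show False using xy a(2) b(2) by (auto simp: zeros_def)
  qed
qed

text \<open>Nonzero refers to \<open>q\<close>, not to the composed function: an ideal disjoint from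
  this set is one modulo which the \<open>g b\<close> are algebraically independent.\<close>

definition nonzero_polys :: "('b \<Rightarrow> ('n \<Rightarrow> 'k::comm_ring_1) \<Rightarrow> 'k) \<Rightarrow> 'b set \<Rightarrow> (('n \<Rightarrow> 'k) \<Rightarrow> 'k) set" where
  "nonzero_polys g B = {\<lambda>z. q (\<lambda>b. g b z) |q. q \<in> polyfun B \<and> (\<exists>w. q w \<noteq> 0)}"

lemma nonzero_polysI: "q \<in> polyfun B \<Longrightarrow> q w \<noteq> 0 \<Longrightarrow> (\<lambda>z. q (\<lambda>b. g b z)) \<in> nonzero_polys g B"
  unfolding nonzero_polys_def by blast

lemma nonzero_polysE:
  assumes "m \<in> nonzero_polys g B"
  obtains q w where "q \<in> polyfun B" "q w \<noteq> 0" "m = (\<lambda>z. q (\<lambda>b. g b z))"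
  using assms unfolding nonzero_polys_def by blast

lemma nonzero_polys_multiplicative:
  fixes g :: "'b \<Rightarrow> ('n \<Rightarrow> 'k::field_char_0) \<Rightarrow> 'k"
  shows "\<forall>b\<in>B. g b \<in> polyfun UNIV \<Longrightarrow> nonzero_polys g B \<subseteq> polyfun UNIV"
    and "nonzero_polys g B \<noteq> {}"
    and "\<forall>a\<in>nonzero_polys g B. \<forall>d\<in>nonzero_polys g B. (\<lambda>z. a z * d z) \<in> nonzero_polys g B"
proof -
  show "nonzero_polys g B \<subseteq> polyfun UNIV" if "\<forall>b\<in>B. g b \<in> polyfun UNIV"
    using polyfun_compose[of _ B g UNIV] that by (auto elim!: nonzero_polysE)
  have "(\<lambda>z. (\<lambda>_. 1) (\<lambda>b. g b z)) \<in> nonzero_polys g B"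
    by (rule nonzero_polysI[OF polyfun.const]) simp
  then show "nonzero_polys g B \<noteq> {}" by blast
  show "\<forall>a\<in>nonzero_polys g B. \<forall>d\<in>nonzero_polys g B. (\<lambda>z. a z * d z) \<in> nonzero_polys g B"
  proof (intro ballI)
    fix a d assume ad: "a \<in> nonzero_polys g B" "d \<in> nonzero_polys g B"
    obtain q v where q: "q \<in> polyfun B" "q v \<noteq> 0" "a = (\<lambda>z. q (\<lambda>b. g b z))" using ad(1) by (rule nonzero_polysE)
    obtain r w where r: "r \<in> polyfun B" "r w \<noteq> 0" "d = (\<lambda>z. r (\<lambda>b. g b z))" using ad(2) by (rule nonzero_polysE)
    obtain x where "q x \<noteq> 0" "r x \<noteq> 0" using polyfun_nonzero_both[where p = q and q = r, OF q(1) r(1) q(2) r(2)] by blast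
    then have "(\<lambda>w. q w * r w) x \<noteq> 0" by simp
    from nonzero_polysI[where q = "\<lambda>w. q w * r w" and g = g, OF polyfun.mult[OF q(1) r(1)] this]
    show "(\<lambda>z. a z * d z) \<in> nonzero_polys g B" by (simp add: q(3) r(3))
  qed
qed

text \<open>Every independent function allows one proper step down: fixing \<open>g b\<close> at a
  suitable value \<open>c\<close> keeps the other functions independent, and a prime over the
  enlarged ideal has a strictly smaller zero set.\<close>

lemma prime_chain:
  fixes P :: "(('n::finite \<Rightarrow> complex) \<Rightarrow> complex) set"
  assumes "finite B" "\<forall>b\<in>B. g b \<in> polyfun UNIV" "prime_poly_ideal P" "P \<inter> nonzero_polys g B = {}"
  shows "\<exists>Z. (\<forall>i\<le>card B. irreducible_algebraic (Z i)) \<and> (\<forall>i<card B. Z i \<subset> Z (Suc i)) \<and> Z (card B) = zeros P"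
  using assms
proof (induction B arbitrary: P rule: finite_induct)
  case empty
  show ?case using irreducible_zeros[OF empty(2)] by (intro exI[of _ "\<lambda>_. zeros P"]) simp
next
  case (insert b B)
  have gb: "g b \<in> polyfun UNIV" and gB: "\<forall>b\<in>B. g b \<in> polyfun UNIV" using insert.prems(1) by auto
  have PI: "poly_ideal P" using insert.prems(2) by (rule prime_poly_idealD)
  define M where "M = nonzero_polys g B"
  have gc: "(\<lambda>z. g b z - c) \<in> polyfun UNIV" for c by (intro polyfun_intros gb)
  have "\<exists>c. adjoin P (\<lambda>z. g b z - c) \<inter> M = {}"
  proof (rule ccontr)
    assume "\<not> ?thesis"
    then have "\<exists>q. q \<in> polyfun B \<and> (\<exists>w. q w \<noteq> 0) \<and> (\<lambda>z. q (\<lambda>b. g b z)) \<in> adjoin P (\<lambda>z. g b z - c)" for c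
      unfolding M_def nonzero_polys_def by blast
    then obtain q where q: "\<And>c. q c \<in> polyfun B" "\<And>c. \<exists>w. q c w \<noteq> 0"
      "\<And>c. (\<lambda>z. q c (\<lambda>b. g b z)) \<in> adjoin P (\<lambda>z. g b z - c)" by metis
    have unc: "uncountable (complex_of_real ` {0<..<1})" by (rule uncountable_complex_reals) simp
    obtain S l where S: "finite S" "\<exists>c\<in>S. l c \<noteq> 0"
      "(\<lambda>z. \<Sum>c\<in>S. l c * q c (\<lambda>b. g b z) * (\<Prod>a\<in>S - {c}. g b z - a)) \<in> P"
      by (rule uncountable_relation[OF PI gb unc q(3)]) blast
    \<comment> \<open>If no value \<open>c\<close> were suitable, the relations \<open>q c\<close>
      would combine to a relation \<open>Q\<close> of the whole family modulo
      \<open>P\<close>.\<close>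
    define Q where "Q w = (\<Sum>c\<in>S. l c * q c w * (\<Prod>a\<in>S - {c}. w b - a))" for w
    have "Q \<in> polyfun (insert b B)" unfolding Q_def[abs_def]
      by (intro polyfun_intros polyfun_mono[OF q(1)]) auto
    moreover obtain c0 where c0: "c0 \<in> S" "l c0 \<noteq> 0" using S(2) by blast
    obtain w0 where w0: "q c0 w0 \<noteq> 0" using q(2) by blast
    \<comment> \<open>At \<open>w b = c0\<close> every other summand contains the factor
      \<open>w b - c0\<close>, so the value of \<open>Q\<close> there is a nonzero multiple of
      \<open>q c0 w0\<close>.\<close>
    define w where "w = w0(b := c0)"
    have "q c0 w = q c0 w0" by (rule polyfun_cong[OF q(1)]) (use insert.hyps(2) in \<open>auto simp: w_def\<close>)
    moreover have "Q w = l c0 * q c0 w * (\<Prod>a\<in>S - {c0}. w b - a)"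
      unfolding Q_def using S(1) c0(1) by (subst sum.remove[of _ c0]) (auto intro!: sum.neutral simp: w_def)
    moreover have "(\<Prod>a\<in>S - {c0}. w b - a) \<noteq> 0" using S(1) by (simp add: w_def)
    ultimately have "Q \<in> polyfun (insert b B)" "Q w \<noteq> 0" using c0(2) w0 by auto
    from nonzero_polysI[where q = Q and g = g, OF this] show False
      using S(3) insert.prems(3) by (auto simp: Q_def)
  qed
  then obtain c where c: "adjoin P (\<lambda>z. g b z - c) \<inter> M = {}" by blast
  note nz = nonzero_polys_multiplicative[where B = B and g = g, folded M_def]
  from maximal_avoiding_ideal[OF adjoin_ideal(1)[OF PI gc] c nz(1)[OF gB] nz(2,3)]
  obtain P' where P': "prime_poly_ideal P'" "adjoin P (\<lambda>z. g b z - c) \<subseteq> P'" "P' \<inter> M = {}" .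
  from insert.IH[OF gB P'(1) P'(3)[unfolded M_def]] obtain Z where Z: "\<forall>i\<le>card B. irreducible_algebraic (Z i)"
    "\<forall>i<card B. Z i \<subset> Z (Suc i)" "Z (card B) = zeros P'" by blast
  have sub: "zeros P' \<subseteq> zeros P" using P'(2) adjoin_ideal(2)[OF PI gc] unfolding zeros_def by blast
  have "(\<lambda>w. w b - c) \<in> polyfun (insert b B)"
    by (rule polyfun_diff[OF polyfun.var[OF insertI1] polyfun.const])
  then have "(\<lambda>z. g b z - c) \<in> nonzero_polys g (insert b B)"
    unfolding nonzero_polys_def
    by (intro CollectI exI[of _ "\<lambda>w. w b - c"] conjI exI[of _ "\<lambda>_. c + 1"]) simp_all
  then have "(\<lambda>z. g b z - c) \<notin> P" using insert.prems(3) by blast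
  from prime_ideal_zero[OF insert.prems(2) gc this] obtain x where x: "x \<in> zeros P" "g b (($) x) - c \<noteq> 0" .
  have "(\<lambda>z. g b z - c) \<in> P'" using P'(2) adjoin_ideal(3)[OF PI gc] by (rule subsetD)
  from zerosD[OF _ this, of x] have "x \<notin> zeros P'" using x(2) by metis
  then have psub: "zeros P' \<subset> zeros P" using sub x(1) by blast
  define Z' where "Z' i = (if i \<le> card B then Z i else zeros P)" for i
  have cardB: "card (insert b B) = Suc (card B)" using insert.hyps by simp
  have "irreducible_algebraic (Z' i)" for i
    using Z(1) irreducible_zeros[OF insert.prems(2)] by (simp add: Z'_def)
  moreover have "Z' i \<subset> Z' (Suc i)" if "i < Suc (card B)" for i
  proof (cases "i < card B")
    case True
    then show ?thesis using Z(2) by (simp add: Z'_def)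
  next
    case False
    then have "i = card B" using that by simp
    then show ?thesis using Z(3) psub by (simp add: Z'_def)
  qed
  ultimately show ?case unfolding cardB by (intro exI[of _ Z']) (simp add: Z'_def)
qed

text \<open>The vanishing ideal of \<open>S\<close> is disjoint from \<open>nonzero_polys\<close>,
  so it extends to a prime that still is; the chain of this prime lies inside
  \<open>S\<close>.\<close>

lemma complex_dim_ge:
  fixes S :: "(complex ^ 'n::finite) set"
  assumes alg: "algebraic_set S" and B: "finite B" "\<forall>b\<in>B. g b \<in> polyfun UNIV"
    and ind: "alg_indep S (\<lambda>b x. g b (($) x)) B"
  shows "ereal (real (card B)) \<le> complex_dim S"
proof -
  define I where "I = {q\<in>polyfun UNIV. \<forall>x\<in>S. q (($) x) = 0}"
  have I: "poly_ideal I" unfolding I_def by (rule poly_ideal_vanishing)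
  have Z: "x \<in> S" if "\<And>q. q \<in> I \<Longrightarrow> q (($) x) = 0" for x
    using zariski_closure_algebraic[OF alg order_refl] that unfolding zariski_closure_def I_def by blast
  define M where "M = nonzero_polys g B"
  note nz = nonzero_polys_multiplicative[where B = B and g = g, folded M_def]
  have "I \<inter> M = {}"
  proof (rule ccontr)
    assume "I \<inter> M \<noteq> {}"
    then obtain q w where q: "q \<in> polyfun B" "q w \<noteq> 0" "(\<lambda>z. q (\<lambda>b. g b z)) \<in> I"
      unfolding M_def by (auto elim!: nonzero_polysE)
    show False by (rule alg_indep_point[where q = q, OF ind q(1,2)]) (use q(3) in \<open>simp add: I_def\<close>)
  qed
  from maximal_avoiding_ideal[OF I this nz(1)[OF B(2)] nz(2,3)] obtain P where P: "prime_poly_ideal P" "I \<subseteq> P" "P \<inter> M = {}" .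
  from prime_chain[OF B P(1) P(3)[unfolded M_def]] obtain Z where Z: "\<forall>i\<le>card B. irreducible_algebraic (Z i)"
    "\<forall>i<card B. Z i \<subset> Z (Suc i)" "Z (card B) = zeros P" by blast
  have top: "zeros P \<subseteq> S"
  proof
    fix x assume "x \<in> zeros P"
    then have "q (($) x) = 0" if "q \<in> I" for q using P(2) that unfolding zeros_def by blast
    then show "x \<in> S" by (rule \<open>\<And>x. (\<And>q. q \<in> I \<Longrightarrow> q (($) x) = 0) \<Longrightarrow> x \<in> S\<close>)
  qed
  have "Z i \<subseteq> S" if "i \<le> card B" for i
  proof -
    have "\<forall>i<card B. Z i \<subseteq> Z (Suc i)" using Z(2) by blast
    from flag_mono[of "card B" Z i "card B", OF this that order_refl] show ?thesis using Z(3) top by simp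
  qed
  then show ?thesis unfolding complex_dim_def using Z(1,2)
    by (intro SUP_upper CollectI exI[of _ Z]) auto
qed

section \<open>The Jelonek set\<close>

definition cplx :: "real ^ 'n \<Rightarrow> complex ^ 'n" where
  "cplx x = (\<chi> i. complex_of_real (x $ i))"

lemma cplx_nth: "($) (cplx x) = (\<lambda>i. complex_of_real (x $ i))"
  by (rule ext) (simp add: cplx_def)

lemma polyfun_complexify:
  assumes "q \<in> polyfun J"
  shows "\<exists>q'\<in>polyfun J. \<forall>z. q' (\<lambda>i. complex_of_real (z i)) = complex_of_real (q z)"
  using assms
proof induction
  case (const c)
  show ?case by (intro bexI[of _ "\<lambda>_. complex_of_real c"] polyfun.const) simp
next
  case (var i)
  then show ?case by (intro bexI[of _ "\<lambda>z. z i"] polyfun.var) simp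
next
  case (add p q)
  then obtain p' q' where "p' \<in> polyfun J" "q' \<in> polyfun J"
    "\<forall>z. p' (\<lambda>i. complex_of_real (z i)) = complex_of_real (p z)"
    "\<forall>z. q' (\<lambda>i. complex_of_real (z i)) = complex_of_real (q z)" by blast
  then show ?case by (intro bexI[of _ "\<lambda>z. p' z + q' z"] polyfun.add) simp_all
next
  case (mult p q)
  then obtain p' q' where "p' \<in> polyfun J" "q' \<in> polyfun J"
    "\<forall>z. p' (\<lambda>i. complex_of_real (z i)) = complex_of_real (p z)"
    "\<forall>z. q' (\<lambda>i. complex_of_real (z i)) = complex_of_real (q z)" by blast
  then show ?case by (intro bexI[of _ "\<lambda>z. p' z * q' z"] polyfun.mult) simp_all
qed

text \<open>At real arguments a complex polynomial is a pair of real ones, so a complex relation on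
  real points splits into two real relations.\<close>

lemma polyfun_Re_Im:
  assumes "q \<in> polyfun J"
  shows "\<exists>a\<in>polyfun J. \<exists>b\<in>polyfun J. \<forall>z.
    Re (q (\<lambda>i. complex_of_real (z i))) = a z \<and> Im (q (\<lambda>i. complex_of_real (z i))) = b z"
  using assms
proof induction
  case (const c)
  show ?case by (intro bexI[of _ "\<lambda>_. Re c"] bexI[of _ "\<lambda>_. Im c"] polyfun.const) simp
next
  case (var i)
  then show ?case by (intro bexI[of _ "\<lambda>z. z i"] bexI[of _ "\<lambda>_. 0"] polyfun.intros) simp_all
next
  case (add p q)
  then obtain a b c d where abcd: "a \<in> polyfun J" "b \<in> polyfun J" "c \<in> polyfun J" "d \<in> polyfun J"
    "\<forall>z. Re (p (\<lambda>i. complex_of_real (z i))) = a z \<and> Im (p (\<lambda>i. complex_of_real (z i))) = b z"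
    "\<forall>z. Re (q (\<lambda>i. complex_of_real (z i))) = c z \<and> Im (q (\<lambda>i. complex_of_real (z i))) = d z" by blast
  show ?case
    by (intro bexI[OF _ polyfun.add[OF abcd(1,3)]] bexI[OF _ polyfun.add[OF abcd(2,4)]]) (simp add: abcd)
next
  case (mult p q)
  then obtain a b c d where abcd: "a \<in> polyfun J" "b \<in> polyfun J" "c \<in> polyfun J" "d \<in> polyfun J"
    "\<forall>z. Re (p (\<lambda>i. complex_of_real (z i))) = a z \<and> Im (p (\<lambda>i. complex_of_real (z i))) = b z"
    "\<forall>z. Re (q (\<lambda>i. complex_of_real (z i))) = c z \<and> Im (q (\<lambda>i. complex_of_real (z i))) = d z" by blast
  show ?case
    by (intro bexI[OF _ polyfun_diff[OF polyfun.mult[OF abcd(1,3)] polyfun.mult[OF abcd(2,4)]]]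
        bexI[OF _ polyfun.add[OF polyfun.mult[OF abcd(1,4)] polyfun.mult[OF abcd(2,3)]]]) (simp add: abcd)
qed

text \<open>The point \<open>w\<close> is the value at \<open>t = \<i>\<close> of the line through
  its real part in the direction of its imaginary part, and the polynomial on this line vanishes for
  all real \<open>t\<close>.\<close>

lemma polyfun_zero_on_reals:
  assumes q: "q \<in> polyfun J" "\<And>z. q (\<lambda>i. complex_of_real (z i)) = 0"
  shows "q w = 0"
proof -
  obtain Q where Q: "\<And>t. q (\<lambda>i. complex_of_real (Re (w i)) + t * complex_of_real (Im (w i))) = poly Q t"
    using polyfun_line[OF q(1), of "\<lambda>i. complex_of_real (Re (w i))" "\<lambda>i. complex_of_real (Im (w i))"] by blast
  have "poly Q (complex_of_real t) = 0" for t
    using q(2)[of "\<lambda>i. Re (w i) + t * Im (w i)"] Q[of "complex_of_real t"] by simp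
  then have "range complex_of_real \<subseteq> {t. poly Q t = 0}" by auto
  moreover have "infinite (range complex_of_real)"
    using infinite_UNIV_char_0 by (simp add: finite_image_iff inj_on_def)
  ultimately have "Q = 0" using poly_roots_finite finite_subset by blast
  moreover have "(\<lambda>i. complex_of_real (Re (w i)) + \<i> * complex_of_real (Im (w i))) = w"
    by (rule ext) (simp add: complex_eq[symmetric])
  ultimately show ?thesis using Q[of \<i>] by simp
qed

lemma alg_indep_cplx:
  assumes ind: "alg_indep V coords K"
  shows "alg_indep (cplx ` V) coords K"
  unfolding alg_indep_def
proof (intro ballI impI allI)
  fix q w assume q: "q \<in> polyfun K" "\<forall>x\<in>cplx ` V. q (($) x) = 0"
  obtain a b where ab: "a \<in> polyfun K" "b \<in> polyfun K"
    "\<And>z. Re (q (\<lambda>i. complex_of_real (z i))) = a z \<and> Im (q (\<lambda>i. complex_of_real (z i))) = b z"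
    using polyfun_Re_Im[OF q(1)] by blast
  have "q (\<lambda>i. complex_of_real (x $ i)) = 0" if "x \<in> V" for x using q(2) that by (simp add: cplx_nth)
  then have "a (($) x) = 0" "b (($) x) = 0" if "x \<in> V" for x using ab(3)[of "($) x"] that by auto
  then have "a z = 0" "b z = 0" for z using alg_indepD[OF ind ab(1)] alg_indepD[OF ind ab(2)] by metis+
  then have "q (\<lambda>i. complex_of_real (z i)) = 0" for z using ab(3)[of z] by (simp add: complex_eq_iff)
  then show "q w = 0" by (rule polyfun_zero_on_reals[OF q(1)])
qed

lemma mfun_complex_mpoly: "mfun (complex_mpoly p) (\<lambda>i. complex_of_real (z i)) = complex_of_real (mfun p z)"
proof -
  have l: "Poly_Mapping.lookup (complex_mpoly p) m = complex_of_real (Poly_Mapping.lookup p m)" for m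
    unfolding complex_mpoly_def by (simp add: Poly_Mapping.map.rep_eq when_def)
  have "Poly_Mapping.keys (complex_mpoly p) = Poly_Mapping.keys p"
    by (auto simp: in_keys_iff l)
  then show ?thesis by (simp add: mfun_def l)
qed

lemma complex_map_nth: "complex_map F x $ j = mfun (complex_mpoly (F $ j)) (($) x)"
  by (simp add: complex_map_def poly_map_def mpoly_eval_mfun)

lemma poly_map_nth: "poly_map F x $ j = mfun (F $ j) (($) x)"
  by (simp add: poly_map_def mpoly_eval_mfun)

lemma complex_map_cplx: "complex_map F (cplx x) = cplx (poly_map F x)"
  by (simp add: vec_eq_iff complex_map_nth cplx_nth mfun_complex_mpoly) (simp add: cplx_def poly_map_nth)

lemma cplx_complex_points: "cplx x \<in> complex_points P \<longleftrightarrow> x \<in> zero_set P"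
  by (simp add: complex_points_def zero_set_def mpoly_eval_mfun cplx_nth mfun_complex_mpoly)

lemma real_points_iff: "x \<in> real_points S \<longleftrightarrow> cplx x \<in> S"
  by (simp add: real_points_def cplx_def)

lemma norm_cplx: "norm (cplx x) = norm x"
  by (simp add: norm_vec_def cplx_def)

lemma continuous_cplx: "continuous_on S cplx"
  unfolding cplx_def by (intro continuous_on_vec_lambda continuous_intros)

lemma continuous_poly_map:
  fixes F :: "('n::finite, 'k::real_normed_field) mpoly ^ 'm::finite"
  shows "continuous_on S (poly_map F)"
  unfolding poly_map_def mpoly_eval_mfun
  by (intro continuous_on_vec_lambda continuous_polyfun[OF mfun_polyfun])

text \<open>One coordinate of the source (\<open>None\<close>) together with the components of the
  map (\<open>Some j\<close>), all as polynomials on the source. The one additional function is the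
  gain in dimension of a Jelonek step.\<close>

definition graph_coord :: "'n::finite \<Rightarrow> ('n, 'k::comm_ring_1) mpoly ^ 'm::finite \<Rightarrow> 'm option \<Rightarrow> ('n \<Rightarrow> 'k) \<Rightarrow> 'k" where
  "graph_coord i G b z = (case b of None \<Rightarrow> z i | Some j \<Rightarrow> mfun (G $ j) z)"

lemma graph_coord_polyfun: "graph_coord i G b \<in> polyfun UNIV"
  unfolding graph_coord_def[abs_def] by (cases b) (simp_all add: mfun_polyfun polyfun.var)

abbreviation "cvec F \<equiv> (\<chi> j. complex_mpoly (F $ j))"

text \<open>A real relation on \<open>W\<close> is a member of \<open>vanishing_ideal W\<close>, so
  its complexification vanishes on the complex points. Here it matters that these are cut out by all
  real polynomials vanishing on \<open>W\<close>.\<close>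

lemma alg_indep_complex_points:
  fixes W :: "(real ^ 'n::finite) set" and F :: "('n, real) mpoly ^ 'm::finite"
  assumes ind: "alg_indep (complex_points (vanishing_ideal W)) (\<lambda>b x. graph_coord i (cvec F) b (($) x)) B"
  shows "alg_indep W (\<lambda>b x. graph_coord i F b (($) x)) B"
  unfolding alg_indep_def
proof (intro ballI impI allI)
  fix q z assume q: "q \<in> polyfun B" "\<forall>x\<in>W. q (\<lambda>b. graph_coord i F b (($) x)) = 0"
  obtain q' where q': "q' \<in> polyfun B" "\<And>z. q' (\<lambda>i. complex_of_real (z i)) = complex_of_real (q z)"
    using polyfun_complexify[OF q(1)] by blast
  have gp: "(\<lambda>z. q (\<lambda>b. graph_coord i F b z)) \<in> polyfun UNIV"
    by (rule polyfun_compose[OF q(1)]) (rule graph_coord_polyfun)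
  obtain p where p: "mfun p = (\<lambda>z. q (\<lambda>b. graph_coord i F b z))" using polyfun_mpoly[OF gp] by blast
  have pv: "p \<in> vanishing_ideal W" using q(2) by (simp add: vanishing_ideal_def mpoly_eval_mfun p)
  have eq: "mfun (complex_mpoly p) w = q' (\<lambda>b. graph_coord i (cvec F) b w)" for w
  proof -
    have d: "(\<lambda>z. mfun (complex_mpoly p) z - q' (\<lambda>b. graph_coord i (cvec F) b z)) \<in> polyfun UNIV"
      by (rule polyfun_diff[OF mfun_polyfun polyfun_compose[OF q'(1)]]) (rule graph_coord_polyfun)
    have r: "mfun (complex_mpoly p) (\<lambda>i. complex_of_real (z i))
        - q' (\<lambda>b. graph_coord i (cvec F) b (\<lambda>i. complex_of_real (z i))) = 0" for z
    proof -
      have "(\<lambda>b. graph_coord i (cvec F) b (\<lambda>i. complex_of_real (z i))) = (\<lambda>b. complex_of_real (graph_coord i F b z))"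
        by (rule ext) (simp add: graph_coord_def mfun_complex_mpoly split: option.split)
      then show ?thesis by (simp add: mfun_complex_mpoly p q'(2))
    qed
    from polyfun_zero_on_reals[OF d r, of w] show ?thesis by simp
  qed
  have "q' (\<lambda>b. graph_coord i (cvec F) b (($) x)) = 0" if "x \<in> complex_points (vanishing_ideal W)" for x
    using that pv by (simp add: complex_points_def zero_set_def mpoly_eval_mfun eq[symmetric])
  then have "q' w = 0" for w by (rule alg_indepD[OF ind q'(1)])
  then have "complex_of_real (q z) = 0" using q'(2)[of z] by simp
  then show "q z = 0" by simp
qed

text \<open>A Cauchy-type root bound, uniform in the coefficients so that it can be used along a
  sequence.\<close>

lemma polynomial_root_bound:
  fixes a :: "nat \<Rightarrow> complex"
  assumes "(\<Sum>k\<le>N. a k * t ^ k) = 0" "0 < \<eta>" "\<eta> \<le> norm (a N)" "\<And>k. k \<le> N \<Longrightarrow> norm (a k) \<le> A"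
  shows "norm t \<le> 1 + real N * A / \<eta>"
proof (cases "norm t \<le> 1")
  case True
  have "0 \<le> A" using order_trans[OF norm_ge_zero assms(4)[of N]] by simp
  then have "0 \<le> real N * A / \<eta>" using assms(2) by simp
  then show ?thesis using True by simp
next
  case False
  have "N \<noteq> 0"
  proof
    assume "N = 0"
    then show False using assms(1-3) by simp
  qed
  then obtain M where M: "N = Suc M" by (cases N) auto
  have "a N * t ^ N = - (\<Sum>k\<le>M. a k * t ^ k)"
    using assms(1) by (simp add: M eq_neg_iff_add_eq_0 add.commute)
  then have "norm (a N) * norm t ^ N = norm (\<Sum>k\<le>M. a k * t ^ k)"
    by (metis norm_minus_cancel norm_mult norm_power)
  also have "\<dots> \<le> (\<Sum>k\<le>M. A * norm t ^ M)"
  proof (rule sum_norm_le)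
    fix k assume "k \<in> {..M}"
    then have "norm t ^ k \<le> norm t ^ M" "norm (a k) \<le> A" using False assms(4)[of k] by (auto simp: M intro: power_increasing)
    then show "norm (a k * t ^ k) \<le> A * norm t ^ M"
      unfolding norm_mult norm_power by (intro mult_mono) (auto intro: order_trans[OF norm_ge_zero])
  qed
  also have "\<dots> = real N * A * norm t ^ M" by (simp add: M)
  finally have "(norm (a N) * norm t) * norm t ^ M \<le> (real N * A) * norm t ^ M" by (simp add: M mult.assoc)
  moreover have "0 < norm t ^ M" by (rule zero_less_power) (use False in linarith)
  ultimately have "norm (a N) * norm t \<le> real N * A" by (simp only: mult_le_cancel_right_pos)
  moreover have "\<eta> * norm t \<le> norm (a N) * norm t" using assms(3) by (intro mult_right_mono) auto
  ultimately have "norm t \<le> real N * A / \<eta>" using assms(2) by (simp add: pos_le_divide_eq mult.commute)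
  then show ?thesis by simp
qed

text \<open>If all coordinates of the source were algebraic over the given functions on the target, they
  would be bounded near the points of the target at which no leading coefficient vanishes.\<close>

lemma jelonek_dimension_drop:
  fixes f :: "complex ^ 'n::finite \<Rightarrow> complex ^ 'm::finite"
  assumes V: "V \<subseteq> jelonek_set S T f" and ind: "alg_indep V coords K"
  shows "\<exists>i. alg_indep S (\<lambda>b x. case b of None \<Rightarrow> x $ i | Some j \<Rightarrow> f x $ j) (insert None (Some ` K))"
proof (rule ccontr)
  assume neg: "\<not> ?thesis"
  define fam where "fam i b x = (case b of None \<Rightarrow> x $ i | Some j \<Rightarrow> f x $ j)" for i b x
  define R where "R i N c \<longleftrightarrow> (\<forall>k. c k \<in> polyfun K) \<and> (\<exists>w. c N w \<noteq> 0) \<and>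
    (\<forall>x\<in>S. (\<Sum>k\<le>N. c k (($) (f x)) * x $ i ^ k) = 0)" for i N and c :: "nat \<Rightarrow> ('m \<Rightarrow> complex) \<Rightarrow> complex"
  have "\<exists>N c. R i N c" for i
  proof -
    have "\<not> alg_indep S (fam i) (insert None (Some ` K))" using neg unfolding fam_def by blast
    then obtain q w where q: "q \<in> polyfun (insert None (Some ` K))" "\<And>x. x \<in> S \<Longrightarrow> q (\<lambda>b. fam i b x) = 0" "q w \<noteq> 0"
      unfolding alg_indep_def by blast
    obtain N c where c: "\<And>k. c k \<in> polyfun (Some ` K)"
      "\<And>z. q z = (\<Sum>k\<le>N. c k z * z None ^ k)" "\<exists>z. c N z \<noteq> 0"
      by (rule polyfun_expand_lead[where q = q, OF q(1,3)]) (rule that)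
    \<comment> \<open>The coefficients involve only the indices \<open>Some j\<close>; the value 0
      at \<open>None\<close> is a filler.\<close>
    define d where "d k z = c k (case_option 0 z)" for k z
    have "d k \<in> polyfun K" for k
      unfolding d_def[abs_def]
      by (rule polyfun_compose[OF c(1), of "\<lambda>b z. case_option 0 z b"]) (auto intro: polyfun.var)
    moreover have "\<exists>w. d N w \<noteq> 0"
    proof -
      obtain w where w: "c N w \<noteq> 0" using c(3) by blast
      have "d N (\<lambda>j. w (Some j)) = c N w" unfolding d_def by (rule polyfun_cong[OF c(1)]) auto
      then show ?thesis using w by metis
    qed
    moreover have "(\<Sum>k\<le>N. d k (($) (f x)) * x $ i ^ k) = 0" if "x \<in> S" for x
    proof -
      have "c k (\<lambda>b. fam i b x) = d k (($) (f x))" for k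
        unfolding d_def by (rule polyfun_cong[OF c(1)]) (auto simp: fam_def)
      then show ?thesis using q(2)[OF that] unfolding c(2) by (simp add: fam_def)
    qed
    ultimately show ?thesis unfolding R_def by blast
  qed
  then obtain N c where "\<And>i. R i (N i) (c i)" by metis
  then have c: "\<And>i k. c i k \<in> polyfun K" "\<And>i. \<exists>w. c i (N i) w \<noteq> 0"
    "\<And>i x. x \<in> S \<Longrightarrow> (\<Sum>k\<le>N i. c i k (($) (f x)) * x $ i ^ k) = 0"
    unfolding R_def by blast+
  \<comment> \<open>The product over all coordinates \<open>i\<close> allows a single point
    \<open>y\<close> of \<open>V\<close> at which every leading coefficient is nonzero.\<close>
  obtain w where w: "(\<Prod>i\<in>UNIV. c i (N i) w) \<noteq> 0"
    using polyfun_nonzero_prod[of UNIV "\<lambda>i. c i (N i)" K] c(1,2) by auto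
  have "(\<lambda>w. \<Prod>i\<in>UNIV. c i (N i) w) \<in> polyfun K" by (intro polyfun_prod c(1))
  then obtain y where y: "y \<in> V" "(\<Prod>i\<in>UNIV. c i (N i) (($) y)) \<noteq> 0"
    by (rule alg_indep_point[where q = "\<lambda>w. \<Prod>i\<in>UNIV. c i (N i) w", OF ind _ w])
  then have lead: "c i (N i) (($) y) \<noteq> 0" for i by simp
  obtain x where x: "\<And>k. x k \<in> S" "filterlim (\<lambda>k. norm (x k)) at_top sequentially" "(\<lambda>k. f (x k)) \<longlonglongrightarrow> y"
    using V y(1) unfolding jelonek_set_def by blast
  have lim: "(\<lambda>n. c i k (($) (f (x n)))) \<longlonglongrightarrow> c i k (($) y)" for i k
  proof -
    have "isCont (\<lambda>v. c i k (($) v)) y"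
      using continuous_polyfun[OF c(1), of UNIV i k] by (simp add: continuous_on_eq_continuous_at)
    from isCont_tendsto_compose[OF this x(3)] show ?thesis .
  qed
  have "\<exists>B. eventually (\<lambda>n. norm (x n $ i) \<le> B) sequentially" for i
  proof -
    \<comment> \<open>Half of the limit bounds the leading coefficient from below near the end of
      the sequence; the sum \<open>A\<close>, with a margin of 1 per term, bounds all coefficients
      from above.\<close>
    define \<eta> where "\<eta> = norm (c i (N i) (($) y)) / 2"
    define A where "A = (\<Sum>k\<le>N i. norm (c i k (($) y)) + 1)"
    have \<eta>: "0 < \<eta>" using lead[of i] by (simp add: \<eta>_def)
    have "eventually (\<lambda>n. \<eta> < norm (c i (N i) (($) (f (x n))))) sequentially"
      using order_tendstoD(1)[OF tendsto_norm[OF lim[of i "N i"]], of \<eta>] lead[of i] by (simp add: \<eta>_def)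
    moreover have "eventually (\<lambda>n. \<forall>k\<in>{..N i}. norm (c i k (($) (f (x n)))) < norm (c i k (($) y)) + 1) sequentially"
      by (intro eventually_ball_finite ballI order_tendstoD(2)[OF tendsto_norm[OF lim]]) auto
    ultimately have "eventually (\<lambda>n. norm (x n $ i) \<le> 1 + real (N i) * A / \<eta>) sequentially"
    proof eventually_elim
      case (elim n)
      show ?case
      proof (rule polynomial_root_bound[OF c(3)[OF x(1)] \<eta>])
        show "\<eta> \<le> norm (c i (N i) (($) (f (x n))))" using elim(1) by simp
        fix k assume k: "k \<le> N i"
        have "norm (c i k (($) y)) + 1 \<le> A" unfolding A_def by (rule member_le_sum) (use k in auto)
        then show "norm (c i k (($) (f (x n)))) \<le> A" using bspec[OF elim(2), of k] k by simp
      qed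
    qed
    then show ?thesis by blast
  qed
  then obtain B where B: "\<And>i. eventually (\<lambda>n. norm (x n $ i) \<le> B i) sequentially" by metis
  have "eventually (\<lambda>n. \<forall>i. norm (x n $ i) \<le> B i) sequentially"
    by (rule eventually_all_finite) (rule B)
  moreover have "eventually (\<lambda>n. sum B UNIV < norm (x n)) sequentially"
    using x(2) unfolding filterlim_at_top_dense by blast
  ultimately have "eventually (\<lambda>n. False) sequentially"
  proof eventually_elim
    case (elim n)
    have "norm (x n) \<le> (\<Sum>i\<in>UNIV. norm (x n $ i))" unfolding norm_vec_def by (rule L2_set_le_sum) simp
    also have "\<dots> \<le> sum B UNIV" using elim(1) by (intro sum_mono) auto
    finally show ?case using elim(2) by simp
  qed
  then show False by simp
qed

lemma complex_map_family:
  "(\<lambda>b x. case b of None \<Rightarrow> x $ i | Some j \<Rightarrow> complex_map F x $ j) = (\<lambda>b x. graph_coord i (cvec F) b (($) x))"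
  by (intro ext) (simp add: graph_coord_def complex_map_nth split: option.split)

lemma card_graph_index: "card (insert None (Some ` (K :: 'm::finite set))) = Suc (card K)"
  by (simp add: card_insert_if card_image)

text \<open>The \<open>Suc (card K)\<close> functions are polynomials and remain independent on the
  real set \<open>W\<close>; \<open>polynomials_dependent\<close> converts their number into a bound
  for \<open>adim W\<close>.\<close>

lemma adim_drop:
  assumes "V \<noteq> {}" "cplx ` V \<subseteq> jelonek_set (complex_points (vanishing_ideal W)) T (complex_map F)"
  shows "Suc (adim V) \<le> adim W"
proof -
  obtain K where K: "alg_indep V coords K" "card K = adim V" using assms(1) by (rule adim_attained)
  obtain i where "alg_indep (complex_points (vanishing_ideal W)) (\<lambda>b x. graph_coord i (cvec F) b (($) x)) (insert None (Some ` K))"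
    using jelonek_dimension_drop[OF assms(2) alg_indep_cplx[OF K(1)]] unfolding complex_map_family by blast
  from alg_indep_complex_points[OF this]
  have "alg_indep W (\<lambda>b x. graph_coord i F b (($) x)) (insert None (Some ` K))" .
  then have "\<not> adim W < card (insert None (Some ` K))"
    using polynomials_dependent[where B = "insert None (Some ` K)" and A = W and H = "graph_coord i F",
        OF _ _ graph_coord_polyfun] by auto
  then show ?thesis using K(2) unfolding card_graph_index by simp
qed

text \<open>The variant for the top of the flag: the complex points are those of given polynomials,
  so the gain is recorded in \<open>complex_dim\<close> instead of on the real zero set.\<close>

lemma complex_dim_drop:
  assumes "V \<noteq> {}" "cplx ` V \<subseteq> jelonek_set (complex_points P) T (complex_map F)"
  shows "ereal (real (Suc (adim V))) \<le> complex_dim (complex_points P)"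
proof -
  obtain K where K: "alg_indep V coords K" "card K = adim V" using assms(1) by (rule adim_attained)
  obtain i where ind: "alg_indep (complex_points P) (\<lambda>b x. graph_coord i (cvec F) b (($) x)) (insert None (Some ` K))"
    using jelonek_dimension_drop[OF assms(2) alg_indep_cplx[OF K(1)]] unfolding complex_map_family by blast
  have "algebraic_set (complex_points P)" unfolding complex_points_def algebraic_set_def by blast
  moreover have "\<forall>b\<in>insert None (Some ` K). graph_coord i (cvec F) b \<in> polyfun UNIV"
    using graph_coord_polyfun by blast
  moreover have "finite (insert None (Some ` K))" by simp
  ultimately have "ereal (real (card (insert None (Some ` K)))) \<le> complex_dim (complex_points P)"
    using ind by (intro complex_dim_ge[where g = "graph_coord i (cvec F)"])
  then show ?thesis unfolding card_graph_index K(2) .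
qed

section \<open>Finiteness and closedness from the Jelonek set\<close>

lemma unbounded_sequence:
  fixes S :: "'a::real_normed_vector set"
  assumes "\<not> bounded S"
  obtains x where "\<And>k::nat. x k \<in> S" "filterlim (\<lambda>k. norm (x k)) at_top sequentially"
proof -
  have "\<exists>x\<in>S. real k < norm x" for k :: nat
    using assms unfolding bounded_iff by (meson linorder_not_le)
  then obtain x where x: "\<And>k. x k \<in> S" "\<And>k. real k < norm (x k)" by metis
  have "filterlim (\<lambda>k. norm (x k)) at_top sequentially"
    by (rule filterlim_at_top_mono[OF filterlim_real_sequentially]) (auto intro: always_eventually less_imp_le[OF x(2)])
  then show ?thesis using that x(1) by blast
qed

text \<open>An unbounded fiber contains a sequence going to infinity with constant image
  \<open>y\<close>, which makes \<open>y\<close> a Jelonek point. So the fiber is bounded as well as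
  algebraic.\<close>

lemma finite_fiber_outside_jelonek:
  assumes "y \<in> T" "y \<notin> jelonek_set (complex_points P) T (complex_map F)"
  shows "finite {x\<in>complex_points P. complex_map F x = y}"
proof (rule bounded_algebraic_finite)
  define Q where "Q = mfun ` complex_mpoly ` P \<union> range (\<lambda>j z. mfun (complex_mpoly (F $ j)) z - y $ j)"
  have "{x\<in>complex_points P. complex_map F x = y} = zeros Q"
    by (simp add: set_eq_iff zeros_def Q_def complex_points_def zero_set_def mpoly_eval_mfun
        vec_eq_iff complex_map_nth ball_Un)
  moreover have "Q \<subseteq> polyfun UNIV"
    unfolding Q_def using mfun_polyfun by (auto intro!: polyfun_diff polyfun.const)
  ultimately show "algebraic_set {x\<in>complex_points P. complex_map F x = y}"
    using algebraic_zeros[of Q] by simp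
  show "bounded {x\<in>complex_points P. complex_map F x = y}"
  proof (rule ccontr)
    assume "\<not> ?thesis"
    then obtain x where x: "\<And>k::nat. x k \<in> {x\<in>complex_points P. complex_map F x = y}"
      "filterlim (\<lambda>k. norm (x k)) at_top sequentially" by (rule unbounded_sequence) blast
    then have "(\<lambda>k. complex_map F (x k)) \<longlonglongrightarrow> y" by simp
    then have "y \<in> jelonek_set (complex_points P) T (complex_map F)"
      using x assms(1) unfolding jelonek_set_def by blast
    then show False using assms(2) by blast
  qed
qed

text \<open>Diagonal choice: for each \<open>y n\<close>, a source point of norm above
  \<open>n\<close> whose image is within \<open>1 / (n + 1)\<close> of \<open>y n\<close>.\<close>

lemma closed_jelonek_set:
  assumes "closed T"
  shows "closed (jelonek_set S T f)"
  unfolding closed_sequential_limits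
proof (intro allI impI, elim conjE)
  fix y l assume y: "\<forall>n. y n \<in> jelonek_set S T f" "y \<longlonglongrightarrow> l"
  have "\<exists>x. x \<in> S \<and> real n < norm x \<and> dist (f x) (y n) < inverse (real (Suc n))" for n
  proof -
    obtain x where x: "\<And>k. x k \<in> S" "filterlim (\<lambda>k. norm (x k)) at_top sequentially" "(\<lambda>k. f (x k)) \<longlonglongrightarrow> y n"
      using y(1) unfolding jelonek_set_def by blast
    have "eventually (\<lambda>k. real n < norm (x k)) sequentially" using x(2) unfolding filterlim_at_top_dense by blast
    moreover have "eventually (\<lambda>k. dist (f (x k)) (y n) < inverse (real (Suc n))) sequentially"
      by (rule tendstoD[OF x(3)]) simp
    ultimately have "eventually (\<lambda>k. real n < norm (x k) \<and> dist (f (x k)) (y n) < inverse (real (Suc n))) sequentially"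
      by (rule eventually_conj)
    then obtain k where "real n < norm (x k)" "dist (f (x k)) (y n) < inverse (real (Suc n))"
      unfolding eventually_sequentially by blast
    then show ?thesis using x(1) by blast
  qed
  then obtain x where x: "\<And>n. x n \<in> S" "\<And>n. real n < norm (x n)" "\<And>n. dist (f (x n)) (y n) < inverse (real (Suc n))"
    by metis
  have "filterlim (\<lambda>k. norm (x k)) at_top sequentially"
    by (rule filterlim_at_top_mono[OF filterlim_real_sequentially]) (auto intro: always_eventually less_imp_le[OF x(2)])
  moreover have "(\<lambda>n. f (x n)) \<longlonglongrightarrow> l"
  proof -
    have "(\<lambda>n. dist (f (x n)) (y n)) \<longlonglongrightarrow> 0"
    proof (rule tendsto_sandwich[OF _ _ tendsto_const LIMSEQ_inverse_real_of_nat])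
      show "eventually (\<lambda>n. dist (f (x n)) (y n) \<le> inverse (real (Suc n))) sequentially"
        by (intro always_eventually allI less_imp_le[OF x(3)])
    qed simp
    from Lim_transform2[OF y(2)] this show ?thesis by (simp add: dist_norm tendsto_norm_zero_iff dist_commute norm_minus_commute)
  qed
  moreover have "l \<in> T"
    using closed_sequentially[OF assms _ y(2)] y(1) unfolding jelonek_set_def by blast
  ultimately show "l \<in> jelonek_set S T f" using x(1) unfolding jelonek_set_def by blast
qed

section \<open>Finite coverings\<close>

text \<open>Small balls around the points of a fiber give the sheets. The image of what they leave
  out is closed and is removed from the base, so nothing else lies over the neighbourhood.
  Connectedness makes the number of sheets constant, hence one fiber serves everywhere.\<close>

lemma finite_covering_bundle:
  fixes f :: "'a::euclidean_space \<Rightarrow> 'b::euclidean_space"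
  assumes cont: "continuous_on E f" and fE: "f ` E \<subseteq> R" and conn: "connected R"
    and fin: "\<And>y. y \<in> R \<Longrightarrow> finite {x\<in>E. f x = y}"
    and inj: "\<And>x. x \<in> E \<Longrightarrow> \<exists>e>0. inj_on f (E \<inter> ball x e)"
    and op: "\<And>x W. x \<in> E \<Longrightarrow> open W \<Longrightarrow> x \<in> W \<Longrightarrow> \<exists>e>0. R \<inter> ball (f x) e \<subseteq> f ` (E \<inter> W)"
    and cl: "\<And>C. closedin (top_of_set E) C \<Longrightarrow> closedin (top_of_set R) (f ` C)"
  shows "locally_trivial_bundle f E R"
proof -
  define fib where "fib y = {x\<in>E. f x = y}" for y
  have open_map: "openin (top_of_set R) (f ` W)" if W: "openin (top_of_set E) W" for W
  proof (subst openin_subopen, intro ballI)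
    fix y assume "y \<in> f ` W"
    then obtain x where x: "x \<in> W" "y = f x" by blast
    obtain G where G: "open G" "W = E \<inter> G" using W unfolding openin_open by blast
    obtain e where e: "e > 0" "R \<inter> ball (f x) e \<subseteq> f ` (E \<inter> G)" using op[OF _ G(1)] x G(2) by blast
    have "openin (top_of_set R) (R \<inter> ball (f x) e)" by (rule openin_open_Int) simp
    moreover have "y \<in> R \<inter> ball (f x) e" using x e(1) fE G(2) by auto
    ultimately show "\<exists>T. openin (top_of_set R) T \<and> y \<in> T \<and> T \<subseteq> f ` W" using e(2) G(2) by blast
  qed
  have nbhd: "\<exists>U r. openin (top_of_set R) U \<and> b \<in> U \<and> 0 < r \<and>
      (\<forall>x\<in>fib b. \<forall>y\<in>fib b. x \<noteq> y \<longrightarrow> ball x r \<inter> ball y r = {}) \<and>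
      (\<forall>x\<in>fib b. inj_on f (E \<inter> ball x r)) \<and> (\<forall>x\<in>fib b. U \<subseteq> f ` (E \<inter> ball x r)) \<and>
      (\<forall>x\<in>E. f x \<in> U \<longrightarrow> (\<exists>y\<in>fib b. x \<in> ball y r))" if b: "b \<in> R" for b
  proof -
    have finb: "finite (fib b)" using fin[OF b] by (simp add: fib_def)
    have "\<exists>e. \<forall>x\<in>fib b. 0 < e x \<and> inj_on f (E \<inter> ball x (e x))"
      using inj by (intro bchoice) (auto simp: fib_def)
    then obtain e where e: "\<And>x. x \<in> fib b \<Longrightarrow> 0 < e x" "\<And>x. x \<in> fib b \<Longrightarrow> inj_on f (E \<inter> ball x (e x))" by blast
    \<comment> \<open>Half of the distances keeps the balls disjoint; the entry 1 covers the empty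
      fiber.\<close>
    define r where "r = Min (insert 1 (e ` fib b \<union> (\<lambda>(x, y). dist x y / 2) ` {(x, y). x \<in> fib b \<and> y \<in> fib b \<and> x \<noteq> y}))"
    have finD: "finite {(x, y). x \<in> fib b \<and> y \<in> fib b \<and> x \<noteq> y}"
      by (rule finite_subset[of _ "fib b \<times> fib b"]) (use finb in auto)
    have r: "0 < r" unfolding r_def using finb finD e(1) by (subst Min_gr_iff) auto
    have re: "r \<le> e x" if "x \<in> fib b" for x unfolding r_def using finb finD that by (intro Min_le) auto
    have rd: "r \<le> dist x y / 2" if "x \<in> fib b" "y \<in> fib b" "x \<noteq> y" for x y
      unfolding r_def using finb finD that by (intro Min_le) (auto intro!: image_eqI[of _ _ "(x, y)"])
    have disj: "ball x r \<inter> ball y r = {}" if "x \<in> fib b" "y \<in> fib b" "x \<noteq> y" for x y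
    proof (rule ccontr)
      assume "ball x r \<inter> ball y r \<noteq> {}"
      then obtain z where "dist x z < r" "dist y z < r" by auto
      then have "dist x y < 2 * r" using dist_triangle2[of x y z] by linarith
      then show False using rd[OF that] by simp
    qed
    have injr: "inj_on f (E \<inter> ball x r)" if "x \<in> fib b" for x
      by (rule inj_on_subset[OF e(2)[OF that]]) (use re[OF that] in auto)
    define A where "A = E - (\<Union>x\<in>fib b. ball x r)"
    have "closedin (top_of_set E) A"
      unfolding A_def Diff_eq by (rule closedin_closed_Int) auto
    then have clA: "closedin (top_of_set R) (f ` A)" by (rule cl)
    define U where "U = (\<Inter>T\<in>insert (R - f ` A) ((\<lambda>x. f ` (E \<inter> ball x r)) ` fib b). T)"
    have "openin (top_of_set R) U" unfolding U_def
    proof (intro openin_INT2)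
      fix T assume "T \<in> insert (R - f ` A) ((\<lambda>x. f ` (E \<inter> ball x r)) ` fib b)"
      then show "openin (top_of_set R) T"
        using clA open_map openin_open_Int[OF open_ball, of E] by (auto intro: openin_diff)
    qed (use finb in auto)
    moreover have "b \<in> U"
    proof -
      have "b \<notin> f ` A" using r by (auto simp: A_def fib_def)
      moreover have "b \<in> f ` (E \<inter> ball x r)" if "x \<in> fib b" for x
        using that r by (auto simp: fib_def intro!: image_eqI[of _ _ x])
      ultimately show ?thesis using b by (auto simp: U_def)
    qed
    moreover have "U \<subseteq> f ` (E \<inter> ball x r)" if "x \<in> fib b" for x using that unfolding U_def by blast
    moreover have "\<exists>y\<in>fib b. x \<in> ball y r" if "x \<in> E" "f x \<in> U" for x
    proof (rule ccontr)
      assume "\<not> ?thesis"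
      then have "f x \<in> f ` A" using that(1) unfolding A_def by blast
      then show False using that(2) unfolding U_def by blast
    qed
    ultimately show ?thesis using r disj injr by (intro exI[of _ U] exI[of _ r]) simp
  qed
  have card_const: "card (fib y) = card (fib b)" if "b \<in> R" "y \<in> R" for b y
  proof (rule connected_local_const[OF conn that(2,1)], intro ballI)
    fix b assume b: "b \<in> R"
    obtain U r where U: "openin (top_of_set R) U" "b \<in> U" "0 < r"
      "\<forall>x\<in>fib b. \<forall>y\<in>fib b. x \<noteq> y \<longrightarrow> ball x r \<inter> ball y r = {}"
      "\<forall>x\<in>fib b. inj_on f (E \<inter> ball x r)" "\<forall>x\<in>fib b. U \<subseteq> f ` (E \<inter> ball x r)"
      "\<forall>x\<in>E. f x \<in> U \<longrightarrow> (\<exists>y\<in>fib b. x \<in> ball y r)" using nbhd[OF b] by (elim exE conjE) (rule that)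
    have "card (fib b) = card (fib y)" if y: "y \<in> U" for y
    proof -
      have "\<forall>x\<in>fib y. \<exists>z. z \<in> fib b \<and> x \<in> ball z r" using U(7) y by (auto simp: fib_def)
      then obtain t where t: "\<And>x. x \<in> fib y \<Longrightarrow> t x \<in> fib b" "\<And>x. x \<in> fib y \<Longrightarrow> x \<in> ball (t x) r" by metis
      have "bij_betw t (fib y) (fib b)"
      proof (rule bij_betw_imageI)
        show "inj_on t (fib y)"
        proof (rule inj_onI)
          fix x x' assume x: "x \<in> fib y" "x' \<in> fib y" "t x = t x'"
          show "x = x'"
            by (rule inj_onD[OF U(5)[rule_format, OF t(1)[OF x(1)]]])
              (use x t(2)[OF x(1)] t(2)[OF x(2)] in \<open>auto simp: fib_def\<close>)
        qed
        show "t ` fib y = fib b"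
        proof (intro equalityI subsetI)
          fix z assume z: "z \<in> fib b"
          then have "y \<in> f ` (E \<inter> ball z r)" using U(6) y by blast
          then obtain x where x: "x \<in> E" "x \<in> ball z r" "y = f x" by blast
          then have xf: "x \<in> fib y" by (simp add: fib_def)
          have "t x = z"
          proof (rule ccontr)
            assume "t x \<noteq> z"
            then have "ball (t x) r \<inter> ball z r = {}" using U(4) t(1)[OF xf] z by blast
            then show False using t(2)[OF xf] x(2) by blast
          qed
          then show "z \<in> t ` fib y" using xf by blast
        qed (use t(1) in blast)
      qed
      then show ?thesis by (simp add: bij_betw_same_card)
    qed
    note same_card = this
    obtain G where G: "open G" "U = R \<inter> G" using U(1) unfolding openin_open by blast
    show "eventually (\<lambda>y. card (fib b) = card (fib y)) (at b within R)"
      unfolding eventually_at_topological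
    proof (intro exI conjI ballI impI)
      fix y assume "y \<in> G" "y \<in> R"
      then show "card (fib b) = card (fib y)" using same_card[of y] G(2) by blast
    qed (use G U(2) in auto)
  qed
  have "\<exists>F :: 'a set. \<forall>b\<in>R. \<exists>U g h. openin (top_of_set R) U \<and> b \<in> U \<and>
        homeomorphism {x\<in>E. f x \<in> U} (U \<times> F) g h \<and> (\<forall>x\<in>E. f x \<in> U \<longrightarrow> fst (g x) = f x)"
  proof (cases "R = {}")
    case False
    then obtain b0 where b0: "b0 \<in> R" by blast
    define F where "F = fib b0"
    have finF: "finite F" using fin[OF b0] by (simp add: F_def fib_def)
    have "\<exists>U g h. openin (top_of_set R) U \<and> b \<in> U \<and>
        homeomorphism {x\<in>E. f x \<in> U} (U \<times> F) g h \<and> (\<forall>x\<in>E. f x \<in> U \<longrightarrow> fst (g x) = f x)"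
      if b: "b \<in> R" for b
    proof -
      obtain U r where U: "openin (top_of_set R) U" "b \<in> U" "0 < r"
        "\<forall>x\<in>fib b. \<forall>y\<in>fib b. x \<noteq> y \<longrightarrow> ball x r \<inter> ball y r = {}"
        "\<forall>x\<in>fib b. inj_on f (E \<inter> ball x r)" "\<forall>x\<in>fib b. U \<subseteq> f ` (E \<inter> ball x r)"
        "\<forall>x\<in>E. f x \<in> U \<longrightarrow> (\<exists>y\<in>fib b. x \<in> ball y r)" using nbhd[OF b] by (elim exE conjE) (rule that)
      have "finite (fib b)" using fin[OF b] by (simp add: fib_def)
      \<comment> \<open>The sheets over \<open>b\<close> are labelled by the points of the fixed
        fiber \<open>F\<close>, which has the same cardinality.\<close>
      then obtain \<sigma> where \<sigma>: "bij_betw \<sigma> (fib b) F"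
        using finite_same_card_bij[OF _ finF] card_const[OF b b0] by (auto simp: F_def)
      define D where "D = {x\<in>E. f x \<in> U}"
      have "\<forall>x\<in>D. \<exists>z. z \<in> fib b \<and> x \<in> ball z r" using U(7) by (auto simp: D_def)
      then obtain t where t: "\<And>x. x \<in> D \<Longrightarrow> t x \<in> fib b" "\<And>x. x \<in> D \<Longrightarrow> x \<in> ball (t x) r" by metis
      have t_eq: "t x = z" if "x \<in> D" "z \<in> fib b" "x \<in> ball z r" for x z
      proof (rule ccontr)
        assume "t x \<noteq> z"
        then have "ball (t x) r \<inter> ball z r = {}" using U(4) t(1)[OF that(1)] that(2) by blast
        then show False using t(2)[OF that(1)] that(3) by blast
      qed
      define g where "g x = (f x, \<sigma> (t x))" for x
      have UR: "U \<subseteq> R" using U(1) by (rule openin_imp_subset)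
      have DE: "openin (top_of_set E) D"
      proof -
        obtain G where G: "open G" "U = R \<inter> G" using U(1) unfolding openin_open by blast
        have "D = E \<inter> f -` G" using G(2) fE by (auto simp: D_def)
        then show ?thesis using continuous_openin_preimage_gen[OF cont G(1)] by simp
      qed
      have contg: "continuous_on D g"
        unfolding g_def
      proof (intro continuous_on_Pair)
        show "continuous_on D f" by (rule continuous_on_subset[OF cont]) (auto simp: D_def)
        \<comment> \<open>The label is constant on \<open>D \<inter> ball (t x) r\<close>.\<close>
        show "continuous_on D (\<lambda>x. \<sigma> (t x))"
          unfolding continuous_on_def
        proof (intro ballI tendsto_eventually)
          fix x assume x: "x \<in> D"
          show "eventually (\<lambda>y. \<sigma> (t y) = \<sigma> (t x)) (at x within D)"
            unfolding eventually_at_topological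
            by (intro exI[of _ "ball (t x) r"]) (use t[OF x] t_eq in auto)
        qed
      qed
      have img: "g ` D = U \<times> F"
      proof (intro equalityI subsetI)
        fix p assume "p \<in> g ` D"
        then show "p \<in> U \<times> F" using t(1) \<sigma> by (auto simp: g_def D_def bij_betw_def)
      next
        fix p assume "p \<in> U \<times> F"
        then obtain u z where p: "p = (u, \<sigma> z)" "u \<in> U" "z \<in> fib b" using \<sigma> by (auto simp: bij_betw_def)
        then have "u \<in> f ` (E \<inter> ball z r)" using U(6) by blast
        then obtain x where x: "x \<in> E" "x \<in> ball z r" "u = f x" by blast
        then have "x \<in> D" using p(2) by (simp add: D_def)
        then show "p \<in> g ` D" using t_eq[OF _ p(3) x(2)] x(3) p(1) by (auto simp: g_def)
      qed
      have injg: "inj_on g D"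
      proof (rule inj_onI)
        fix x y assume xy: "x \<in> D" "y \<in> D" "g x = g y"
        then have "t x = t y" using \<sigma> t(1) by (auto simp: g_def bij_betw_def dest: inj_onD)
        then show "x = y"
          by (intro inj_onD[OF U(5)[rule_format, OF t(1)[OF xy(1)]]])
            (use xy t(2)[OF xy(1)] t(2)[OF xy(2)] in \<open>auto simp: g_def D_def\<close>)
      qed
      have openg: "openin (top_of_set (U \<times> F)) (g ` W)" if W: "openin (top_of_set D) W" for W
      proof (subst openin_subopen, intro ballI)
        fix p assume "p \<in> g ` W"
        then obtain x where x: "x \<in> W" "p = g x" by blast
        have WD: "W \<subseteq> D" using W by (rule openin_imp_subset)
        have xD: "x \<in> D" using x(1) WD by blast
        have WE: "openin (top_of_set E) W" using W DE by (rule openin_trans)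
        have "openin (top_of_set E) (W \<inter> ball (t x) r)"
          using openin_Int[OF WE openin_open_Int[OF open_ball[of "t x" r], of E]] openin_imp_subset[OF WE]
          by (simp add: Int_assoc[symmetric] inf.absorb1)
        then have "openin (top_of_set R) (f ` (W \<inter> ball (t x) r))" by (rule open_map)
        moreover have "f ` (W \<inter> ball (t x) r) \<subseteq> U" using WD by (auto simp: D_def)
        ultimately have "openin (top_of_set U) (f ` (W \<inter> ball (t x) r))"
          using UR by (rule openin_subset_trans)
        moreover have "openin (top_of_set F) {\<sigma> (t x)}"
        proof -
          have "\<sigma> (t x) \<in> F" using \<sigma> t(1)[OF xD] by (auto simp: bij_betw_def)
          then have "{\<sigma> (t x)} = F \<inter> - (F - {\<sigma> (t x)})" by blast
          moreover have "open (- (F - {\<sigma> (t x)}))" using finF by (intro open_Compl finite_imp_closed) simp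
          ultimately show ?thesis unfolding openin_open by blast
        qed
        ultimately have "openin (top_of_set (U \<times> F)) (f ` (W \<inter> ball (t x) r) \<times> {\<sigma> (t x)})"
          by (rule openin_Times)
        moreover have "p \<in> f ` (W \<inter> ball (t x) r) \<times> {\<sigma> (t x)}" using x t(2)[OF xD] by (auto simp: g_def)
        moreover have "f ` (W \<inter> ball (t x) r) \<times> {\<sigma> (t x)} \<subseteq> g ` W"
        proof
          fix q assume "q \<in> f ` (W \<inter> ball (t x) r) \<times> {\<sigma> (t x)}"
          then obtain x' where x': "x' \<in> W" "x' \<in> ball (t x) r" "q = (f x', \<sigma> (t x))" by blast
          have "t x' = t x" using t_eq[OF _ t(1)[OF xD] x'(2)] x'(1) WD by blast
          then show "q \<in> g ` W" using x' by (auto simp: g_def)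
        qed
        ultimately show "\<exists>T. openin (top_of_set (U \<times> F)) T \<and> p \<in> T \<and> T \<subseteq> g ` W" by blast
      qed
      obtain h where "homeomorphism D (U \<times> F) g h"
        using homeomorphism_injective_open_map[OF contg img injg openg] by blast
      then show ?thesis using U(1,2) unfolding D_def
        by (intro exI[of _ U] exI[of _ g] exI[of _ h]) (simp add: g_def)
    qed
    then show ?thesis by (intro exI[of _ F]) blast
  qed simp
  then show ?thesis unfolding locally_trivial_bundle_def using cont fE by blast
qed

text \<open>The data are local on each stratum, and the danger is that strata accumulate at one
  another. As every stratum meets the finite fiber over \<open>b\<close>, there are finitely many,
  and disjoint relatively closed sets in finite number are relatively open in
  \<open>E\<close>.\<close>

lemma stratified_covering_bundle:
  fixes f :: "'a::euclidean_space \<Rightarrow> 'b::euclidean_space"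
  assumes cont: "continuous_on E f" and fE: "f ` E \<subseteq> R" and conn: "connected R" and R: "R \<noteq> {}"
    and fin: "\<And>y. y \<in> R \<Longrightarrow> finite {x\<in>E. f x = y}"
    and cl: "\<And>C. closedin (top_of_set E) C \<Longrightarrow> closedin (top_of_set R) (f ` C)"
    and M: "\<Union>\<M> = E" "disjoint \<M>" "{} \<notin> \<M>"
    and Mcl: "\<And>M. M \<in> \<M> \<Longrightarrow> closedin (top_of_set E) M"
    and inj: "\<And>M x. M \<in> \<M> \<Longrightarrow> x \<in> M \<Longrightarrow> \<exists>e>0. inj_on f (M \<inter> ball x e)"
    and op: "\<And>M x W. M \<in> \<M> \<Longrightarrow> x \<in> M \<Longrightarrow> open W \<Longrightarrow> x \<in> W \<Longrightarrow> \<exists>e>0. R \<inter> ball (f x) e \<subseteq> f ` (M \<inter> W)"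
  shows "locally_trivial_bundle f E R"
proof -
  have ME: "M \<subseteq> E" if "M \<in> \<M>" for M using M(1) that by blast
  have surj: "f ` M = R" if MM: "M \<in> \<M>" for M
  proof -
    have "openin (top_of_set R) (f ` M)"
    proof (subst openin_subopen, intro ballI)
      fix y assume "y \<in> f ` M"
      then obtain x where x: "x \<in> M" "y = f x" by blast
      obtain e where e: "e > 0" "R \<inter> ball (f x) e \<subseteq> f ` (M \<inter> UNIV)" using op[OF MM x(1) open_UNIV UNIV_I] by blast
      have "openin (top_of_set R) (R \<inter> ball (f x) e)" by (rule openin_open_Int) simp
      moreover have "y \<in> R \<inter> ball (f x) e" using x e(1) fE ME[OF MM] by auto
      ultimately show "\<exists>T. openin (top_of_set R) T \<and> y \<in> T \<and> T \<subseteq> f ` M" using e(2) by auto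
    qed
    moreover have "closedin (top_of_set R) (f ` M)" by (rule cl[OF Mcl[OF MM]])
    moreover have "f ` M \<noteq> {}" using M(3) MM by auto
    ultimately show ?thesis using conn unfolding connected_clopen by blast
  qed
  obtain b where b: "b \<in> R" using R by blast
  have "\<forall>M\<in>\<M>. \<exists>x. x \<in> M \<and> f x = b"
  proof
    fix M assume "M \<in> \<M>"
    then have "b \<in> f ` M" using surj b by blast
    then show "\<exists>x. x \<in> M \<and> f x = b" by blast
  qed
  then obtain c where c: "\<And>M. M \<in> \<M> \<Longrightarrow> c M \<in> M" "\<And>M. M \<in> \<M> \<Longrightarrow> f (c M) = b" by metis
  have "c ` \<M> \<subseteq> {x\<in>E. f x = b}" using c ME by blast
  then have "finite (c ` \<M>)" using fin[OF b] finite_subset by blast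
  moreover have "inj_on c \<M>"
  proof (rule inj_onI)
    fix M N assume MN: "M \<in> \<M>" "N \<in> \<M>" "c M = c N"
    then have "c M \<in> M \<inter> N" using c(1)[OF MN(1)] c(1)[OF MN(2)] by simp
    then show "M = N" using M(2) MN(1,2) unfolding disjoint_def by blast
  qed
  ultimately have finM: "finite \<M>" by (simp add: finite_image_iff)
  have local: "\<exists>e>0. E \<inter> ball x e \<subseteq> M" if MM: "M \<in> \<M>" "x \<in> M" for M x
  proof -
    have "closedin (top_of_set E) (\<Union>(\<M> - {M}))" using finM Mcl by (intro closedin_Union) auto
    then obtain T where T: "closed T" "\<Union>(\<M> - {M}) = E \<inter> T" unfolding closedin_closed by blast
    have "x \<notin> \<Union>(\<M> - {M})" using M(2) MM unfolding disjoint_def by blast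
    then have "x \<in> - T" using T(2) ME MM by blast
    then obtain e where e: "e > 0" "ball x e \<subseteq> - T" using T(1) by (metis open_Compl openE)
    have "E \<inter> ball x e \<subseteq> M"
    proof
      fix y assume y: "y \<in> E \<inter> ball x e"
      then have "y \<notin> \<Union>(\<M> - {M})" using T(2) e(2) by blast
      then show "y \<in> M" using y M(1) by blast
    qed
    then show ?thesis using e(1) by blast
  qed
  show ?thesis
  proof (rule finite_covering_bundle[OF cont fE conn fin _ _ cl])
    fix x assume "x \<in> E"
    then obtain M where MM: "M \<in> \<M>" "x \<in> M" using M(1) by blast
    obtain e e' where e: "e > 0" "E \<inter> ball x e \<subseteq> M" "e' > 0" "inj_on f (M \<inter> ball x e')"
      using local[OF MM] inj[OF MM] by blast
    have "inj_on f (E \<inter> ball x (min e e'))" by (rule inj_on_subset[OF e(4)]) (use e(2) in auto)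
    then show "\<exists>e>0. inj_on f (E \<inter> ball x e)" using e(1,3) by (intro exI[of _ "min e e'"]) auto
    fix W assume "open W" "x \<in> W"
    then obtain e where "e > 0" "R \<inter> ball (f x) e \<subseteq> f ` (M \<inter> W)" using op[OF MM] by blast
    then show "\<exists>e>0. R \<inter> ball (f x) e \<subseteq> f ` (E \<inter> W)" using ME[OF MM(1)] by blast
  qed
qed

section \<open>The Jelonek flag\<close>

lemma adim_empty: "adim {} = 0"
  by (simp add: adim_def not_alg_indep_empty)

lemma zero_dimensional_connected:
  assumes M: "smooth_submanifold 0 M" and conn: "connected M" and p: "p \<in> M"
  shows "M = {p}"
proof -
  obtain U V g h L where "chart 0 M p U V g h L"
    using M p smooth_point_chart unfolding smooth_submanifold_def by blast
  then interpret chart 0 M p U V g h L .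
  have L0: "v = 0" if "v \<in> L" for v using L(2) that dim_eq_0[of L] by blast
  have "M \<inter> U = {p}"
  proof (intro equalityI subsetI)
    fix x assume x: "x \<in> M \<inter> U"
    then have "g x = 0" using g_flat[of x] L0 by blast
    moreover have "g p = 0" using base L0 by blast
    ultimately have "h (g x) = h (g p)" by simp
    then show "x \<in> {p}" using inverses(1) x pS by simp
  qed (use pS in auto)
  moreover have "openin (top_of_set M) (M \<inter> U)" using opens(1) by (rule openin_open_Int)
  moreover have "closedin (top_of_set M) {p}" using p by (simp add: closed_subset)
  ultimately show ?thesis using conn unfolding connected_clopen by auto
qed

text \<open>Over a point the total space itself serves as fiber.\<close>

lemma singleton_bundle:
  assumes "continuous_on E f" "f ` E \<subseteq> {b}"
  shows "locally_trivial_bundle f E {b}"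
  unfolding locally_trivial_bundle_def
proof (intro conjI exI[of _ E] ballI)
  fix y assume y: "y \<in> {b}"
  have E: "{x\<in>E. f x \<in> {b}} = E" using assms(2) by blast
  have "homeomorphism E ({b} \<times> E) (\<lambda>x. (f x, x)) snd"
    unfolding homeomorphism_def
    using assms by (auto intro!: continuous_intros image_eqI)
  then have "homeomorphism {x\<in>E. f x \<in> {b}} ({b} \<times> E) (\<lambda>x. (f x, x)) snd" unfolding E .
  then show "\<exists>U g h. openin (top_of_set {b}) U \<and> y \<in> U \<and>
        homeomorphism {x\<in>E. f x \<in> U} (U \<times> E) g h \<and> (\<forall>x\<in>E. f x \<in> U \<longrightarrow> fst (g x) = f x)"
    using y by (intro exI[of _ "{b}"] exI[of _ "\<lambda>x. (f x, x)"] exI[of _ snd]) auto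
qed (use assms in auto)

lemma complex_points_antimono: "P \<subseteq> P' \<Longrightarrow> complex_points P' \<subseteq> complex_points P"
  unfolding complex_points_def zero_set_def by blast

lemma vanishing_ideal_antimono: "A \<subseteq> B \<Longrightarrow> vanishing_ideal B \<subseteq> vanishing_ideal A"
  unfolding vanishing_ideal_def by blast

lemma zero_set_vanishing_ideal: "A \<subseteq> zero_set (vanishing_ideal A)" "A \<subseteq> zero_set P \<Longrightarrow> P \<subseteq> vanishing_ideal A"
  unfolding vanishing_ideal_def zero_set_def by blast+

lemma jelonek_set_mono: "S \<subseteq> S' \<Longrightarrow> T \<subseteq> T' \<Longrightarrow> jelonek_set S T f \<subseteq> jelonek_set S' T' f"
  unfolding jelonek_set_def by blast

lemma closed_complex_points: "closed (complex_points P)"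
  unfolding complex_points_def by (rule closed_zero_set)

locale jelonek_flags =
  fixes P :: "('n::finite, real) mpoly set" and Q :: "('m::finite, real) mpoly set"
    and F :: "('n, real) mpoly ^ 'm" and d :: nat and W V
  assumes flag: "jelonek_flag P Q F d W V"
begin

abbreviation "f \<equiv> poly_map F"
abbreviation "CW i \<equiv> complex_points (flag_polys d P W i)"
abbreviation "CV i \<equiv> complex_points (flag_polys d Q V i)"

lemma top: "W d = zero_set P" "V d = zero_set Q"
  using flag unfolding jelonek_flag_def by auto

lemma V_iff: "i < d \<Longrightarrow> y \<in> V i \<longleftrightarrow> cplx y \<in> jelonek_set (CW (Suc i)) (CV (Suc i)) (complex_map F)"
  using flag unfolding jelonek_flag_def by (auto simp: real_points_iff)

lemma W_closure: "i < d \<Longrightarrow> W i = closure {x\<in>zero_set P. f x \<in> V i}"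
  using flag unfolding jelonek_flag_def by blast

lemma cplx_flag: "x \<in> W i \<Longrightarrow> cplx x \<in> CW i" "y \<in> V i \<Longrightarrow> cplx y \<in> CV i"
  using zero_set_vanishing_ideal(1) top by (auto simp: flag_polys_def cplx_complex_points)

lemma W_subset: "i < d \<Longrightarrow> W i \<subseteq> zero_set P"
  unfolding W_closure by (rule closure_minimal[OF _ closed_zero_set]) auto

text \<open>Downward induction: the inclusions one level up enlarge both sets of complex points and
  hence the Jelonek set. The top is treated separately because its complex points are those of
  \<open>P\<close> and \<open>Q\<close>.\<close>

lemma step: "i < d \<Longrightarrow> V i \<subseteq> V (Suc i) \<and> W i \<subseteq> W (Suc i) \<and> CW i \<subseteq> CW (Suc i) \<and> CV i \<subseteq> CV (Suc i)"
proof (induction "d - i" arbitrary: i rule: less_induct)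
  case less
  have fi: "flag_polys d P W i = vanishing_ideal (W i)" "flag_polys d Q V i = vanishing_ideal (V i)"
    using less.prems by (auto simp: flag_polys_def)
  show ?case
  proof (cases "Suc i = d")
    case True
    have fd: "flag_polys d P W (Suc i) = P" "flag_polys d Q V (Suc i) = Q" using True by (auto simp: flag_polys_def)
    have V: "V i \<subseteq> zero_set Q"
    proof
      fix y assume "y \<in> V i"
      then have "cplx y \<in> CV (Suc i)" using V_iff[OF less.prems] by (auto simp: jelonek_set_def)
      then show "y \<in> zero_set Q" unfolding fd by (simp add: cplx_complex_points)
    qed
    have W: "W i \<subseteq> zero_set P" by (rule W_subset[OF less.prems])
    show ?thesis
      using V W top True complex_points_antimono[OF zero_set_vanishing_ideal(2)[OF V]]
        complex_points_antimono[OF zero_set_vanishing_ideal(2)[OF W]] unfolding fi fd by auto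
  next
    case False
    then have si: "Suc i < d" using less.prems by simp
    have IH: "V (Suc i) \<subseteq> V (Suc (Suc i))" "W (Suc i) \<subseteq> W (Suc (Suc i))"
      "CW (Suc i) \<subseteq> CW (Suc (Suc i))" "CV (Suc i) \<subseteq> CV (Suc (Suc i))"
      using less.hyps[of "Suc i"] si less.prems by auto
    have fs: "flag_polys d P W (Suc i) = vanishing_ideal (W (Suc i))" "flag_polys d Q V (Suc i) = vanishing_ideal (V (Suc i))"
      using False by (auto simp: flag_polys_def)
    have V: "V i \<subseteq> V (Suc i)"
    proof
      fix y assume "y \<in> V i"
      then have "cplx y \<in> jelonek_set (CW (Suc i)) (CV (Suc i)) (complex_map F)" using V_iff[OF less.prems] by blast
      then have "cplx y \<in> jelonek_set (CW (Suc (Suc i))) (CV (Suc (Suc i))) (complex_map F)"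
        using jelonek_set_mono[OF IH(3,4)] by blast
      then show "y \<in> V (Suc i)" using V_iff[OF si] by blast
    qed
    have W: "W i \<subseteq> W (Suc i)"
      unfolding W_closure[OF less.prems] W_closure[OF si] by (rule closure_mono) (use V in blast)
    show ?thesis
      using V W complex_points_antimono[OF vanishing_ideal_antimono[OF V]]
        complex_points_antimono[OF vanishing_ideal_antimono[OF W]] unfolding fi fs by blast
  qed
qed

lemma V_increasing: "\<forall>i<d. V i \<subseteq> V (Suc i)" and W_increasing: "\<forall>i<d. W i \<subseteq> W (Suc i)"
  using step by blast+

lemma closed_V: "i \<le> d \<Longrightarrow> closed (V i)"
proof (cases "i = d")
  case False
  assume "i \<le> d"
  then have i: "i < d" using False by simp
  have "V i = cplx -` jelonek_set (CW (Suc i)) (CV (Suc i)) (complex_map F)"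
    using V_iff[OF i] by blast
  moreover have "closed (cplx -` jelonek_set (CW (Suc i)) (CV (Suc i)) (complex_map F))"
    by (intro closed_vimage closed_jelonek_set closed_complex_points continuous_cplx)
  ultimately show ?thesis by simp
qed (simp add: top closed_zero_set)

lemma W_preimage: "i \<le> d \<Longrightarrow> x \<in> zero_set P \<Longrightarrow> f x \<in> V i \<Longrightarrow> x \<in> W i"
  using W_closure[of i] top closure_subset[of "{x\<in>zero_set P. f x \<in> V i}"] by (cases "i = d") auto

text \<open>The closure in the construction of \<open>W i\<close> adds only points that still map
  into \<open>V i\<close>, because \<open>V i\<close> is closed.\<close>

lemma W_image: "i < d \<Longrightarrow> x \<in> W i \<Longrightarrow> f x \<in> V i"
proof -
  assume i: "i < d" and x: "x \<in> W i"
  have "closed (f -` V i)"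
    using i by (intro closed_vimage closed_V continuous_poly_map) simp
  then have "W i \<subseteq> f -` V i" unfolding W_closure[OF i] by (intro closure_minimal) auto
  then show "f x \<in> V i" using x by blast
qed

text \<open>The index shift of the flag: \<open>V (i - 1)\<close> consists of the real Jelonek
  points of the map at level \<open>i\<close>, which requires \<open>0 < i\<close>.\<close>

lemma outside_jelonek:
  assumes "0 < i" "i \<le> d" "y \<in> flag_diff V i"
  shows "cplx y \<in> CV i" "cplx y \<notin> jelonek_set (CW i) (CV i) (complex_map F)" "y \<in> V i"
proof -
  have y: "y \<in> V i" "y \<notin> V (i - 1)" using assms by (auto simp: flag_diff_def)
  show "cplx y \<in> CV i" "y \<in> V i" using cplx_flag(2) y by auto
  show "cplx y \<notin> jelonek_set (CW i) (CV i) (complex_map F)"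
    using V_iff[of "i - 1" y] y(2) assms(1,2) by simp
qed

lemma finite_fiber:
  assumes "0 < i" "i \<le> d" "y \<in> flag_diff V i"
  shows "finite {x\<in>zero_set P. f x = y}"
proof -
  note o = outside_jelonek[OF assms]
  have "cplx ` {x\<in>zero_set P. f x = y} \<subseteq> {z\<in>CW i. complex_map F z = cplx y}"
    using W_preimage[OF assms(2)] o(3) cplx_flag(1) complex_map_cplx by auto
  then have "finite (cplx ` {x\<in>zero_set P. f x = y})"
    using finite_fiber_outside_jelonek[OF o(1,2)] finite_subset by blast
  moreover have "inj_on cplx {x\<in>zero_set P. f x = y}"
    by (rule inj_onI) (simp add: cplx_def vec_eq_iff)
  ultimately show ?thesis by (simp add: finite_image_iff)
qed

text \<open>Properness over compact sets: a sequence over \<open>K\<close> that goes to infinity has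
  a subsequence whose images converge in \<open>K\<close>, and the limit would be a Jelonek
  point.\<close>

lemma bounded_preimage:
  assumes "0 < i" "i \<le> d" "K \<subseteq> flag_diff V i" "compact K"
  shows "bounded {x\<in>zero_set P. f x \<in> K}"
proof (rule ccontr)
  assume "\<not> ?thesis"
  then obtain z where z: "\<And>k::nat. z k \<in> {x\<in>zero_set P. f x \<in> K}" "filterlim (\<lambda>k. norm (z k)) at_top sequentially"
    by (rule unbounded_sequence) blast
  have "\<exists>l\<in>K. \<exists>r. strict_mono r \<and> ((\<lambda>k. f (z k)) \<circ> r) \<longlonglongrightarrow> l"
    using assms(4) z(1) unfolding compact_def by (elim allE[of _ "\<lambda>k. f (z k)"]) simp
  then obtain y r where y: "y \<in> K" "strict_mono r" "((\<lambda>k. f (z k)) \<circ> r) \<longlonglongrightarrow> y" by blast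
  have yV: "y \<in> flag_diff V i" using y(1) assms(3) by blast
  have "cplx (z (r k)) \<in> CW i" for k
  proof -
    have "f (z (r k)) \<in> V i" using z(1)[of "r k"] assms(3) by (auto simp: flag_diff_def)
    then show ?thesis using W_preimage[OF assms(2)] z(1)[of "r k"] cplx_flag(1) by blast
  qed
  moreover have "filterlim (\<lambda>k. norm (cplx (z (r k)))) at_top sequentially"
    unfolding norm_cplx using filterlim_compose[OF z(2) filterlim_subseq[OF y(2)]] .
  moreover have "(\<lambda>k. complex_map F (cplx (z (r k)))) \<longlonglongrightarrow> cplx y"
  proof -
    have "isCont cplx y" by (metis continuous_cplx continuous_on_eq_continuous_at open_UNIV UNIV_I)
    from isCont_tendsto_compose[OF this y(3)] show ?thesis by (simp add: complex_map_cplx o_def)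
  qed
  ultimately have "cplx y \<in> jelonek_set (CW i) (CV i) (complex_map F)"
    using outside_jelonek(1)[OF assms(1,2) yV] unfolding jelonek_set_def
    by (intro CollectI conjI exI[of _ "\<lambda>k. cplx (z (r k))"]) auto
  then show False using outside_jelonek(2)[OF assms(1,2) yV] by blast
qed

text \<open>A convergent sequence of image points together with its limit is compact, and so is its
  preimage; a convergent subsequence of preimages then lies over the limit.\<close>

lemma closed_map_over:
  assumes i: "0 < i" "i \<le> d" and R: "R \<subseteq> flag_diff V i"
    and C: "closedin (top_of_set {x\<in>zero_set P. f x \<in> R}) C"
  shows "closedin (top_of_set R) (f ` C)"
proof -
  obtain T where T: "closed T" "C = {x\<in>zero_set P. f x \<in> R} \<inter> T" using C unfolding closedin_closed by blast
  have "y \<in> f ` C" if y: "y \<in> R" "y \<in> closure (f ` C)" for y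
  proof -
    obtain s where s: "\<And>n. s n \<in> f ` C" "s \<longlonglongrightarrow> y" using y(2) unfolding closure_sequential by blast
    then have "\<forall>n. \<exists>x. x \<in> C \<and> f x = s n" by (metis imageE)
    then obtain x where x: "\<And>n. x n \<in> C" "\<And>n. f (x n) = s n" by metis
    define K where "K = insert y (range s)"
    have compK: "compact K" unfolding K_def by (rule compact_sequence_with_limit[OF s(2)])
    have "f ` C \<subseteq> R" using T(2) by auto
    then have KR: "K \<subseteq> R" using s(1) y(1) unfolding K_def by blast
    define B where "B = {x\<in>zero_set P. f x \<in> K}"
    have "bounded B" unfolding B_def by (rule bounded_preimage[OF i _ compK]) (use KR R in blast)
    moreover have "closed B"
    proof -
      have "B = zero_set P \<inter> f -` K" by (auto simp: B_def)
      moreover have "closed (zero_set P \<inter> f -` K)"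
        by (intro closed_Int closed_zero_set closed_vimage compact_imp_closed compK continuous_poly_map)
      ultimately show ?thesis by simp
    qed
    ultimately have "compact B" by (simp add: compact_eq_bounded_closed)
    moreover have "\<forall>n. x n \<in> B" using x T(2) by (auto simp: B_def K_def)
    ultimately have "\<exists>l\<in>B. \<exists>r. strict_mono r \<and> (x \<circ> r) \<longlonglongrightarrow> l"
      unfolding compact_def by (elim allE[of _ x]) simp
    then obtain l r where l: "l \<in> B" "strict_mono r" "(x \<circ> r) \<longlonglongrightarrow> l" by blast
    have "isCont f l" using continuous_poly_map[of UNIV F] by (simp add: continuous_on_eq_continuous_at)
    from isCont_tendsto_compose[OF this l(3)] have "(\<lambda>n. s (r n)) \<longlonglongrightarrow> f l" using x(2) by (simp add: o_def)
    moreover have "(\<lambda>n. s (r n)) \<longlonglongrightarrow> y" using LIMSEQ_subseq_LIMSEQ[OF s(2) l(2)] by (simp add: o_def)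
    ultimately have fl: "f l = y" by (rule LIMSEQ_unique)
    have "l \<in> T" using closed_sequentially[OF T(1) _ l(3)] x(1) T(2) by auto
    then have "l \<in> C" using fl y(1) l(1) T(2) by (auto simp: B_def)
    then show ?thesis using fl by blast
  qed
  moreover have "f ` C \<subseteq> R" using T(2) by auto
  ultimately have eq: "f ` C = R \<inter> closure (f ` C)" using closure_subset[of "f ` C"] by blast
  show ?thesis unfolding closedin_closed
  proof (intro exI conjI)
    show "closed (closure (f ` C))" by (rule closed_closure)
  qed (rule eq)
qed

end

text \<open>Subordination confines a stratum to a single difference \<open>flag_diff V j\<close>,
  and meeting \<open>V i\<close> forces \<open>j \<le> i\<close>.\<close>

lemma stratum_subset_of_flag:
  assumes mono: "\<forall>i<d. V i \<subseteq> V (Suc i)" and sub: "subordinate YS l V d"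
    and N: "N \<in> strata YS l" "N \<inter> V i \<noteq> {}" and i: "i \<le> d"
  shows "N \<subseteq> V i"
proof -
  obtain j where j: "j \<le> d" "N \<subseteq> flag_diff V j" using sub N(1) unfolding subordinate_def by blast
  obtain x where x: "x \<in> N" "x \<in> V i" using N(2) by blast
  have "j \<le> i"
  proof (rule ccontr)
    assume "\<not> j \<le> i"
    then have "V i \<subseteq> V (j - 1)" using j(1) by (intro flag_mono[OF mono]) auto
    then show False using x j(2) \<open>\<not> j \<le> i\<close> by (auto simp: flag_diff_def split: if_splits)
  qed
  then have "V j \<subseteq> V i" using flag_mono[OF mono] i by blast
  then show ?thesis using j(2) by (auto simp: flag_diff_def)
qed

section \<open>Comparison of dimensions and the bundle theorem\<close>

lemma real_dim_le_adim: "real_dim S \<le> ereal (real (adim S))"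
  unfolding real_dim_def by (rule SUP_least) (auto dest: smooth_point_adim)

lemma smooth_point_real_dim: "smooth_point k S p \<Longrightarrow> ereal (real k) \<le> real_dim S"
  unfolding real_dim_def by (rule SUP_upper) blast

theorem theorem4p9:
  fixes P :: "('n::finite, real) mpoly set"
    and Q :: "('m::finite, real) mpoly set"
    and F :: "('n, real) mpoly ^ 'm"
    and X :: "(real ^ 'n) set" and Y :: "(real ^ 'm) set"
    and f :: "real ^ 'n \<Rightarrow> real ^ 'm"
    and W XS :: "nat \<Rightarrow> (real ^ 'n) set"
    and V YS :: "nat \<Rightarrow> (real ^ 'm) set"
    and d k l i :: nat
    and R :: "(real ^ 'm) set"
  assumes X: "X = zero_set P"
    and Y: "Y = zero_set Q"
    and f: "f = poly_map F"
    and morphism: "variety_morphism P Q F"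
    and dims: "real_dim X = ereal (real d)" "real_dim Y = ereal (real d)"
    and dominant: "zariski_dense_in (complex_map F ` complex_points P) (complex_points Q)"
    and complex_dims: "complex_dim (complex_points P) = ereal (real d)"
      "complex_dim (complex_points Q) = ereal (real d)"
    and flag: "jelonek_flag P Q F d W V"
    and stratX: "whitney_stratification X XS k" "subordinate XS k W d"
    and stratY: "whitney_stratification Y YS l" "subordinate YS l V d"
    and stratified: "stratified_map f XS k YS l"
    and i: "i \<le> d" "real_dim (V i) = real_dim (W i)"
    and R: "R \<in> strata YS l" "R \<subseteq> flag_diff V i"
  shows "locally_trivial_bundle f {x \<in> X. f x \<in> R} R"
proof -
  interpret jf: jelonek_flags P Q F d W V by unfold_locales (rule flag)
  note wX = whitney_stratificationD[OF stratX(1)] and wY = whitney_stratificationD[OF stratY(1)]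
  obtain j where j: "j \<le> l" "R \<in> components (flag_diff YS j)" using strata_level[OF R(1)] .
  have smR: "smooth_submanifold j R" by (rule wY(4)[OF j])
  have connR: "connected R" using j(2) by (rule in_components_connected)
  obtain b where b: "b \<in> R" using in_components_nonempty[OF j(2)] by blast
  have contf: "continuous_on S f" for S unfolding f by (rule continuous_poly_map)
  \<comment> \<open>Stated for an arbitrary positive level \<open>i'\<close>, because in the
    dimension count the level of the image stratum is not known in advance.\<close>
  have equidim: "r = j'" "\<exists>e>0. inj_on f (M \<inter> ball x e)"
    "open G \<Longrightarrow> x \<in> G \<Longrightarrow> \<exists>e>0. N \<inter> ball (f x) e \<subseteq> f ` (M \<inter> G)"
    if M: "r \<le> k" "M \<in> components (flag_diff XS r)" "x \<in> M"
      and N: "j' \<le> l" "N \<in> components (flag_diff YS j')" "smooth_submersion f M N"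
      and y: "0 < i'" "i' \<le> d" "f x \<in> flag_diff V i'" for r M x j' N i' G
  proof -
    have "M \<subseteq> X"
      using in_components_subset[OF M(2)] flag_mono[OF wX(2) M(1) order_refl] wX(3) by (auto simp: flag_diff_def)
    then have "finite {z\<in>M. f z = f x}"
      using jf.finite_fiber[OF y(1,2) y(3)[unfolded f]] finite_subset[of "{z\<in>M. f z = f x}" "{z\<in>zero_set P. poly_map F z = poly_map F x}"]
      unfolding X f by blast
    from submersion_finite_fiber[OF wX(4)[OF M(1,2)] wY(4)[OF N(1,2)] N(3) M(3) this]
    show "r = j'" "\<exists>e>0. inj_on f (M \<inter> ball x e)"
      "open G \<Longrightarrow> x \<in> G \<Longrightarrow> \<exists>e>0. N \<inter> ball (f x) e \<subseteq> f ` (M \<inter> G)" by blast+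
  qed
  show ?thesis
  proof (cases "j = 0")
    case True
    then have "R = {b}" using zero_dimensional_connected smR connR b by blast
    then show ?thesis using singleton_bundle[OF contf, of "{x\<in>X. f x \<in> R}" b] by auto
  next
    case False
    have "0 < i"
    proof (rule ccontr)
      assume "\<not> 0 < i"
      then have i0: "i = 0" by simp
      have RV: "R \<subseteq> V 0" using R(2) by (simp add: i0 flag_diff_def)
      have "j \<le> adim R" using smR b smooth_point_adim unfolding smooth_submanifold_def by blast
      then have e: "0 < adim (V 0)" using adim_mono[OF RV] False by simp
      have Vne: "V n \<noteq> {}" if "n \<le> d" for n
        using flag_mono[OF jf.V_increasing, of 0 n] RV b that by blast
      \<comment> \<open>The hypothesis compares values of \<open>real_dim\<close>. It passes to
        \<open>adim\<close> through a smooth point of full dimension in \<open>W 0\<close> and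
        through \<open>real_dim_le_adim\<close> for \<open>V 0\<close>.\<close>
      have W0: "adim (W 0) \<le> adim (V 0)"
      proof (cases "W 0 = {}")
        case True
        then show ?thesis by (simp add: adim_empty)
      next
        case False
        have "W 0 \<subseteq> X" using flag_mono[OF jf.W_increasing, of 0 d] jf.top X by simp
        from strata_dimension[OF stratX(1) False this stratum_subset_of_flag[OF jf.W_increasing stratX(2)]]
        obtain p where "smooth_point (adim (W 0)) (W 0) p" by blast
        then have "ereal (real (adim (W 0))) \<le> real_dim (W 0)" by (rule smooth_point_real_dim)
        also have "\<dots> \<le> ereal (real (adim (V 0)))" using i(2) real_dim_le_adim[of "V 0"] by (simp add: i0)
        finally show ?thesis by simp
      qed
      \<comment> \<open>The range stops before \<open>d\<close>: at level \<open>d\<close> the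
        complex points come from \<open>P\<close> instead of a vanishing ideal, and
        \<open>adim_drop\<close> does not apply.\<close>
      have grow: "n < d \<Longrightarrow> adim (V 0) + n \<le> adim (V n)" for n
      proof (induction n)
        case (Suc n)
        have "cplx ` V n \<subseteq> jelonek_set (complex_points (vanishing_ideal (W (Suc n)))) (jf.CV (Suc n)) (complex_map F)"
          using jf.V_iff[of n] Suc.prems by (auto simp: flag_polys_def)
        from adim_drop[OF Vne this] have a: "adim (V 0) + Suc n \<le> adim (W (Suc n))" using Suc by simp
        have Wne: "W (Suc n) \<noteq> {}"
        proof
          assume "W (Suc n) = {}"
          then show False using a by (simp add: adim_empty)
        qed
        have WX: "W (Suc n) \<subseteq> X" using jf.W_subset[OF Suc.prems] X by simp
        have union: "M \<in> strata XS k \<Longrightarrow> M \<inter> W (Suc n) \<noteq> {} \<Longrightarrow> M \<subseteq> W (Suc n)" for M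
          using stratum_subset_of_flag[OF jf.W_increasing stratX(2)] Suc.prems by simp
        obtain M p where M: "M \<in> components (flag_diff XS (adim (W (Suc n))))" "adim (W (Suc n)) \<le> k"
          "M \<subseteq> W (Suc n)" "p \<in> M"
          using strata_dimension[OF stratX(1) Wne WX union] by blast
        \<comment> \<open>\<open>M\<close> has dimension above \<open>adim (W 0)\<close>. A point of
          \<open>M\<close> outside \<open>W 0\<close> has its image outside \<open>V 0\<close>,
          hence at a positive level, where \<open>equidim\<close> applies.\<close>
        have "\<not> M \<subseteq> W 0"
        proof
          assume "M \<subseteq> W 0"
          have "smooth_point (adim (W (Suc n))) M p" using wX(4)[OF M(2,1)] M(4) unfolding smooth_submanifold_def by blast
          then have "adim (W (Suc n)) \<le> adim (W 0)" using smooth_point_adim adim_mono[OF \<open>M \<subseteq> W 0\<close>] le_trans by blast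
          then show False using a W0 by simp
        qed
        then obtain x where x: "x \<in> M" "x \<notin> W 0" by blast
        have "M \<in> strata XS k" using M(1,2) unfolding strata_def by blast
        then obtain N where N: "N \<in> strata YS l" "smooth_submersion f M N"
          using stratified unfolding stratified_map_def by blast
        have fx: "f x \<in> N" using N(2) x(1) unfolding smooth_submersion_def by blast
        have fV: "f x \<in> V (Suc n)" using jf.W_image[OF Suc.prems] M(3) x(1) f by blast
        obtain i' where i': "i' \<le> d" "N \<subseteq> flag_diff V i'" using stratY(2) N(1) unfolding subordinate_def by blast
        have "f x \<notin> V 0" using jf.W_preimage[of 0 x] x WX M(3) X f by auto
        then have "0 < i'" using i'(2) fx by (cases i') (auto simp: flag_diff_def)
        obtain j' where j': "j' \<le> l" "N \<in> components (flag_diff YS j')" using strata_level[OF N(1)] .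
        have "f x \<in> flag_diff V i'" using i'(2) fx by blast
        from equidim(1)[OF M(2,1) x(1) j' N(2) \<open>0 < i'\<close> i'(1) this] have "adim (W (Suc n)) = j'" .
        moreover have "j' \<le> adim N" using wY(4)[OF j'] fx smooth_point_adim unfolding smooth_submanifold_def by blast
        moreover have "N \<subseteq> V (Suc n)"
          using stratum_subset_of_flag[OF jf.V_increasing stratY(2) N(1)] fx fV Suc.prems by (metis IntI empty_iff less_imp_le)
        ultimately show ?case using a adim_mono[of N "V (Suc n)"] by simp
      qed simp
      show False
      proof (cases d)
        \<comment> \<open>Without a Jelonek step \<open>V 0\<close> is \<open>Y\<close> itself, and
          \<open>real_dim Y = 0\<close> contradicts \<open>adim (V 0) > 0\<close>.\<close>
        case 0
        have "V 0 = Y" using jf.top Y 0 by simp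
        then have ne: "Y \<noteq> {}" using Vne[of 0] 0 by simp
        have sub: "M \<subseteq> Y" if MS: "M \<in> strata YS l" for M
        proof -
          obtain m where m: "m \<le> l" "M \<in> components (flag_diff YS m)" using strata_level[OF MS] .
          have "M \<subseteq> YS m" using in_components_subset[OF m(2)] by (auto simp: flag_diff_def)
          then show ?thesis using flag_mono[OF wY(2) m(1) order_refl] wY(3) by blast
        qed
        from strata_dimension[OF stratY(1) ne order_refl sub]
        obtain p where "smooth_point (adim Y) Y p" by blast
        then have "ereal (real (adim Y)) \<le> real_dim Y" by (rule smooth_point_real_dim)
        then show False using dims(2) e \<open>V 0 = Y\<close> 0 by simp
      next
        case (Suc n)
        have "cplx ` V n \<subseteq> jelonek_set (complex_points P) (jf.CV (Suc n)) (complex_map F)"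
          using jf.V_iff[of n] Suc by (auto simp: flag_polys_def)
        \<comment> \<open>Here \<open>d = Suc n\<close>: the complex dimension gives
          \<open>adim (V n) \<le> n\<close>, while \<open>grow\<close> gives at least
          \<open>adim (V 0) + n\<close>.\<close>
        from complex_dim_drop[OF Vne this] have "Suc (adim (V n)) \<le> d" using complex_dims(1) Suc by simp
        then show False using grow[of n] e Suc by simp
      qed
    qed
    define E where "E = {x\<in>X. f x \<in> R}"
    define \<M> where "\<M> = {M\<in>strata XS k. M \<inter> E \<noteq> {}}"
    \<comment> \<open>A stratum meeting \<open>E\<close> is mapped into one stratum of
      \<open>Y\<close>, which can only be \<open>R\<close>; hence it lies in \<open>E\<close>, and
      \<open>equidim\<close> fixes its dimension as \<open>j\<close>.\<close>
    have over: "smooth_submersion f M R" "M \<subseteq> E" "M \<in> components (flag_diff XS j)" "j \<le> k" if MM: "M \<in> \<M>" for M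
    proof -
      have Ms: "M \<in> strata XS k" "M \<inter> E \<noteq> {}" using MM by (auto simp: \<M>_def)
      obtain N where N: "N \<in> strata YS l" "smooth_submersion f M N"
        using stratified Ms(1) unfolding stratified_map_def by blast
      obtain x where x: "x \<in> M" "x \<in> E" using Ms(2) by blast
      have "f x \<in> N" using N(2) x(1) unfolding smooth_submersion_def by blast
      moreover have fx: "f x \<in> R" using x(2) by (simp add: E_def)
      ultimately have NR: "N = R" using strata_unique[OF wY(2) N(1) R(1)] by blast
      then show sub: "smooth_submersion f M R" using N(2) by simp
      obtain r where r: "r \<le> k" "M \<in> components (flag_diff XS r)" using strata_level[OF Ms(1)] .
      have "M \<subseteq> X"
        using in_components_subset[OF r(2)] flag_mono[OF wX(2) r(1) order_refl] wX(3) by (auto simp: flag_diff_def)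
      then show "M \<subseteq> E" using sub unfolding E_def smooth_submersion_def by blast
      have "f x \<in> flag_diff V i" using fx R(2) by blast
      from equidim(1)[OF r x(1) j sub \<open>0 < i\<close> i(1) this] have "r = j" .
      then show "M \<in> components (flag_diff XS j)" "j \<le> k" using r by auto
    qed
    have "locally_trivial_bundle f E R"
    proof (rule stratified_covering_bundle[where \<M> = \<M>])
      show "continuous_on E f" "connected R" by (fact contf connR)+
      show "f ` E \<subseteq> R" by (auto simp: E_def)
      show "R \<noteq> {}" using b by blast
      show "finite {x\<in>E. f x = y}" if "y \<in> R" for y
        using jf.finite_fiber[OF \<open>0 < i\<close> i(1)] R(2) that
        by (intro finite_subset[OF _ jf.finite_fiber[OF \<open>0 < i\<close> i(1), of y]]) (auto simp: E_def X f)
      show "closedin (top_of_set R) (f ` C)" if "closedin (top_of_set E) C" for C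
        using jf.closed_map_over[OF \<open>0 < i\<close> i(1) R(2), of C] that unfolding E_def X f .
      show "\<Union>\<M> = E"
      proof (intro equalityI subsetI)
        fix x assume x: "x \<in> E"
        then have "x \<in> XS k" using wX(3) by (simp add: E_def)
        then obtain r M where "M \<in> strata XS k" "x \<in> M" by (rule strata_exists)
        then show "x \<in> \<Union>\<M>" using x unfolding \<M>_def by blast
      qed (use over(2) in blast)
      show "disjoint \<M>"
        unfolding disjoint_def \<M>_def using strata_unique[OF wX(2)] by blast
      show "{} \<notin> \<M>" by (simp add: \<M>_def)
      \<comment> \<open>All strata over \<open>R\<close> have the same dimension, so
        \<open>E\<close> lies in one difference of the filtration, whose components are relatively
        closed.\<close>
      have Ej: "E \<subseteq> flag_diff XS j"
        using \<open>\<Union>\<M> = E\<close> over(3) in_components_subset by blast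
      show "closedin (top_of_set E) M" if "M \<in> \<M>" for M
      proof -
        have "closedin (top_of_set (flag_diff XS j)) M" using over(3)[OF that] by (rule closedin_component)
        then show ?thesis using over(2)[OF that] Ej by (rule closedin_subset_trans)
      qed
      fix M x assume M: "M \<in> \<M>" "x \<in> M"
      have "f x \<in> flag_diff V i" using over(1)[OF M(1)] M(2) R(2) unfolding smooth_submersion_def by blast
      note eq = equidim[OF over(4)[OF M(1)] over(3)[OF M(1)] M(2) j over(1)[OF M(1)] \<open>0 < i\<close> i(1) this]
      show "\<exists>e>0. inj_on f (M \<inter> ball x e)" by (rule eq(2))
      show "\<exists>e>0. R \<inter> ball (f x) e \<subseteq> f ` (M \<inter> G)" if "open G" "x \<in> G" for G by (rule eq(3)[OF that])
    qed
    then show ?thesis by (simp add: E_def)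
  qed
qed

end
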